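(* Let $\Gamma\subset SL_2(\mathbb R)$ be a Fuchsian group of the first kind and let $m\ge 4$ be an even integer. Then the map $f\longmapsto \omega_f$ from cusp forms of weight $m$ to meromorphic differentials of degree $m/2$ on $\mathfrak R_\Gamma$ induces an isomorphism of $S^H_m(\Gamma)$ onto $H^{m/2}(\mathfrak R_\Gamma)$.
   Context: A Fuchsian group of the first kind is a discrete subgroup $\Gamma\subset SL_2(\mathbb R)$ with $\iint_{\Gamma\backslash\mathbb H} dx\,dy/y^2<\infty$. For $g=\begin{pmatrix}a&b\\c&d\end{pmatrix}\in SL_2(\mathbb R)$ put $j(g,z)=cz+d$ and $(f|_m g)(z)=j(g,z)^{-m}f(g.z)$. $\mathfrak R_\Gamma$ is the compact Riemann surface obtained from $\Gamma\backslash\mathbb H$ by adding the finitely many $\Gamma$-orbits of cusps. $M_m(\Gamma)$ (resp. $S_m(\Gamma)$) is the space of holomorphic $f:\mathbb H\to\mathbb C$ with $f(\gamma.z)=j(\gamma,z)^m f(z)$ for all $\gamma\in\Gamma$ that are holomorphic (resp. holomorphic and vanishing) at every cusp of $\Gamma$. Orders. For $\xi\in\mathbb H$ let $e_\xi=\#(\Gamma_\xi/(\Gamma\cap\{\pm1\}))$; $\xi$ is elliptic if $e_\xi>1$. For the image $\mathfrak a_\xi\in\mathfrak R_\Gamma$ of $\xi$ put $e_{\mathfrak a_\xi}=e_\xi$, and for $0\ne f\in M_m(\Gamma)$ put $\nu_{\mathfrak a_\xi}(f)=\nu_{z-\xi}(f)/e_\xi$, where $\nu_{z-\xi}(f)$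 is the order of vanishing of $f$ at $\xi$. If $x$ is a cusp, choose $\sigma\in SL_2(\mathbb R)$ with $\sigma.x=\infty$ and $h'>0$ with $\{\pm1\}\sigma\Gamma_x\sigma^{-1}=\{\pm1\}\{\begin{pmatrix}1&lh'\\0&1\end{pmatrix}: l\in\mathbb Z\}$; for $m$ even write $(f|_m\sigma^{-1})(z)=\sum_{n\ge0}a_ne^{2\pi\sqrt{-1}nz/h'}$ and let $\nu_{\mathfrak b}(f)$ be the least $n$ with $a_n\ne0$, where $\mathfrak b$ is the point of $\mathfrak R_\Gamma$ corresponding to $x$. Put $\mathrm{div}(f)=\sum_{\mathfrak a}\nu_{\mathfrak a}(f)\mathfrak a\in\mathbb Q\otimes\mathrm{Div}(\mathfrak R_\Gamma)$. For divisors, $\mathfrak d_1\ge\mathfrak d_2$ means $\mathfrak d_1-\mathfrak d_2$ is an integral divisor with non-negative coefficients. For even $m\ge2$ and $0\ne f\in M_m(\Gamma)$ the divisor $$\mathfrak c'_f=\mathrm{div}(f)-\sum_{\mathfrak a\ \text{elliptic}}\left(\tfrac m2(1-1/e_{\mathfrak a})-\left[\tfrac m2(1-1/e_{\mathfrak a})\right]\right)\mathfrak a$$ ($[x]$ is the largest integer $\le x$) is integral and $\ge0$. If $f\in S_m(\Gamma)$, put $\mathfrak c_f=\mathfrak c'_f-\sum_{\mathfrak b\ \text{cusp}}\mathfrak b\ \ (\ge0)$. Define $S^H_m(\Gamma)$ as the set of $f\in S_m(\Gamma)$ such that $f=0$ or $$\mathfrak c_f\ge\sum_{\mathfrak a\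 \text{elliptic}}\left[\tfrac m2(1-1/e_{\mathfrak a})\right]\mathfrak a+\left(\tfrac m2-1\right)\sum_{\mathfrak b\ \text{cusp}}\mathfrak b .$$ $H^l(\mathfrak R_\Gamma)$ is the space of holomorphic differentials of degree $l$ on $\mathfrak R_\Gamma$ (locally $\varphi(z)(dz)^l$ with $\varphi$ holomorphic). For even $m$ and $f$ of weight $m$, $\omega_f$ is the unique meromorphic differential of degree $m/2$ on $\mathfrak R_\Gamma$ whose pull-back to $\mathbb H$ is $f(z)(dz)^{m/2}$. *)

theory Defs
  imports
    "HOL-Complex_Analysis.Complex_Analysis"
    "HOL-Algebra.Coset"
    "HOL-Library.Function_Algebras"
begin

section \<open>The action of SL(2,R)\<close>

definition SL2R :: "(real^2^2) monoid" where
  "SL2R = \<lparr>carrier = {g. det g = 1}, monoid.mult = (**), one = mat 1\<rparr>"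

definition uhp :: "complex set" where
  "uhp = {z. Im z > 0}"

definition autf :: "real^2^2 \<Rightarrow> complex \<Rightarrow> complex" where
  "autf g z = of_real (g$2$1) * z + of_real (g$2$2)"

definition mob :: "real^2^2 \<Rightarrow> complex \<Rightarrow> complex" where
  "mob g z = (of_real (g$1$1) * z + of_real (g$1$2)) / autf g z"

definition slash :: "nat \<Rightarrow> (complex \<Rightarrow> complex) \<Rightarrow> real^2^2 \<Rightarrow> complex \<Rightarrow> complex" where
  "slash m f g z = f (mob g z) / autf g z ^ m"

text \<open>The Riemann sphere; it accommodates both the points of the upper half plane and the cusps,
  which lie on the real line or are equal to \<open>Infty\<close>.\<close>

datatype csphere = Fin complex | Infty

fun act :: "real^2^2 \<Rightarrow> csphere \<Rightarrow> csphere" where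
  "act g (Fin z) = (if autf g z = 0 then Infty else Fin (mob g z))"
| "act g Infty = (if g$2$1 = 0 then Infty else Fin (of_real (g$1$1 / g$2$1)))"

definition stab :: "(real^2^2) set \<Rightarrow> csphere \<Rightarrow> (real^2^2) set" where
  "stab \<Gamma> p = {g \<in> \<Gamma>. act g p = p}"

definition orb :: "(real^2^2) set \<Rightarrow> csphere \<Rightarrow> csphere set" where
  "orb \<Gamma> p = (\<lambda>g. act g p) ` \<Gamma>"


section \<open>Fuchsian groups of the first kind\<close>

text \<open>The integral of \<open>dx dy / y\<^sup>2\<close> over the quotient is computed over a Borel set of
  representatives of the orbits; it does not depend on the choice of this set.\<close>

definition finite_covolume :: "(real^2^2) set \<Rightarrow> bool" where
  "finite_covolume \<Gamma> \<longleftrightarrow>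
     (\<exists>F \<in> sets borel. F \<subseteq> uhp \<and> (\<forall>z\<in>uhp. \<exists>!w. w \<in> F \<and> Fin w \<in> orb \<Gamma> (Fin z)) \<and>
        (\<integral>\<^sup>+z\<in>F. ennreal (1 / (Im z)\<^sup>2) \<partial>lborel) < \<infinity>)"

definition fuchsian_first_kind :: "(real^2^2) set \<Rightarrow> bool" where
  "fuchsian_first_kind \<Gamma> \<longleftrightarrow> subgroup \<Gamma> SL2R \<and> discrete \<Gamma> \<and> finite_covolume \<Gamma>"

definition parabolic :: "real^2^2 \<Rightarrow> bool" where
  "parabolic g \<longleftrightarrow> g \<noteq> mat 1 \<and> g \<noteq> - mat 1 \<and> \<bar>g$1$1 + g$2$2\<bar> = 2"

definition cusps :: "(real^2^2) set \<Rightarrow> csphere set" where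
  "cusps \<Gamma> = {x. (x = Infty \<or> (\<exists>r::real. x = Fin (of_real r))) \<and> (\<exists>g\<in>\<Gamma>. parabolic g \<and> act g x = x)}"

definition translation :: "real \<Rightarrow> real^2^2" where
  "translation b = vector [vector [1, b], vector [0, 1]]"

text \<open>\<open>cusp_frame \<Gamma> x \<sigma> h\<close>: the matrix \<open>\<sigma>\<close> moves \<open>x\<close> to infinity and \<open>h\<close> is the width of the
  cusp \<open>x\<close> as seen through \<open>\<sigma>\<close>.\<close>

definition cusp_frame :: "(real^2^2) set \<Rightarrow> csphere \<Rightarrow> real^2^2 \<Rightarrow> real \<Rightarrow> bool" where
  "cusp_frame \<Gamma> x \<sigma> h \<longleftrightarrow>
     \<sigma> \<in> carrier SL2R \<and> act \<sigma> x = Infty \<and> h > 0 \<and>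
     {s *\<^sub>R (\<sigma> ** g ** matrix_inv \<sigma>) | s g. s \<in> {1, -1} \<and> g \<in> stab \<Gamma> x} =
     {s *\<^sub>R translation (of_int l * h) | s (l::int). s \<in> {1, -1}}"


section \<open>Modular forms and cusp forms of even weight\<close>

definition fourier_expansion :: "nat \<Rightarrow> (complex \<Rightarrow> complex) \<Rightarrow> real^2^2 \<Rightarrow> real \<Rightarrow> (nat \<Rightarrow> complex) \<Rightarrow> bool" where
  "fourier_expansion m f \<sigma> h a \<longleftrightarrow>
     (\<forall>z\<in>uhp. (\<lambda>n. a n * exp (2 * of_real pi * \<i> * of_nat n * z / of_real h))
                 sums slash m f (matrix_inv \<sigma>) z)"

text \<open>The conditions at the cusps do not depend on the choice of the frame. They are the right ones
  for even \<open>m\<close> only: in odd weight, at an irregular cusp, the expansion runs over half-integers.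
  A function on the upper half plane is represented by its extension by 0 to the plane.\<close>

definition modular_forms :: "(real^2^2) set \<Rightarrow> nat \<Rightarrow> (complex \<Rightarrow> complex) set" where
  "modular_forms \<Gamma> m =
     {f. f holomorphic_on uhp \<and> (\<forall>z. z \<notin> uhp \<longrightarrow> f z = 0) \<and>
         (\<forall>g\<in>\<Gamma>. \<forall>z\<in>uhp. f (mob g z) = autf g z ^ m * f z) \<and>
         (\<forall>x\<in>cusps \<Gamma>. \<exists>\<sigma> h a. cusp_frame \<Gamma> x \<sigma> h \<and> fourier_expansion m f \<sigma> h a)}"

definition cusp_forms :: "(real^2^2) set \<Rightarrow> nat \<Rightarrow> (complex \<Rightarrow> complex) set" where
  "cusp_forms \<Gamma> m =
     {f \<in> modular_forms \<Gamma> m.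
        \<forall>x\<in>cusps \<Gamma>. \<exists>\<sigma> h a. cusp_frame \<Gamma> x \<sigma> h \<and> fourier_expansion m f \<sigma> h a \<and> a 0 = 0}"


section \<open>Riemann surfaces and differentials\<close>

text \<open>A chart consists of its domain and its coordinate function. A Riemann surface is given by an
  atlas, i.e. a set of charts mapping their domains bijectively onto open sets of the plane,
  with overlaps corresponding to open sets and with holomorphic transition functions; the atlas
  determines the topology.\<close>

type_synonym 'a chart = "'a set \<times> ('a \<Rightarrow> complex)"

text \<open>A differential of degree \<open>l\<close>, locally \<open>\<phi>(t) (dt)\<^sup>l\<close>, is the family of its local
  expressions, indexed by the charts. The coefficient functions are normalised (value 0 at poles,
  continuous everywhere else, 0 outside of the image of the chart), so that equal
  differentials are equal families.\<close>

type_synonym 'a mdiff = "'a chart \<Rightarrow> complex \<Rightarrow> complex"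

definition meromorphic_differentials :: "'a chart set \<Rightarrow> nat \<Rightarrow> 'a mdiff set" where
  "meromorphic_differentials A l =
     {\<phi>. (\<forall>c. c \<notin> A \<longrightarrow> \<phi> c = (\<lambda>_. 0)) \<and>
         (\<forall>(U, t)\<in>A. \<phi> (U, t) nicely_meromorphic_on t ` U \<and> (\<forall>z. z \<notin> t ` U \<longrightarrow> \<phi> (U, t) z = 0)) \<and>
         (\<forall>(U, t)\<in>A. \<forall>(V, s)\<in>A. \<forall>p\<in>U \<inter> V.
            \<phi> (U, t) (t p) = \<phi> (V, s) (s p) * deriv (s \<circ> inv_into U t) (t p) ^ l)}"

definition holomorphic_differentials :: "'a chart set \<Rightarrow> nat \<Rightarrow> 'a mdiff set" where
  "holomorphic_differentials A l =
     {\<phi> \<in> meromorphic_differentials A l. \<forall>(U, t)\<in>A. \<phi> (U, t) holomorphic_on t ` U}"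

text \<open>The pull-back of \<open>\<phi>\<close> along a holomorphic map \<open>p\<close> from an open set \<open>S\<close> of the plane to the
  surface is \<open>f(z) (dz)\<^sup>l\<close>. This is equality of meromorphic functions, hence required only in a
  punctured neighbourhood of every point.\<close>

definition pulls_back_to ::
  "'a chart set \<Rightarrow> nat \<Rightarrow> (complex \<Rightarrow> 'a) \<Rightarrow> complex set \<Rightarrow> 'a mdiff \<Rightarrow> (complex \<Rightarrow> complex) \<Rightarrow> bool" where
  "pulls_back_to A l p S \<phi> f \<longleftrightarrow>
     (\<forall>(U, t)\<in>A. \<forall>z\<in>S. p z \<in> U \<longrightarrow>
        (\<forall>\<^sub>F w in at z. f w = \<phi> (U, t) (t (p w)) * deriv (t \<circ> p) w ^ l))"


section \<open>The compact Riemann surface of a Fuchsian group of the first kind\<close>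

definition quot_map :: "(real^2^2) set \<Rightarrow> complex \<Rightarrow> csphere set" where
  "quot_map \<Gamma> z = orb \<Gamma> (Fin z)"

definition elliptic_index :: "(real^2^2) set \<Rightarrow> complex \<Rightarrow> nat" where
  "elliptic_index \<Gamma> \<xi> =
     card (rcosets\<^bsub>SL2R\<lparr>carrier := stab \<Gamma> (Fin \<xi>)\<rparr>\<^esub> (\<Gamma> \<inter> {mat 1, - mat 1}))"

text \<open>Around the image of \<open>\<xi>\<close> in the upper half plane, the coordinate is the
  \<open>e\<^sub>\<xi>\<close>-th power of \<open>(z - \<xi>) / (z - cnj \<xi>)\<close>, on the image of a disc \<open>D\<close> so small that only
  elements of the stabiliser of \<open>\<xi>\<close> identify points of \<open>D\<close>.\<close>

definition interior_charts :: "(real^2^2) set \<Rightarrow> csphere set chart set" where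
  "interior_charts \<Gamma> =
     {(U, t). \<exists>\<xi>\<in>uhp. \<exists>r>0.
        let w = (\<lambda>z. (z - \<xi>) / (z - cnj \<xi>)); D = {z\<in>uhp. norm (w z) < r} in
          (\<forall>g\<in>\<Gamma>. mob g ` D \<inter> D \<noteq> {} \<longrightarrow> g \<in> stab \<Gamma> (Fin \<xi>)) \<and>
          U = quot_map \<Gamma> ` D \<and> t \<in> extensional U \<and>
          (\<forall>z\<in>D. t (quot_map \<Gamma> z) = w z ^ elliptic_index \<Gamma> \<xi>)}"

text \<open>Around the point given by a cusp \<open>x\<close>, the coordinate is \<open>exp (2 \<pi> \<i> \<sigma>.z / h)\<close>, on the image
  of a horodisc \<open>D\<close> at \<open>x\<close>, again so small that only elements of the stabiliser
  of \<open>x\<close> identify points of \<open>D\<close>.\<close>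

definition cusp_charts :: "(real^2^2) set \<Rightarrow> csphere set chart set" where
  "cusp_charts \<Gamma> =
     {(U, t). \<exists>x\<in>cusps \<Gamma>. \<exists>\<sigma> h. cusp_frame \<Gamma> x \<sigma> h \<and> (\<exists>L>0.
        let D = {z\<in>uhp. Im (mob \<sigma> z) > L} in
          (\<forall>g\<in>\<Gamma>. mob g ` D \<inter> D \<noteq> {} \<longrightarrow> g \<in> stab \<Gamma> x) \<and>
          U = insert (orb \<Gamma> x) (quot_map \<Gamma> ` D) \<and> t \<in> extensional U \<and>
          t (orb \<Gamma> x) = 0 \<and>
          (\<forall>z\<in>D. t (quot_map \<Gamma> z) = exp (2 * of_real pi * \<i> * mob \<sigma> z / of_real h)))}"

definition surface_atlas :: "(real^2^2) set \<Rightarrow> csphere set chart set" where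
  "surface_atlas \<Gamma> = interior_charts \<Gamma> \<union> cusp_charts \<Gamma>"

definition surface_points :: "(real^2^2) set \<Rightarrow> csphere set set" where
  "surface_points \<Gamma> = orb \<Gamma> ` (Fin ` uhp \<union> cusps \<Gamma>)"

definition cusp_points :: "(real^2^2) set \<Rightarrow> csphere set set" where
  "cusp_points \<Gamma> = orb \<Gamma> ` cusps \<Gamma>"

definition elliptic_points :: "(real^2^2) set \<Rightarrow> csphere set set" where
  "elliptic_points \<Gamma> = quot_map \<Gamma> ` {\<xi>\<in>uhp. elliptic_index \<Gamma> \<xi> > 1}"

definition form_differential :: "(real^2^2) set \<Rightarrow> nat \<Rightarrow> (complex \<Rightarrow> complex) \<Rightarrow> csphere set mdiff" where
  "form_differential \<Gamma> m f =
     (THE \<phi>. \<phi> \<in> meromorphic_differentials (surface_atlas \<Gamma>) (m div 2) \<and>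
             pulls_back_to (surface_atlas \<Gamma>) (m div 2) (quot_map \<Gamma>) uhp \<phi> f)"


section \<open>Divisors\<close>

text \<open>A divisor with rational coefficients is given by its coefficient function. Those occurring
  below have finite support, as the surface is compact.\<close>

type_synonym 'a divisor = "'a \<Rightarrow> rat"

definition divisor_sum :: "'a set \<Rightarrow> ('a \<Rightarrow> rat) \<Rightarrow> 'a divisor" where
  "divisor_sum S c = (\<lambda>a. if a \<in> S then c a else 0)"

definition divisor_ge :: "'a divisor \<Rightarrow> 'a divisor \<Rightarrow> bool" where
  "divisor_ge d1 d2 \<longleftrightarrow> (\<forall>a. (d1 - d2) a \<in> \<int> \<and> (d1 - d2) a \<ge> 0)"

definition representative :: "(real^2^2) set \<Rightarrow> csphere set \<Rightarrow> complex" where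
  "representative \<Gamma> a = (SOME \<xi>. \<xi> \<in> uhp \<and> quot_map \<Gamma> \<xi> = a)"

definition point_index :: "(real^2^2) set \<Rightarrow> csphere set \<Rightarrow> nat" where
  "point_index \<Gamma> a = elliptic_index \<Gamma> (representative \<Gamma> a)"

text \<open>The orders do not depend on the choices of representatives and frames.\<close>

definition interior_order :: "(real^2^2) set \<Rightarrow> (complex \<Rightarrow> complex) \<Rightarrow> csphere set \<Rightarrow> rat" where
  "interior_order \<Gamma> f a = of_int (zorder f (representative \<Gamma> a)) / of_nat (point_index \<Gamma> a)"

definition cusp_order :: "(real^2^2) set \<Rightarrow> nat \<Rightarrow> (complex \<Rightarrow> complex) \<Rightarrow> csphere set \<Rightarrow> nat" where
  "cusp_order \<Gamma> m f b =
     (LEAST n. \<exists>x\<in>cusps \<Gamma>. \<exists>\<sigma> h a. orb \<Gamma> x = b \<and> cusp_frame \<Gamma> x \<sigma> h \<and>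
        fourier_expansion m f \<sigma> h a \<and> a n \<noteq> 0)"

definition div_form :: "(real^2^2) set \<Rightarrow> nat \<Rightarrow> (complex \<Rightarrow> complex) \<Rightarrow> csphere set divisor" where
  "div_form \<Gamma> m f = divisor_sum (surface_points \<Gamma>)
     (\<lambda>a. if a \<in> cusp_points \<Gamma> then of_nat (cusp_order \<Gamma> m f a) else interior_order \<Gamma> f a)"

definition ell_coeff :: "(real^2^2) set \<Rightarrow> nat \<Rightarrow> csphere set \<Rightarrow> rat" where
  "ell_coeff \<Gamma> m a = of_nat m / 2 * (1 - 1 / of_nat (point_index \<Gamma> a))"

definition c'_div :: "(real^2^2) set \<Rightarrow> nat \<Rightarrow> (complex \<Rightarrow> complex) \<Rightarrow> csphere set divisor" where
  "c'_div \<Gamma> m f = div_form \<Gamma> m f -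
     divisor_sum (elliptic_points \<Gamma>) (\<lambda>a. ell_coeff \<Gamma> m a - of_int \<lfloor>ell_coeff \<Gamma> m a\<rfloor>)"

definition c_div :: "(real^2^2) set \<Rightarrow> nat \<Rightarrow> (complex \<Rightarrow> complex) \<Rightarrow> csphere set divisor" where
  "c_div \<Gamma> m f = c'_div \<Gamma> m f - divisor_sum (cusp_points \<Gamma>) (\<lambda>_. 1)"

definition SH_forms :: "(real^2^2) set \<Rightarrow> nat \<Rightarrow> (complex \<Rightarrow> complex) set" where
  "SH_forms \<Gamma> m =
     {f \<in> cusp_forms \<Gamma> m. f = 0 \<or>
        divisor_ge (c_div \<Gamma> m f)
          (divisor_sum (elliptic_points \<Gamma>) (\<lambda>a. of_int \<lfloor>ell_coeff \<Gamma> m a\<rfloor>) +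
           divisor_sum (cusp_points \<Gamma>) (\<lambda>_. of_nat m / 2 - 1))}"


section \<open>Isomorphisms of complex vector spaces\<close>

definition linear_iso ::
  "(complex \<Rightarrow> 'v \<Rightarrow> 'v) \<Rightarrow> 'v set \<Rightarrow> (complex \<Rightarrow> 'w \<Rightarrow> 'w) \<Rightarrow> 'w set \<Rightarrow>
   ('v::ab_group_add \<Rightarrow> 'w::ab_group_add) \<Rightarrow> bool" where
  "linear_iso scale1 V scale2 W T \<longleftrightarrow>
     module.subspace scale1 V \<and> module.subspace scale2 W \<and>
     (\<forall>x\<in>V. \<forall>y\<in>V. T (x + y) = T x + T y) \<and>
     (\<forall>c. \<forall>x\<in>V. T (scale1 c x) = scale2 c (T x)) \<and>
     bij_betw T V W"

definition scale_form :: "complex \<Rightarrow> (complex \<Rightarrow> complex) \<Rightarrow> complex \<Rightarrow> complex" where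
  "scale_form c f = (\<lambda>z. c * f z)"

text \<open>Pointwise addition and scaling of the coefficient functions are the vector space operations
  on holomorphic differentials; on meromorphic ones, sums would have to be normalised again.\<close>

definition scale_mdiff :: "complex \<Rightarrow> 'a mdiff \<Rightarrow> 'a mdiff" where
  "scale_mdiff c \<phi> = (\<lambda>ch z. c * \<phi> ch z)"

end

theory Submission
  imports Defs
begin

text \<open>Let \<open>m = 2l\<close>. A form \<open>f\<close> of weight \<open>m\<close> makes \<open>f(z) (dz)\<^sup>l\<close> invariant under \<open>\<Gamma>\<close>, because the derivative
of a Moebius transformation is \<open>j(g, z)\<close> to the power \<open>-2\<close>. If \<open>u = \<tau>(z)\<close> is a local coordinate of the
surface, read on the half plane, the corresponding differential is \<open>f(z) / \<tau>'(z)\<^sup>l (du)\<^sup>l\<close>. The whole proof is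
local, and ordinary points, elliptic points and cusps are treated alike through a single function, the
coefficient \<open>H = f (\<tau> / \<tau>')\<^sup>l\<close> of the differential with respect
to \<open>(du / u)\<^sup>l\<close>. It is invariant under \<open>\<Gamma>\<close>, and it has no pole at the centre of any chart. At an interior
point \<open>\<xi>\<close> of index \<open>e\<close>, the coordinate is \<open>\<tau> = w\<^sup>e\<close> with a disc coordinate \<open>w\<close>, and \<open>\<tau> / \<tau>' = w / (e w')\<close> is
holomorphic although \<open>\<tau>'\<close> vanishes; at a cusp \<open>\<tau> / \<tau>'\<close> is a constant multiple of \<open>j(\<sigma>, z)\<^sup>2\<close>, so that \<open>H\<close> is a
constant multiple of the Fourier series (\<open>reduced_form_holomorphic\<close>). Hence \<open>\<omega>\<^sub>f = H u\<^bsup>-l\<^esup> (du)\<^sup>l\<close> is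
meromorphic, with poles at the centres of charts only.

The same formula tells when there is no pole. At \<open>\<xi>\<close>, comparison of \<open>f = \<phi>(w\<^sup>e) (e w\<^bsup>e-1\<^esup> w')\<^sup>l\<close> with the Taylor
series of \<open>f \<noteq> 0\<close> shows that \<open>\<phi>\<close> is holomorphic if and only if \<open>\<nu> - l (e - 1)\<close> is a non-negative multiple
of \<open>e\<close>, where \<open>\<nu>\<close> is the order of \<open>f\<close> (\<open>analytic_at_interior_iff\<close>). At a cusp, \<open>\<phi>\<close> is holomorphic if and
only if the first \<open>l\<close> Fourier coefficients vanish (\<open>analytic_at_cusp_iff\<close>). In the divisor
condition that defines \<open>S\<^sup>H\<close> the integral parts of \<open>l (1 - 1/e)\<close> cancel, and what remains
is exactly this pair of conditions (\<open>divisor_ge_iff\<close>). So \<open>S\<^sup>H\<close> consists of the cusp forms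
whose differential is holomorphic (\<open>SH_forms_iff\<close>). In this description linearity follows
from the uniqueness of \<open>\<omega>\<^sub>f\<close>, and the map is injective because \<open>\<omega>\<^sub>f\<close> determines its pull-back. For surjectivity, a holomorphic differential is pulled back
to the half plane; near a cusp its Fourier series is divisible by \<open>u\<^sup>l\<close>, and \<open>l > 0\<close>
makes the pull-back a cusp form (\<open>form_of_holomorphic_differential\<close>).

The remaining work is to show that the atlas is what it should be. Discreteness of \<open>\<Gamma>\<close>
gives small discs around interior points (\<open>exists_small_disc\<close>) and, through Shimizu's lemma, small
horodiscs at cusps (\<open>exists_small_horodisc\<close>), so that every point lies in a chart. Transition maps are
obtained without formulas from \<open>descend_holomorphic\<close>: a holomorphic function that is constant on the
fibres of a coordinate is a holomorphic function of the coordinate, even over its branch point. Only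
at a cusp, which is not in the image of the half plane, the transition map is computed; there it is
multiplication by a constant.\<close>

no_notation fps_nth (infixl \<open>$\<close> 75)

section \<open>The action of SL(2,R) on the half plane and on the sphere\<close>

lemma mat2_mult [simp]:
  fixes A B :: "real^2^2"
  shows "(A ** B) $ i $ j = A$i$1 * B$1$j + A$i$2 * B$2$j"
  by (simp add: matrix_matrix_mult_def sum_2)

lemma mat2_eqI:
  fixes A B :: "real^2^2"
  assumes "A$1$1 = B$1$1" "A$1$2 = B$1$2" "A$2$1 = B$2$1" "A$2$2 = B$2$2"
  shows "A = B"
  using assms by (simp add: vec_eq_iff forall_2)

lemma mat_1_2 [simp]:
  "(mat 1 :: real^2^2)$1$1 = 1" "(mat 1 :: real^2^2)$1$2 = 0"
  "(mat 1 :: real^2^2)$2$1 = 0" "(mat 1 :: real^2^2)$2$2 = 1"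
  by (simp_all add: mat_def)

lemma translation_entries [simp]:
  "translation b $1$1 = 1" "translation b $1$2 = b"
  "translation b $2$1 = 0" "translation b $2$2 = 1"
  by (simp_all add: translation_def)

lemma det_translation [simp]: "det (translation b) = 1"
  by (simp add: det_2)

lemma translation_mult: "translation a ** translation b = translation (a + b)"
  by (intro mat2_eqI) auto

lemma translation_0 [simp]: "translation 0 = mat 1"
  by (intro mat2_eqI) auto

lemma matrix_inv_SL2:
  fixes g :: "real^2^2"
  assumes "det g = 1"
  shows "matrix_inv g = vector [vector [g$2$2, - g$1$2], vector [- g$2$1, g$1$1]]"
proof -
  let ?h = "vector [vector [g$2$2, - g$1$2], vector [- g$2$1, g$1$1]] :: real^2^2"
  have d: "g$1$1 * g$2$2 - g$1$2 * g$2$1 = 1"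
    using assms by (simp add: det_2)
  have h: "g ** ?h = mat 1" "?h ** g = mat 1"
    using d by (intro mat2_eqI; simp add: algebra_simps)+
  have i: "g ** matrix_inv g = mat 1 \<and> matrix_inv g ** g = mat 1"
    unfolding matrix_inv_def by (rule someI[of _ ?h]) (use h in blast)
  have "matrix_inv g = matrix_inv g ** (g ** ?h)"
    by (simp only: h matrix_mul_rid)
  also have "\<dots> = (matrix_inv g ** g) ** ?h"
    by (rule matrix_mul_assoc)
  also have "\<dots> = ?h"
    by (simp only: i matrix_mul_lid)
  finally show ?thesis .
qed

lemma matrix_inv_entries:
  fixes g :: "real^2^2"
  assumes "det g = 1"
  shows "matrix_inv g $1$1 = g$2$2" "matrix_inv g $1$2 = - g$1$2"
    "matrix_inv g $2$1 = - g$2$1" "matrix_inv g $2$2 = g$1$1"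
  by (simp_all add: matrix_inv_SL2[OF assms])

lemma SL2_inv:
  fixes g :: "real^2^2"
  assumes "det g = 1"
  shows "g ** matrix_inv g = mat 1" "matrix_inv g ** g = mat 1" "det (matrix_inv g) = 1"
    "matrix_inv (matrix_inv g) = g"
proof -
  have d: "g$1$1 * g$2$2 - g$1$2 * g$2$1 = 1"
    using assms by (simp add: det_2)
  show "g ** matrix_inv g = mat 1" "matrix_inv g ** g = mat 1" "det (matrix_inv g) = 1"
    using d by (auto intro!: mat2_eqI simp: matrix_inv_entries[OF assms] det_2 algebra_simps)
  then show "matrix_inv (matrix_inv g) = g"
    by (intro mat2_eqI) (simp_all add: matrix_inv_entries assms)
qed

lemma matrix_inv_mult_SL2:
  fixes g h :: "real^2^2"
  assumes "det g = 1" "det h = 1"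
  shows "matrix_inv (g ** h) = matrix_inv h ** matrix_inv g"
proof -
  have "det (g ** h) = 1"
    using assms by (simp add: det_mul)
  then show ?thesis
    by (intro mat2_eqI) (simp_all add: matrix_inv_entries assms algebra_simps)
qed

lemma det_scale2: "s \<in> {1, -1} \<Longrightarrow> det (s *\<^sub>R (g::real^2^2)) = det g"
  by (auto simp: det_2)

text \<open>Homogeneous coordinates put infinity on the same footing as the finite points; the action becomes
linear, and its composition law needs no case distinctions.\<close>

definition of_homogeneous :: "complex \<Rightarrow> complex \<Rightarrow> csphere" where
  "of_homogeneous u v = (if v = 0 then Infty else Fin (u / v))"

lemma act_of_homogeneous:
  fixes g :: "real^2^2"
  assumes "det g = 1" "u \<noteq> 0 \<or> v \<noteq> 0"
  shows "act g (of_homogeneous u v) = of_homogeneous (of_real (g$1$1) * u + of_real (g$1$2) * v) (of_real (g$2$1) * u + of_real (g$2$2) * v)"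
proof (cases "v = 0")
  case False
  have "autf g (u / v) = (of_real (g$2$1) * u + of_real (g$2$2) * v) / v"
    "of_real (g$1$1) * (u / v) + of_real (g$1$2) = (of_real (g$1$1) * u + of_real (g$1$2) * v) / v"
    using False by (simp_all add: autf_def field_simps)
  then show ?thesis
    using False by (simp add: of_homogeneous_def mob_def del: add_divide_distrib)
qed (use assms in \<open>auto simp: of_homogeneous_def\<close>)

lemma of_homogeneous_surj: obtains u v where "p = of_homogeneous u v" "u \<noteq> 0 \<or> v \<noteq> 0"
proof (cases p)
  case (Fin z)
  then show ?thesis using that[of z 1] by (simp add: of_homogeneous_def)
next
  case Infty
  then show ?thesis using that[of 1 0] by (simp add: of_homogeneous_def)
qed

text \<open>Cramer's rule: an invertible matrix maps homogeneous coordinates to homogeneous coordinates.\<close>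

lemma SL2_nondegenerate:
  fixes u v :: complex and g :: "real^2^2"
  assumes "det g = 1" "u \<noteq> 0 \<or> v \<noteq> 0"
  shows "of_real (g$1$1) * u + of_real (g$1$2) * v \<noteq> 0 \<or> of_real (g$2$1) * u + of_real (g$2$2) * v \<noteq> 0"
proof (rule ccontr)
  assume "\<not> ?thesis"
  then have 1: "of_real (g$1$1) * u + of_real (g$1$2) * v = 0"
    and 2: "of_real (g$2$1) * u + of_real (g$2$2) * v = 0" by auto
  have d: "complex_of_real (g$1$1) * of_real (g$2$2) - of_real (g$1$2) * of_real (g$2$1) = 1"
    using arg_cong[OF assms(1), of complex_of_real] by (simp add: det_2)
  have "u = u * (complex_of_real (g$1$1) * of_real (g$2$2) - of_real (g$1$2) * of_real (g$2$1))"
    by (simp add: d)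
  also have "\<dots> = of_real (g$2$2) * (of_real (g$1$1) * u + of_real (g$1$2) * v) - of_real (g$1$2) * (of_real (g$2$1) * u + of_real (g$2$2) * v)"
    by (simp add: algebra_simps)
  finally have "u = 0" by (simp add: 1 2)
  have "v = v * (complex_of_real (g$1$1) * of_real (g$2$2) - of_real (g$1$2) * of_real (g$2$1))"
    by (simp add: d)
  also have "\<dots> = of_real (g$1$1) * (of_real (g$2$1) * u + of_real (g$2$2) * v) - of_real (g$2$1) * (of_real (g$1$1) * u + of_real (g$1$2) * v)"
    by (simp add: algebra_simps)
  finally have "v = 0" by (simp add: 1 2)
  with \<open>u = 0\<close> assms show False by simp
qed

lemma act_mult:
  assumes "det g = 1" "det h = 1"
  shows "act (g ** h) p = act g (act h p)"
proof -
  obtain u v where p: "p = of_homogeneous u v" and nz: "u \<noteq> 0 \<or> v \<noteq> 0"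
    by (rule of_homogeneous_surj)
  have "det (g ** h) = 1"
    using assms by (simp add: det_mul)
  from act_of_homogeneous[OF this nz] show ?thesis
    unfolding p act_of_homogeneous[OF assms(2) nz]
    by (subst act_of_homogeneous[OF assms(1) SL2_nondegenerate[OF assms(2) nz]])
       (simp add: algebra_simps)
qed

lemma act_one [simp]: "act (mat 1) p = p"
  by (cases p) (auto simp: autf_def mob_def)

lemma act_inv:
  assumes "det g = 1"
  shows "act (matrix_inv g) (act g p) = p" "act g (act (matrix_inv g) p) = p"
  by (simp_all flip: act_mult add: assms SL2_inv)

lemma uhpD: "z \<in> uhp \<Longrightarrow> Im z > 0"
  by (simp add: uhp_def)

lemma open_uhp [simp, intro]: "open uhp"
  by (simp add: uhp_def open_halfspace_Im_gt)

lemma convex_uhp: "convex uhp"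
  by (simp add: uhp_def convex_halfspace_Im_gt)

lemma connected_uhp: "connected uhp"
  by (simp add: convex_uhp convex_connected)

lemma autf_nonzero:
  assumes "det g = 1" "z \<in> uhp"
  shows "autf g z \<noteq> 0"
proof
  assume 0: "autf g z = 0"
  then have "g$2$1 * Im z = 0"
    by (simp add: autf_def complex_eq_iff)
  then have "g$2$1 = 0" using assms by (auto simp: uhp_def)
  with 0 have "g$2$2 = 0" by (simp add: autf_def)
  with \<open>g$2$1 = 0\<close> assms show False by (simp add: det_2)
qed

lemma Im_mob:
  assumes "det g = 1"
  shows "Im (mob g z) = Im z / (norm (autf g z))\<^sup>2"
proof -
  have d: "g$1$1 * g$2$2 - g$1$2 * g$2$1 = 1"
    using assms by (simp add: det_2)
  have "Im (mob g z) = (g$1$1 * Im z * (g$2$1 * Re z + g$2$2) - (g$1$1 * Re z + g$1$2) * (g$2$1 * Im z)) / (norm (autf g z))\<^sup>2"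
    unfolding mob_def autf_def by (simp add: Im_divide cmod_power2)
  also have "g$1$1 * Im z * (g$2$1 * Re z + g$2$2) - (g$1$1 * Re z + g$1$2) * (g$2$1 * Im z) = (g$1$1 * g$2$2 - g$1$2 * g$2$1) * Im z"
    by (simp add: algebra_simps)
  finally show ?thesis by (simp add: d)
qed

lemma mob_uhp [simp]:
  assumes "det g = 1" "z \<in> uhp"
  shows "mob g z \<in> uhp"
  using assms autf_nonzero[OF assms] by (simp add: uhp_def Im_mob)

lemma act_Fin:
  assumes "det g = 1" "z \<in> uhp"
  shows "act g (Fin z) = Fin (mob g z)"
  using autf_nonzero[OF assms] by simp

lemma mob_mult:
  assumes "det g = 1" "det h = 1" "z \<in> uhp"
  shows "mob (g ** h) z = mob g (mob h z)"
proof -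
  have "det (g ** h) = 1"
    using assms by (simp add: det_mul)
  then have "Fin (mob (g ** h) z) = Fin (mob g (mob h z))"
    using act_mult[OF assms(1,2), of "Fin z"] assms by (simp only: act_Fin mob_uhp)
  then show ?thesis by simp
qed

lemma mob_one [simp]: "mob (mat 1) z = z"
  by (simp add: mob_def autf_def)

lemma mob_inv:
  assumes "det g = 1" "z \<in> uhp"
  shows "mob (matrix_inv g) (mob g z) = z" "mob g (mob (matrix_inv g) z) = z"
  by (simp_all flip: mob_mult add: assms SL2_inv)

lemma autf_mult:
  assumes "det g = 1" "det h = 1" "z \<in> uhp"
  shows "autf (g ** h) z = autf g (mob h z) * autf h z"
proof -
  have "autf g (mob h z) * autf h z = of_real (g$2$1) * (mob h z * autf h z) + of_real (g$2$2) * autf h z"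
    by (simp add: autf_def algebra_simps)
  also have "mob h z * autf h z = of_real (h$1$1) * z + of_real (h$1$2)"
    using autf_nonzero[OF assms(2,3)] by (simp add: mob_def)
  finally show ?thesis
    by (simp add: autf_def algebra_simps)
qed

lemma autf_one [simp]: "autf (mat 1) z = 1"
  by (simp add: autf_def)

lemma autf_inv:
  assumes "det g = 1" "z \<in> uhp"
  shows "autf (matrix_inv g) (mob g z) = 1 / autf g z"
  using autf_mult[of "matrix_inv g" g z] assms autf_nonzero[OF assms]
  by (simp add: SL2_inv field_simps)

lemma mob_scale:
  assumes "s \<in> {1, -1}"
  shows "mob (s *\<^sub>R g) z = mob g z"
proof -
  have "autf (- g) z = - autf g z"
    "of_real ((- g)$1$1) * z + of_real ((- g)$1$2) = - (of_real (g$1$1) * z + of_real (g$1$2))"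
    by (simp_all add: autf_def)
  then have "mob (- g) z = mob g z"
    by (simp only: mob_def minus_divide_divide)
  with assms show ?thesis by auto
qed

lemma autf_scale:
  "autf (s *\<^sub>R g) z = of_real s * autf g z"
  by (simp add: autf_def algebra_simps)

lemma has_field_derivative_mob:
  assumes "det g = 1" "z \<in> uhp"
  shows "(mob g has_field_derivative 1 / autf g z ^ 2) (at z)"
proof -
  have d: "complex_of_real (g$1$1) * of_real (g$2$2) - of_real (g$1$2) * of_real (g$2$1) = 1"
    using arg_cong[OF assms(1), of complex_of_real] by (simp add: det_2)
  have nz: "autf g z \<noteq> 0" by (rule autf_nonzero[OF assms])
  have "((\<lambda>z. (of_real (g$1$1) * z + of_real (g$1$2)) / (of_real (g$2$1) * z + of_real (g$2$2)))
     has_field_derivative (of_real (g$1$1) * autf g z - (of_real (g$1$1) * z + of_real (g$1$2)) * of_real (g$2$1)) / (autf g z * autf g z)) (at z)"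
    using nz unfolding autf_def by (auto intro!: derivative_eq_intros)
  also have "of_real (g$1$1) * autf g z - (of_real (g$1$1) * z + of_real (g$1$2)) * of_real (g$2$1) = 1"
    using d by (simp add: autf_def algebra_simps)
  also have "(\<lambda>z. (of_real (g$1$1) * z + of_real (g$1$2)) / (of_real (g$2$1) * z + of_real (g$2$2))) = mob g"
    by (rule ext) (simp add: mob_def autf_def)
  finally show ?thesis
    by (simp only: power2_eq_square)
qed

lemma holomorphic_mob: "det g = 1 \<Longrightarrow> mob g holomorphic_on uhp"
  using has_field_derivative_mob holomorphic_on_open[OF open_uhp] by blast

lemma mob_translation [simp]: "mob (translation b) z = z + of_real b"
  by (simp add: mob_def autf_def)

section \<open>Discrete subgroups\<close>

lemma group_SL2R: "group SL2R"
proof (rule groupI)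
  fix x assume x: "x \<in> carrier SL2R"
  show "\<exists>y\<in>carrier SL2R. y \<otimes>\<^bsub>SL2R\<^esub> x = \<one>\<^bsub>SL2R\<^esub>"
    using x by (intro bexI[of _ "matrix_inv x"]) (auto simp: SL2R_def SL2_inv)
qed (auto simp: SL2R_def det_mul matrix_mul_assoc)

lemma inv_SL2R: "det g = 1 \<Longrightarrow> inv\<^bsub>SL2R\<^esub> g = matrix_inv g"
  by (intro group.inv_equality[OF group_SL2R]) (auto simp: SL2R_def SL2_inv)

lemma mat2_tendstoI:
  fixes X :: "'b \<Rightarrow> real^2^2"
  assumes "((\<lambda>n. X n $1$1) \<longlongrightarrow> L$1$1) F" "((\<lambda>n. X n $1$2) \<longlongrightarrow> L$1$2) F"
    "((\<lambda>n. X n $2$1) \<longlongrightarrow> L$2$1) F" "((\<lambda>n. X n $2$2) \<longlongrightarrow> L$2$2) F"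
  shows "(X \<longlongrightarrow> L) F"
proof (rule vec_tendstoI)
  fix i :: 2
  show "((\<lambda>n. X n $ i) \<longlongrightarrow> L $ i) F"
  proof (rule vec_tendstoI)
    fix j :: 2
    show "((\<lambda>n. X n $ i $ j) \<longlongrightarrow> L $ i $ j) F"
      using assms exhaust_2[of i] exhaust_2[of j] by auto
  qed
qed

lemma norm_mat2_le:
  fixes g :: "real^2^2"
  assumes "\<bar>g$1$1\<bar> \<le> K" "\<bar>g$1$2\<bar> \<le> K" "\<bar>g$2$1\<bar> \<le> K" "\<bar>g$2$2\<bar> \<le> K"
  shows "norm g \<le> 4 * K"
proof -
  have "norm g \<le> norm (g$1) + norm (g$2)"
    unfolding norm_vec_def[of g] by (rule order_trans[OF L2_set_le_sum]) (auto simp: sum_2)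
  moreover have "norm (g$i) \<le> \<bar>g$i$1\<bar> + \<bar>g$i$2\<bar>" for i
    using norm_le_l1_cart[of "g$i"] by (simp add: sum_2)
  ultimately show ?thesis
    using assms by (smt (verit))
qed

locale discrete_SL2_subgroup =
  fixes \<Gamma> :: "(real^2^2) set"
  assumes subgroup: "subgroup \<Gamma> SL2R"
    and discrete: "discrete \<Gamma>"
begin

lemma det_1 [simp]: "g \<in> \<Gamma> \<Longrightarrow> det g = 1"
  using subgroup.subset[OF subgroup] by (auto simp: SL2R_def)

lemma mat_1_in [simp]: "mat 1 \<in> \<Gamma>"
  using subgroup.one_closed[OF subgroup] by (simp add: SL2R_def)

lemma mult_in [simp]: "g \<in> \<Gamma> \<Longrightarrow> h \<in> \<Gamma> \<Longrightarrow> g ** h \<in> \<Gamma>"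
  using subgroup.m_closed[OF subgroup] by (simp add: SL2R_def)

lemma inv_in [simp]: "g \<in> \<Gamma> \<Longrightarrow> matrix_inv g \<in> \<Gamma>"
  using subgroup.m_inv_closed[OF subgroup, of g] by (simp add: inv_SL2R)

lemma eventually_eq_limit:
  assumes "X \<longlonglongrightarrow> g" "g \<in> \<Gamma>" "\<And>n. X n \<in> \<Gamma>"
  shows "eventually (\<lambda>n. X n = g) sequentially"
proof -
  from discreteD[OF discrete assms(2)] obtain T where "open T" "T \<inter> \<Gamma> = {g}"
    by (auto simp: isolated_in_def)
  then have "eventually (\<lambda>n. X n \<in> T) sequentially"
    using assms(1) by (intro topological_tendstoD) auto
  then show ?thesis
    by eventually_elim (use \<open>T \<inter> \<Gamma> = {g}\<close> assms(3) in auto)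
qed

text \<open>An infinite bounded subset would contain a convergent sequence of distinct elements; its limit
again has determinant 1, so the quotients of consecutive terms would tend to the identity
and eventually be equal to it.\<close>

lemma finite_bounded:
  assumes "B \<subseteq> \<Gamma>" "bounded B"
  shows "finite B"
proof (rule ccontr)
  assume "infinite B"
  then obtain f :: "nat \<Rightarrow> real^2^2" where f: "inj f" "range f \<subseteq> B"
    using infinite_countable_subset by blast
  have "bounded (range f)"
    using f(2) assms(2) bounded_subset by blast
  then obtain L r where r: "strict_mono r" and lim: "(f \<circ> r) \<longlonglongrightarrow> L"
    using bounded_imp_convergent_subsequence by blast
  define G where "G = f \<circ> r"
  have G: "G n \<in> \<Gamma>" for n
    using f(2) assms(1) by (auto simp: G_def)
  have G_lim: "(\<lambda>n. G n $ i $ j) \<longlonglongrightarrow> L $ i $ j" for i j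
    using lim unfolding G_def[symmetric] by (intro tendsto_vec_nth)
  have G_lim': "(\<lambda>n. G (Suc n) $ i $ j) \<longlonglongrightarrow> L $ i $ j" for i j
    using LIMSEQ_Suc[OF G_lim] .
  have "(\<lambda>n. det (G n)) \<longlonglongrightarrow> L$1$1 * L$2$2 - L$1$2 * L$2$1"
    unfolding det_2 by (intro tendsto_intros G_lim)
  then have "L$1$1 * L$2$2 - L$1$2 * L$2$1 = 1"
    using G by (simp add: LIMSEQ_const_iff)
  then have L: "L$2$2 * L$1$1 + - L$1$2 * L$2$1 = 1" "L$2$2 * L$1$2 + - L$1$2 * L$2$2 = 0"
    "- L$2$1 * L$1$1 + L$1$1 * L$2$1 = 0" "- L$2$1 * L$1$2 + L$1$1 * L$2$2 = 1"
    by (simp_all add: algebra_simps)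
  \<comment> \<open>The entries of the quotients converge to those of the adjugate of \<open>L\<close> times \<open>L\<close>, which is the identity.\<close>
  have "(\<lambda>n. matrix_inv (G n) ** G (Suc n)) \<longlonglongrightarrow> mat 1"
    by (rule mat2_tendstoI; simp only: mat2_mult matrix_inv_entries[OF det_1[OF G]] mat_1_2;
        rule tendsto_eq_rhs[rotated, OF L(1)] tendsto_eq_rhs[rotated, OF L(2)]
          tendsto_eq_rhs[rotated, OF L(3)] tendsto_eq_rhs[rotated, OF L(4)];
        intro tendsto_intros G_lim G_lim')
  then have "eventually (\<lambda>n. matrix_inv (G n) ** G (Suc n) = mat 1) sequentially"
    by (rule eventually_eq_limit) (simp_all add: G)
  then obtain n where n: "matrix_inv (G n) ** G (Suc n) = mat 1"
    by (auto dest: eventually_happens)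
  have "G (Suc n) = (G n ** matrix_inv (G n)) ** G (Suc n)"
    by (simp add: SL2_inv G)
  also have "\<dots> = G n ** (matrix_inv (G n) ** G (Suc n))"
    by (rule matrix_mul_assoc[symmetric])
  finally have "G (Suc n) = G n" by (simp add: n)
  then have "r (Suc n) = r n"
    using f(1) by (simp add: G_def inj_eq)
  then show False
    using r by (metis lessI less_irrefl strict_mono_less)
qed

text \<open>Conjugation by a matrix that moves a cusp to infinity reduces statements about cusps to
statements about translations.\<close>

lemma conj_group:
  assumes "det \<sigma> = 1"
  shows "discrete_SL2_subgroup ((\<lambda>g. \<sigma> ** g ** matrix_inv \<sigma>) ` \<Gamma>)"
proof (rule discrete_SL2_subgroup.intro)
  let ?c = "\<lambda>g. \<sigma> ** g ** matrix_inv \<sigma>"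
  let ?d = "\<lambda>g. matrix_inv \<sigma> ** g ** \<sigma>"
  have dc: "?d (?c g) = g" for g
    by (simp add: assms matrix_mul_assoc SL2_inv) (simp add: assms SL2_inv flip: matrix_mul_assoc)
  have cm: "?c (g ** h) = ?c g ** ?c h" for g h
  proof -
    have "?c g ** ?c h = \<sigma> ** g ** (matrix_inv \<sigma> ** \<sigma>) ** h ** matrix_inv \<sigma>"
      by (simp only: matrix_mul_assoc)
    then show ?thesis by (simp add: assms SL2_inv matrix_mul_assoc)
  qed
  show "subgroup (?c ` \<Gamma>) SL2R"
  proof (rule subgroup.intro)
    show "?c ` \<Gamma> \<subseteq> carrier SL2R"
      by (auto simp: SL2R_def det_mul assms SL2_inv)
    show "x \<otimes>\<^bsub>SL2R\<^esub> y \<in> ?c ` \<Gamma>" if "x \<in> ?c ` \<Gamma>" "y \<in> ?c ` \<Gamma>" for x y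
      using that by (auto simp: SL2R_def simp flip: cm intro!: imageI)
    show "\<one>\<^bsub>SL2R\<^esub> \<in> ?c ` \<Gamma>"
      by (rule image_eqI[of _ _ "mat 1"]) (auto simp: SL2R_def SL2_inv assms)
  next
    fix x assume "x \<in> ?c ` \<Gamma>"
    show "inv\<^bsub>SL2R\<^esub> x \<in> ?c ` \<Gamma>"
    proof -
      from \<open>x \<in> ?c ` \<Gamma>\<close> obtain g where g: "g \<in> \<Gamma>" "x = ?c g" by auto
      have "matrix_inv (?c g) = ?c (matrix_inv g)"
        using g assms by (simp add: matrix_inv_mult_SL2 det_mul SL2_inv matrix_mul_assoc)
      then show ?thesis
        using g assms by (auto simp: inv_SL2R det_mul SL2_inv)
    qed
  qed
  show "discrete (?c ` \<Gamma>)"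
  proof (rule discreteI)
    fix x assume "x \<in> ?c ` \<Gamma>"
    then obtain g where g: "g \<in> \<Gamma>" "x = ?c g" by auto
    from discreteD[OF discrete g(1)] obtain T where T: "open T" "T \<inter> \<Gamma> = {g}"
      by (auto simp: isolated_in_def)
    have "continuous_on UNIV ?d"
    proof -
      have "continuous_on UNIV (\<lambda>h. ?d h $ i $ j)" for i j :: 2
        by (simp, intro continuous_intros)
      then have "(?d \<longlongrightarrow> ?d h) (at h)" for h
        by (intro mat2_tendstoI) (auto simp: continuous_on_def)
      then show ?thesis by (simp add: continuous_on_def)
    qed
    then have "open (?d -` T)"
      using T(1) by (rule open_vimage[rotated])
    moreover have "?d -` T \<inter> ?c ` \<Gamma> = {x}"
    proof -
      have "?d x \<in> T" using T(2) g(2) by (auto simp: dc)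
      moreover have "?c h = x" if "?d (?c h) \<in> T" "h \<in> \<Gamma>" for h
      proof -
        have "h \<in> T \<inter> \<Gamma>" using that by (simp add: dc)
        then show ?thesis using T(2) g(2) by simp
      qed
      ultimately show ?thesis using g by blast
    qed
    ultimately show "x isolated_in ?c ` \<Gamma>"
      using g by (intro isolated_inI) auto
  qed
qed

text \<open>Shimizu's lemma. Suppose \<open>0 < \<bar>c\<bar> k < 1\<close> and replace \<open>B\<close> by its conjugate \<open>B T B\<^bsup>-1\<^esup>\<close> of the translation \<open>T\<close>
again and again. The lower left entry \<open>c\<close> becomes \<open>- c\<^sup>2 k\<close>, so it tends to 0 without ever being 0, the
diagonal stays bounded and hence tends to 1, and the matrices converge to \<open>T\<close> without reaching it.\<close>

lemma shimizu:
  assumes k: "k > 0" "translation k \<in> \<Gamma>" and g: "g \<in> \<Gamma>" "g$2$1 \<noteq> 0"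
  shows "\<bar>g$2$1\<bar> * k \<ge> 1"
proof (rule ccontr)
  assume less: "\<not> ?thesis"
  define q where "q = \<bar>g$2$1\<bar> * k"
  have q: "0 < q" "q < 1"
    using less k g by (auto simp: q_def)
  define B where "B n = ((\<lambda>h. h ** translation k ** matrix_inv h) ^^ n) g" for n
  have B_Suc: "B (Suc n) = B n ** translation k ** matrix_inv (B n)" for n
    by (simp add: B_def)
  have B: "B n \<in> \<Gamma>" for n
    by (induction n) (use g k in \<open>auto simp: B_Suc\<close>, simp add: B_def)
  have det: "B n$1$1 * B n$2$2 - B n$1$2 * B n$2$1 = 1" for n
    using det_1[OF B[of n]] by (simp add: det_2)
  have entries: "B (Suc n)$1$1 = 1 - B n$1$1 * (B n$2$1 * k)"
    "B (Suc n)$1$2 = (B n$1$1)\<^sup>2 * k" "B (Suc n)$2$1 = - (B n$2$1)\<^sup>2 * k"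
    "B (Suc n)$2$2 = 1 + B n$1$1 * (B n$2$1 * k)" for n
    using det[of n]
    by (simp_all add: B_Suc matrix_inv_entries[OF det_1[OF B]] algebra_simps power2_eq_square)
  have c_nz: "B n$2$1 \<noteq> 0" for n
    by (induction n) (use g k entries in \<open>auto\<close>, simp add: B_def)
  have c_le: "\<bar>B n$2$1\<bar> * k \<le> q ^ Suc n" for n
  proof (induction n)
    case (Suc n)
    have "\<bar>B (Suc n)$2$1\<bar> * k = (\<bar>B n$2$1\<bar> * k) * (\<bar>B n$2$1\<bar> * k)"
      using k by (simp add: entries abs_mult power2_eq_square)
    also have "\<dots> \<le> q ^ Suc n * q ^ Suc n"
      using Suc k q by (intro mult_mono) auto
    also have "\<dots> \<le> q ^ Suc n * q"
      using q by (intro mult_left_mono) (auto simp: power_le_one mult_left_le)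
    finally show ?case by (simp add: mult_ac)
  qed (simp add: B_def q_def)
  \<comment> \<open>The upper left entry satisfies \<open>\<bar>a'\<bar> \<le> 1 + q \<bar>a\<bar>\<close>; the second number is the fixed point of this recursion.\<close>
  define A where "A = max \<bar>g$1$1\<bar> (1 / (1 - q))"
  have a_le: "\<bar>B n$1$1\<bar> \<le> A" for n
  proof (induction n)
    case (Suc n)
    have "\<bar>B n$2$1 * k\<bar> \<le> q"
    proof -
      have "q ^ Suc n \<le> q" using q by (simp add: power_le_one mult_left_le)
      then show ?thesis using c_le[of n] k by (simp add: abs_mult)
    qed
    then have "\<bar>B n$1$1 * (B n$2$1 * k)\<bar> \<le> A * q"
      using Suc unfolding abs_mult[of "B n$1$1"] by (intro mult_mono) auto
    then have "\<bar>B (Suc n)$1$1\<bar> \<le> 1 + A * q"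
      unfolding entries by linarith
    also have "\<dots> \<le> A"
    proof -
      have "1 / (1 - q) \<le> A" by (simp add: A_def)
      then have "1 \<le> A * (1 - q)" using q by (simp add: field_simps)
      then show ?thesis by (simp add: algebra_simps)
    qed
    finally show ?case .
  qed (simp add: B_def A_def)
  have "(\<lambda>n. q ^ Suc n) \<longlonglongrightarrow> 0"
    using q by (intro LIMSEQ_Suc LIMSEQ_power_zero) auto
  then have c_lim: "(\<lambda>n. B n$2$1 * k) \<longlonglongrightarrow> 0"
    by (rule tendsto_0_le[where K = 1]) (use c_le k q in \<open>auto simp: abs_mult intro!: always_eventually\<close>)
  have ac_lim: "(\<lambda>n. B n$1$1 * (B n$2$1 * k)) \<longlonglongrightarrow> 0"
  proof (rule tendsto_0_le[OF c_lim, where K = A])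
    show "\<forall>\<^sub>F n in sequentially. norm (B n$1$1 * (B n$2$1 * k)) \<le> norm (B n$2$1 * k) * A"
      using a_le by (intro always_eventually allI) (simp add: abs_mult mult.commute mult_left_mono mult_right_mono)
  qed
  have a_lim: "(\<lambda>n. B (Suc n)$1$1) \<longlonglongrightarrow> 1"
    unfolding entries by (rule tendsto_eq_intros ac_lim refl | simp)+
  have c_lim': "(\<lambda>n. B n$2$1) \<longlonglongrightarrow> 0"
    using tendsto_mult_left[OF c_lim, of "1/k"] k by simp
  have "(\<lambda>n. B (Suc (Suc n))) \<longlonglongrightarrow> translation k"
  proof (rule mat2_tendstoI)
    show "(\<lambda>n. B (Suc (Suc n))$1$1) \<longlonglongrightarrow> translation k$1$1"
      using LIMSEQ_Suc[OF a_lim] by simp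
    show "(\<lambda>n. B (Suc (Suc n))$1$2) \<longlonglongrightarrow> translation k$1$2"
      unfolding entries(2)[of "Suc _"] by (rule tendsto_eq_intros a_lim refl | simp)+
    show "(\<lambda>n. B (Suc (Suc n))$2$1) \<longlonglongrightarrow> translation k$2$1"
      using LIMSEQ_Suc[OF LIMSEQ_Suc[OF c_lim']] by simp
    show "(\<lambda>n. B (Suc (Suc n))$2$2) \<longlonglongrightarrow> translation k$2$2"
      unfolding entries(4)[of "Suc _"] by (rule tendsto_eq_intros LIMSEQ_Suc[OF ac_lim] refl | simp)+
  qed
  then have "\<forall>\<^sub>F n in sequentially. B (Suc (Suc n)) = translation k"
    using k B by (intro eventually_eq_limit) auto
  then obtain n where "B (Suc (Suc n)) = translation k"
    by (auto dest: eventually_happens)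
  with c_nz[of "Suc (Suc n)"] show False by simp
qed

text \<open>Conjugating a translation by the powers of a contracting element would produce arbitrarily short
translations.\<close>

lemma upper_triangular_not_contracting:
  assumes k: "k \<noteq> 0" "translation k \<in> \<Gamma>" and g: "g \<in> \<Gamma>" "g$2$1 = 0"
  shows "\<bar>g$1$1\<bar> \<ge> 1"
proof (rule ccontr)
  assume less: "\<not> ?thesis"
  define a where "a = (g$1$1)\<^sup>2"
  have nz: "g$1$1 \<noteq> 0" "g$1$1 * g$2$2 = 1"
    using det_1[OF g(1)] g(2) by (auto simp: det_2)
  have a: "0 < a" "a < 1"
    using less nz by (auto simp: a_def abs_square_less_1)
  have step: "g ** translation b ** matrix_inv g = translation (a * b)" for b
    using g nz by (intro mat2_eqI) (auto simp: matrix_inv_entries a_def power2_eq_square algebra_simps)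
  have "translation (a ^ n * k) \<in> \<Gamma>" for n
  proof (induction n)
    case (Suc n)
    then have "g ** translation (a ^ n * k) ** matrix_inv g \<in> \<Gamma>"
      using g by simp
    then show ?case by (simp add: step mult_ac)
  qed (use k in simp)
  moreover have "(\<lambda>n. translation (a ^ n * k)) \<longlonglongrightarrow> mat 1"
  proof (rule mat2_tendstoI)
    have "(\<lambda>n. a ^ n * k) \<longlonglongrightarrow> 0 * k"
      using a by (intro tendsto_intros LIMSEQ_power_zero) auto
    then show "(\<lambda>n. translation (a ^ n * k) $1$2) \<longlonglongrightarrow> (mat 1 :: real^2^2) $1$2" by simp
  qed auto
  ultimately have "eventually (\<lambda>n. translation (a ^ n * k) = mat 1) sequentially"
    by (intro eventually_eq_limit) auto
  then obtain n where n: "translation (a ^ n * k) = mat 1"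
    by (auto dest: eventually_happens)
  have "a ^ n * k = 0"
    using arg_cong[OF n, of "\<lambda>A. A$1$2"] by simp
  then show False using a k by simp
qed

lemma upper_triangular_translation:
  assumes k: "k \<noteq> 0" "translation k \<in> \<Gamma>" and g: "g \<in> \<Gamma>" "g$2$1 = 0"
  shows "\<exists>s\<in>{1,-1}. \<exists>b. g = s *\<^sub>R translation b"
proof -
  have d: "g$1$1 * g$2$2 = 1"
    using det_1[OF g(1)] g(2) by (auto simp: det_2)
  have "\<bar>g$1$1\<bar> \<ge> 1"
    by (rule upper_triangular_not_contracting[OF k g])
  moreover have "\<bar>g$2$2\<bar> \<ge> 1"
    using upper_triangular_not_contracting[OF k inv_in[OF g(1)]] g by (simp add: matrix_inv_entries)
  moreover have "\<bar>g$1$1\<bar> * \<bar>g$2$2\<bar> = 1"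
    using d by (simp flip: abs_mult)
  ultimately have "\<bar>g$1$1\<bar> = 1"
    by (smt (verit) mult_le_cancel_left1 mult_cancel_left1)
  then have "g$1$1 = 1 \<and> g$2$2 = 1 \<or> g$1$1 = -1 \<and> g$2$2 = -1"
    using d by (auto simp: abs_if split: if_splits)
  then show ?thesis
  proof
    assume "g$1$1 = 1 \<and> g$2$2 = 1"
    then have "g = 1 *\<^sub>R translation (g$1$2)"
      using g by (intro mat2_eqI) auto
    then show ?thesis by blast
  next
    assume "g$1$1 = -1 \<and> g$2$2 = -1"
    then have "g = (-1) *\<^sub>R translation (- g$1$2)"
      using g by (intro mat2_eqI) auto
    then show ?thesis by blast
  qed
qed

text \<open>A non-trivial discrete subgroup of the line is generated by its least positive element. Translations are
considered up to sign, since the stabiliser of a cusp may contain \<open>- T\<close> without containing \<open>T\<close>.\<close>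

lemma translations_discrete:
  assumes k: "k > 0" "translation k \<in> \<Gamma>"
  shows "\<exists>h>0. {b. \<exists>s\<in>{1,-1}. s *\<^sub>R translation b \<in> \<Gamma>} = {of_int l * h | l. True}"
proof -
  define B where "B = {b. \<exists>s\<in>{1,-1::real}. s *\<^sub>R translation b \<in> \<Gamma>}"
  have add: "b + c \<in> B" if "b \<in> B" "c \<in> B" for b c
  proof -
    from that obtain s t where st: "s \<in> {1,-1}" "t \<in> {1,-1}"
      "s *\<^sub>R translation b \<in> \<Gamma>" "t *\<^sub>R translation c \<in> \<Gamma>" unfolding B_def by blast
    have "(s *\<^sub>R translation b) ** (t *\<^sub>R translation c) = (s * t) *\<^sub>R translation (b + c)"
      by (intro mat2_eqI) (auto simp: algebra_simps)
    with st have "(s * t) *\<^sub>R translation (b + c) \<in> \<Gamma>" by (metis mult_in)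
    moreover have "s * t \<in> {1,-1}" using st by auto
    ultimately show ?thesis by (auto simp: B_def)
  qed
  have uminus: "- b \<in> B" if "b \<in> B" for b
  proof -
    from that obtain s where s: "s \<in> {1,-1}" "s *\<^sub>R translation b \<in> \<Gamma>" unfolding B_def by blast
    have "matrix_inv (s *\<^sub>R translation b) = s *\<^sub>R translation (- b)"
    proof -
      have "det (s *\<^sub>R translation b) = 1" using s by (simp only: det_scale2 det_translation)
      from matrix_inv_entries[OF this] show ?thesis by (intro mat2_eqI) auto
    qed
    moreover have "matrix_inv (s *\<^sub>R translation b) \<in> \<Gamma>" using s(2) by (rule inv_in)
    ultimately show ?thesis using s(1) unfolding B_def by auto
  qed
  have zero: "0 \<in> B" by (auto simp: B_def)
  have nat_mult: "of_nat n * b \<in> B" if "b \<in> B" for b n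
    by (induction n) (use that zero add in \<open>auto simp: algebra_simps\<close>)
  have int_mult: "of_int l * b \<in> B" if "b \<in> B" for b l
    by (cases l rule: int_cases2) (use nat_mult[OF that] uminus in \<open>auto\<close>)
  have kB: "k \<in> B" using k by (auto simp: B_def)
  define C where "C = {b \<in> B. 0 < b \<and> b \<le> k}"
  have "finite C"
  proof -
    define M where "M = {g \<in> \<Gamma>. \<exists>s\<in>{1,-1}. \<exists>b. 0 < b \<and> b \<le> k \<and> g = s *\<^sub>R translation b}"
    have "norm g \<le> 4 * (1 + k)" if "g \<in> M" for g
      using that k by (intro norm_mat2_le) (auto simp: M_def)
    then have "bounded M" by (auto simp: bounded_iff)
    then have "finite M" by (intro finite_bounded) (auto simp: M_def)
    moreover have "C \<subseteq> (\<lambda>g. g$1$1 * g$1$2) ` M"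
    proof
      fix b assume "b \<in> C"
      then obtain s where "s \<in> {1,-1}" "s *\<^sub>R translation b \<in> \<Gamma>" "0 < b" "b \<le> k"
        unfolding C_def B_def by blast
      then show "b \<in> (\<lambda>g. g$1$1 * g$1$2) ` M"
        by (intro image_eqI[of _ _ "s *\<^sub>R translation b"]) (auto simp: M_def)
    qed
    ultimately show ?thesis by (rule finite_surj)
  qed
  define h where "h = Min C"
  have "C \<noteq> {}" using kB k by (auto simp: C_def)
  then have "h \<in> C" using \<open>finite C\<close> by (simp add: h_def)
  then have h: "h \<in> B" "h > 0" "h \<le> k" by (auto simp: C_def)
  have "b \<in> {of_int l * h | l. True}" if "b \<in> B" for b
  proof -
    define r where "r = b + of_int (- \<lfloor>b / h\<rfloor>) * h"
    have rB: "r \<in> B"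
      unfolding r_def by (intro add that int_mult h)
    have "of_int \<lfloor>b / h\<rfloor> \<le> b / h" "b / h < of_int \<lfloor>b / h\<rfloor> + 1"
      by linarith+
    then have "of_int \<lfloor>b / h\<rfloor> * h \<le> b" "b < (of_int \<lfloor>b / h\<rfloor> + 1) * h"
      by (simp_all only: pos_le_divide_eq[OF h(2)] pos_divide_less_eq[OF h(2)])
    then have r: "0 \<le> r" "r < h"
      by (simp_all add: r_def algebra_simps)
    have "r = 0"
    proof (rule ccontr)
      assume "r \<noteq> 0"
      then have "r \<in> C" using r rB h by (auto simp: C_def)
      then have "h \<le> r" using \<open>finite C\<close> by (simp add: h_def)
      then show False using r by simp
    qed
    then have "b = of_int \<lfloor>b / h\<rfloor> * h" by (simp add: r_def)
    then show ?thesis by blast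
  qed
  moreover have "{of_int l * h | l. True} \<subseteq> B" using int_mult h by auto
  ultimately have "B = {of_int l * h | l. True}" by blast
  with h show ?thesis unfolding B_def by blast
qed

end

section \<open>Stabilisers of interior points\<close>

text \<open>The Cayley transformation: it maps the half plane onto the unit disc and \<open>\<xi>\<close> to 0, and it is
the coordinate underlying the charts around the image of \<open>\<xi>\<close>.\<close>

definition disc_coord :: "complex \<Rightarrow> complex \<Rightarrow> complex" where
  "disc_coord \<xi> z = (z - \<xi>) / (z - cnj \<xi>)"

lemma uhp_minus_cnj_nonzero: "z \<in> uhp \<Longrightarrow> \<xi> \<in> uhp \<Longrightarrow> z - cnj \<xi> \<noteq> 0"
  by (auto simp: uhp_def complex_eq_iff)

lemma disc_coord_self [simp]: "disc_coord \<xi> \<xi> = 0"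
  by (simp add: disc_coord_def)

lemma disc_coord_eq_0_iff: "z \<in> uhp \<Longrightarrow> \<xi> \<in> uhp \<Longrightarrow> disc_coord \<xi> z = 0 \<longleftrightarrow> z = \<xi>"
  using uhp_minus_cnj_nonzero[of z \<xi>] by (simp add: disc_coord_def)

lemma norm_disc_coord_less_1:
  assumes "z \<in> uhp" "\<xi> \<in> uhp"
  shows "norm (disc_coord \<xi> z) < 1"
proof -
  have pos: "Im z * Im \<xi> > 0" using assms by (simp add: uhp_def)
  have "(norm (z - \<xi>))\<^sup>2 = (norm (z - cnj \<xi>))\<^sup>2 - 4 * (Im z * Im \<xi>)"
    by (simp add: cmod_power2) (simp add: power2_eq_square algebra_simps)
  then have "(norm (z - \<xi>))\<^sup>2 < (norm (z - cnj \<xi>))\<^sup>2"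
    using pos by simp
  then have "norm (z - \<xi>) < norm (z - cnj \<xi>)"
    by (rule power_less_imp_less_base) simp
  then show ?thesis
    using uhp_minus_cnj_nonzero[OF assms] by (simp add: disc_coord_def norm_divide)
qed

lemma disc_coord_inj:
  assumes "z \<in> uhp" "z' \<in> uhp" "\<xi> \<in> uhp" "disc_coord \<xi> z = disc_coord \<xi> z'"
  shows "z = z'"
proof -
  have "(z - \<xi>) * (z' - cnj \<xi>) = (z' - \<xi>) * (z - cnj \<xi>)"
    using assms uhp_minus_cnj_nonzero[of _ \<xi>] by (simp add: disc_coord_def frac_eq_eq)
  then have "(z - z') * (\<xi> - cnj \<xi>) = 0"
    by (simp add: algebra_simps)
  moreover have "\<xi> - cnj \<xi> \<noteq> 0"
    using assms by (auto simp: uhp_def complex_eq_iff)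
  ultimately show ?thesis by simp
qed

lemma disc_coord_surj:
  assumes "norm v < 1" "\<xi> \<in> uhp"
  obtains z where "z \<in> uhp" "disc_coord \<xi> z = v"
proof -
  have v: "1 - v \<noteq> 0" using assms by auto
  have ne: "\<xi> - cnj \<xi> \<noteq> 0"
    using assms by (auto simp: uhp_def complex_eq_iff)
  define z where "z = (\<xi> - cnj \<xi> * v) / (1 - v)"
  have "z - \<xi> = v * (\<xi> - cnj \<xi>) / (1 - v)" "z - cnj \<xi> = (\<xi> - cnj \<xi>) / (1 - v)"
    using v by (simp_all add: z_def field_simps)
  then have "disc_coord \<xi> z = v"
    using v ne by (simp add: disc_coord_def)
  moreover have "z \<in> uhp"
  proof -
    have "Im ((\<xi> - cnj \<xi> * v) * cnj (1 - v)) = Im \<xi> * (1 - (norm v)\<^sup>2)"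
      unfolding cmod_power2 by (simp add: power2_eq_square algebra_simps)
    moreover have "(norm v)\<^sup>2 < 1" using assms by (simp add: abs_square_less_1)
    ultimately have "Im ((\<xi> - cnj \<xi> * v) * cnj (1 - v)) > 0"
      using assms by (simp add: uhp_def)
    moreover have "Im z = Im ((\<xi> - cnj \<xi> * v) * cnj (1 - v)) / (norm (1 - v))\<^sup>2"
      unfolding z_def complex_div_cnj[of _ "1 - v"]
      by (metis Im_divide_of_real of_real_power)
    ultimately show ?thesis using v by (simp add: uhp_def)
  qed
  ultimately show ?thesis using that by blast
qed

lemma has_field_derivative_disc_coord:
  assumes "z \<in> uhp" "\<xi> \<in> uhp"
  shows "(disc_coord \<xi> has_field_derivative (\<xi> - cnj \<xi>) / (z - cnj \<xi>)\<^sup>2) (at z)"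
proof -
  have "((\<lambda>z. (z - \<xi>) / (z - cnj \<xi>)) has_field_derivative (\<xi> - cnj \<xi>) / (z - cnj \<xi>)\<^sup>2) (at z)"
    using uhp_minus_cnj_nonzero[OF assms]
    by (auto intro!: derivative_eq_intros simp: power2_eq_square)
  then show ?thesis by (simp add: disc_coord_def[abs_def])
qed

lemma holomorphic_disc_coord: "\<xi> \<in> uhp \<Longrightarrow> disc_coord \<xi> holomorphic_on uhp"
  using has_field_derivative_disc_coord holomorphic_on_open[OF open_uhp] by blast

lemma open_disc:
  assumes "\<xi> \<in> uhp"
  shows "open {z \<in> uhp. norm (disc_coord \<xi> z) < r}"
proof -
  have "continuous_on uhp (\<lambda>z. norm (disc_coord \<xi> z))"
    using holomorphic_disc_coord[OF assms] by (intro continuous_on_norm holomorphic_on_imp_continuous_on)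
  then have "open ((\<lambda>z. norm (disc_coord \<xi> z)) -` {..<r} \<inter> uhp)"
    by (intro open_uhp continuous_on_open_vimage[THEN iffD1, rule_format]) auto
  also have "(\<lambda>z. norm (disc_coord \<xi> z)) -` {..<r} \<inter> uhp = {z \<in> uhp. norm (disc_coord \<xi> z) < r}"
    by auto
  finally show ?thesis .
qed

lemma mob_diff:
  assumes "det g = 1" "autf g z \<noteq> 0" "autf g z' \<noteq> 0"
  shows "mob g z - mob g z' = (z - z') / (autf g z * autf g z')"
proof -
  have d: "complex_of_real (g$1$1) * of_real (g$2$2) - of_real (g$1$2) * of_real (g$2$1) = 1"
    using arg_cong[OF assms(1), of complex_of_real] by (simp add: det_2)
  have "(of_real (g$1$1) * z + of_real (g$1$2)) * autf g z' - (of_real (g$1$1) * z' + of_real (g$1$2)) * autf g z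
     = (complex_of_real (g$1$1) * of_real (g$2$2) - of_real (g$1$2) * of_real (g$2$1)) * (z - z')"
    by (simp add: autf_def algebra_simps)
  then show ?thesis
    using assms by (simp add: mob_def d diff_frac_eq del: add_divide_distrib)
qed

lemma autf_cnj: "autf g (cnj z) = cnj (autf g z)"
  by (simp add: autf_def)

lemma mob_cnj: "mob g (cnj z) = cnj (mob g z)"
  by (simp add: mob_def autf_cnj)

text \<open>By Schwarz's lemma an automorphism of the disc that fixes 0 is a rotation; the multiplier is the derivative at
the fixed point.\<close>

lemma disc_coord_mob:
  assumes "det g = 1" "z \<in> uhp" "\<xi> \<in> uhp" "mob g \<xi> = \<xi>"
  shows "disc_coord \<xi> (mob g z) = disc_coord \<xi> z / (autf g \<xi>)\<^sup>2" "norm (autf g \<xi>) = 1"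
proof -
  have nz: "autf g z \<noteq> 0" "autf g \<xi> \<noteq> 0" "autf g (cnj \<xi>) \<noteq> 0"
    using assms autf_nonzero by (auto simp: autf_cnj)
  have "Im \<xi> = Im \<xi> / (norm (autf g \<xi>))\<^sup>2"
    using Im_mob[OF assms(1), of \<xi>] assms(4) by simp
  then have "(norm (autf g \<xi>))\<^sup>2 = 1"
    using assms(3) nz by (simp add: uhp_def field_simps)
  then show n: "norm (autf g \<xi>) = 1"
    unfolding power2_eq_1_iff using norm_ge_zero[of "autf g \<xi>"] by linarith
  have cnj: "autf g (cnj \<xi>) = 1 / autf g \<xi>"
  proof -
    have "autf g \<xi> * cnj (autf g \<xi>) = 1" by (simp add: n flip: complex_norm_square)
    then show ?thesis using nz by (simp add: autf_cnj nonzero_eq_divide_eq mult.commute)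
  qed
  have "mob g z - \<xi> = (z - \<xi>) / (autf g z * autf g \<xi>)"
    using mob_diff[OF assms(1) nz(1,2)] assms(4) by simp
  moreover have "mob g z - cnj \<xi> = (z - cnj \<xi>) / (autf g z * autf g (cnj \<xi>))"
    using mob_diff[OF assms(1) nz(1,3)] assms(4) by (simp add: mob_cnj)
  ultimately show "disc_coord \<xi> (mob g z) = disc_coord \<xi> z / (autf g \<xi>)\<^sup>2"
    using nz by (simp add: disc_coord_def cnj power2_eq_square)
qed

text \<open>The numerator and the denominator of the transformation are real linear forms in \<open>\<xi>\<close> and 1, which are
linearly independent over the reals; so both are determined, up to a common sign, by
the value and the derivative at \<open>\<xi>\<close>.\<close>

lemma SL2_eq_pm_if_autf_eq:
  assumes "\<xi> \<in> uhp" "det g = 1" "det h = 1" "mob g \<xi> = mob h \<xi>" "(autf g \<xi>)\<^sup>2 = (autf h \<xi>)\<^sup>2"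
  shows "g = h \<or> g = - h"
proof -
  have lin: "a = a' \<and> b = b'"
    if "complex_of_real a * \<xi> + of_real b = of_real a' * \<xi> + of_real b'" for a b a' b' :: real
  proof -
    have "(a - a') * Im \<xi> = 0" using that by (auto simp: complex_eq_iff algebra_simps)
    then have "a = a'" using assms(1) by (simp add: uhp_def)
    then show ?thesis using that by simp
  qed
  have num: "of_real (k$1$1) * \<xi> + of_real (k$1$2) = mob k \<xi> * autf k \<xi>" if "det k = 1" for k
    using autf_nonzero[OF that assms(1)] by (simp add: mob_def)
  from assms(5) consider "autf g \<xi> = autf h \<xi>" | "autf g \<xi> = - autf h \<xi>"
    by (auto simp: power2_eq_iff)
  then show ?thesis
  proof cases
    case 1
    then have "of_real (g$1$1) * \<xi> + of_real (g$1$2) = of_real (h$1$1) * \<xi> + of_real (h$1$2)"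
      by (simp add: num assms)
    then have "g$1$1 = h$1$1 \<and> g$1$2 = h$1$2" by (rule lin)
    moreover have "g$2$1 = h$2$1 \<and> g$2$2 = h$2$2"
      using 1 unfolding autf_def by (rule lin)
    ultimately have "g = h" by (intro mat2_eqI) auto
    then show ?thesis ..
  next
    case 2
    then have "of_real (g$1$1) * \<xi> + of_real (g$1$2) = - (of_real (h$1$1) * \<xi> + of_real (h$1$2))"
      by (simp add: num assms)
    then have "of_real (g$1$1) * \<xi> + of_real (g$1$2) = of_real (- h$1$1) * \<xi> + of_real (- h$1$2)"
      by simp
    then have "g$1$1 = - h$1$1 \<and> g$1$2 = - h$1$2" by (rule lin)
    moreover have "of_real (g$2$1) * \<xi> + of_real (g$2$2) = of_real (- h$2$1) * \<xi> + of_real (- h$2$2)"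
      using 2 by (simp add: autf_def)
    then have "g$2$1 = - h$2$1 \<and> g$2$2 = - h$2$2" by (rule lin)
    ultimately have "g = - h" by (intro mat2_eqI) auto
    then show ?thesis ..
  qed
qed

lemma card_image_eq_card_image:
  assumes "\<And>a b. a \<in> S \<Longrightarrow> b \<in> S \<Longrightarrow> f a = f b \<longleftrightarrow> g a = g b"
  shows "card (f ` S) = card (g ` S)"
proof (rule bij_betw_same_card)
  show "bij_betw (\<lambda>y. g (inv_into S f y)) (f ` S) (g ` S)"
  proof (rule bij_betw_imageI)
    have i: "f (inv_into S f (f a)) = f a" "inv_into S f (f a) \<in> S" if "a \<in> S" for a
      using that by (auto intro: f_inv_into_f inv_into_into)
    then have *: "g (inv_into S f (f a)) = g a" if "a \<in> S" for a
      using assms[of "inv_into S f (f a)" a] that by auto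
    show "inj_on (\<lambda>y. g (inv_into S f y)) (f ` S)"
      by (auto simp: inj_on_def * assms)
    show "(\<lambda>y. g (inv_into S f y)) ` f ` S = g ` S"
      using * by (force simp: image_iff)
  qed
qed

text \<open>Lagrange's theorem: multiplication by an element permutes the set, so it does not change the product
of all elements. As there are only \<open>n\<close> roots of unity of order \<open>n\<close>, all of them occur.\<close>

lemma finite_subgroup_roots_of_unity:
  fixes S :: "complex set"
  assumes "finite S" "S \<noteq> {}" "0 \<notin> S" "\<And>a b. a \<in> S \<Longrightarrow> b \<in> S \<Longrightarrow> a * b \<in> S"
  shows "S = {z. z ^ card S = 1}"
proof (rule card_subset_eq)
  have e: "card S > 0" using assms by (simp add: card_gt_0_iff)
  show "finite {z::complex. z ^ card S = 1}"
    using e by (rule finite_nth_roots)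
  show "card S = card {z::complex. z ^ card S = 1}"
    using card_roots_unity_eq[OF e] by simp
  show "S \<subseteq> {z. z ^ card S = 1}"
  proof safe
    fix z assume z: "z \<in> S"
    have inj: "inj_on ((*) z) S" using z assms by (auto simp: inj_on_def)
    have "(*) z ` S = S"
      using z assms inj by (intro card_subset_eq) (auto simp: card_image)
    then have "\<Prod>S = \<Prod>((*) z ` S)" by simp
    also have "\<dots> = (\<Prod>a\<in>S. z * a)" using inj by (simp add: prod.reindex)
    also have "\<dots> = z ^ card S * \<Prod>S" by (simp add: prod.distrib)
    finally have "\<Prod>S * (z ^ card S - 1) = 0" by (simp add: algebra_simps)
    moreover have "\<Prod>S \<noteq> 0" using assms by auto
    ultimately show "z ^ card S = 1" by simp
  qed
qed

context discrete_SL2_subgroup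
begin

lemma orb_eq_iff: "orb \<Gamma> p = orb \<Gamma> p' \<longleftrightarrow> (\<exists>g\<in>\<Gamma>. p' = act g p)"
proof
  assume "orb \<Gamma> p = orb \<Gamma> p'"
  moreover have "act (mat 1) p' \<in> orb \<Gamma> p'" unfolding orb_def by (intro imageI) simp
  ultimately show "\<exists>g\<in>\<Gamma>. p' = act g p" by (auto simp: orb_def)
next
  have *: "orb \<Gamma> (act g p) \<subseteq> orb \<Gamma> p" if "g \<in> \<Gamma>" for g p
    using that by (auto simp: orb_def simp flip: act_mult)
  assume "\<exists>g\<in>\<Gamma>. p' = act g p"
  then obtain g where g: "g \<in> \<Gamma>" "p' = act g p" by auto
  have "orb \<Gamma> (act (matrix_inv g) p') \<subseteq> orb \<Gamma> p'" using g by (intro *) simp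
  then show "orb \<Gamma> p = orb \<Gamma> p'" using g * by (auto simp: act_inv)
qed

lemma quot_map_eq_iff:
  "z \<in> uhp \<Longrightarrow> quot_map \<Gamma> z = quot_map \<Gamma> z' \<longleftrightarrow> (\<exists>g\<in>\<Gamma>. z' = mob g z)"
  by (auto simp: quot_map_def orb_eq_iff autf_nonzero)

lemma quot_map_mob [simp]: "g \<in> \<Gamma> \<Longrightarrow> z \<in> uhp \<Longrightarrow> quot_map \<Gamma> (mob g z) = quot_map \<Gamma> z"
  by (metis quot_map_eq_iff)

lemma stab_Fin_iff: "\<xi> \<in> uhp \<Longrightarrow> g \<in> stab \<Gamma> (Fin \<xi>) \<longleftrightarrow> g \<in> \<Gamma> \<and> mob g \<xi> = \<xi>"
  by (auto simp: stab_def autf_nonzero)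

text \<open>Proper discontinuity. The ratio of the imaginary parts of \<open>z\<close> and \<open>g z\<close> bounds the denominator of \<open>g\<close>, and then the
boundedness of \<open>g z\<close> bounds the numerator. Both are linear forms in \<open>z\<close> and 1 with real coefficients, and \<open>z\<close>
stays away from the real line, so the entries of \<open>g\<close> are bounded.\<close>

lemma finite_returning:
  assumes "\<delta> > 0"
  shows "finite {g \<in> \<Gamma>. \<exists>z. Im z \<ge> \<delta> \<and> norm z \<le> R \<and> Im (mob g z) \<ge> \<delta> \<and> norm (mob g z) \<le> R}" (is "finite ?S")
proof (rule finite_bounded)
  define J where "J = sqrt (R / \<delta>)"
  have "norm g \<le> 4 * ((J + R * J) * (1 + R) * (1 + 1 / \<delta>))" if "g \<in> ?S" for g
  proof -
    from that obtain z where g: "g \<in> \<Gamma>" and z: "Im z \<ge> \<delta>" "norm z \<le> R" "Im (mob g z) \<ge> \<delta>" "norm (mob g z) \<le> R"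
      by auto
    have zu: "z \<in> uhp" using z assms by (simp add: uhp_def)
    have nz: "autf g z \<noteq> 0" using g zu by (simp add: autf_nonzero)
    have R: "R \<ge> 0" using z(2) norm_ge_zero[of z] by linarith
    have "Im z \<le> R" using z(2) abs_Im_le_cmod[of z] by linarith
    moreover have "\<delta> * (norm (autf g z))\<^sup>2 \<le> Im z"
      using z(3) nz g by (simp add: Im_mob field_simps)
    ultimately have "(norm (autf g z))\<^sup>2 \<le> R / \<delta>"
      using assms by (simp add: field_simps)
    then have j: "norm (autf g z) \<le> J"
      unfolding J_def by (rule real_le_rsqrt)
    then have J: "J \<ge> 0" using norm_ge_zero[of "autf g z"] by linarith
    define P where "P = J + R * J"
    have "R * J \<ge> 0" using J R by simp
    then have P: "P \<ge> 0" "norm (autf g z) \<le> P" using j J by (simp_all add: P_def)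
    have num: "norm (of_real (g$1$1) * z + of_real (g$1$2)) \<le> P"
    proof -
      have "of_real (g$1$1) * z + of_real (g$1$2) = mob g z * autf g z"
        using nz by (simp add: mob_def)
      then have "norm (of_real (g$1$1) * z + of_real (g$1$2)) \<le> R * J"
        using z(4) j R by (simp add: norm_mult mult_mono)
      then show ?thesis using J by (simp add: P_def)
    qed
    have lin: "\<bar>a\<bar> \<le> P / \<delta>" "\<bar>b\<bar> \<le> P + P / \<delta> * R"
      if "norm (of_real a * z + of_real b) \<le> P" for a b :: real
    proof -
      have "\<bar>a\<bar> * Im z = \<bar>Im (of_real a * z + of_real b)\<bar>"
        using z(1) assms by (simp add: abs_mult)
      also have "\<dots> \<le> P" using that abs_Im_le_cmod order_trans by blast
      finally have "\<bar>a\<bar> * Im z \<le> P" .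
      moreover have "\<bar>a\<bar> * \<delta> \<le> \<bar>a\<bar> * Im z" using z(1) by (intro mult_left_mono) auto
      ultimately show a: "\<bar>a\<bar> \<le> P / \<delta>" using assms by (simp add: field_simps)
      have "\<bar>b\<bar> = norm ((of_real a * z + of_real b) - of_real a * z)" by simp
      also have "\<dots> \<le> norm (of_real a * z + of_real b) + norm (of_real a * z)"
        by (rule norm_triangle_ineq4)
      also have "\<dots> \<le> P + P / \<delta> * R"
      proof (rule add_mono[OF that])
        show "norm (of_real a * z) \<le> P / \<delta> * R"
          unfolding norm_mult norm_of_real using a z(2) P assms by (intro mult_mono) auto
      qed
      finally show "\<bar>b\<bar> \<le> P + P / \<delta> * R" .
    qed
    have le: "P / \<delta> \<le> P * (1 + R) * (1 + 1 / \<delta>)" "P + P / \<delta> * R \<le> P * (1 + R) * (1 + 1 / \<delta>)"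
      using P R assms by (simp_all add: field_simps)
    show ?thesis
      unfolding P_def[symmetric]
    proof (rule norm_mat2_le)
      show "\<bar>g$1$1\<bar> \<le> P * (1 + R) * (1 + 1 / \<delta>)" "\<bar>g$1$2\<bar> \<le> P * (1 + R) * (1 + 1 / \<delta>)"
        using lin[OF num] le by linarith+
      have "norm (of_real (g$2$1) * z + of_real (g$2$2)) \<le> P"
        using P(2) by (simp add: autf_def)
      then show "\<bar>g$2$1\<bar> \<le> P * (1 + R) * (1 + 1 / \<delta>)" "\<bar>g$2$2\<bar> \<le> P * (1 + R) * (1 + 1 / \<delta>)"
        using lin le by (meson order_trans)+
    qed
  qed
  then show "bounded ?S" by (auto simp only: bounded_iff)
qed auto

lemma finite_stab:
  assumes "\<xi> \<in> uhp"
  shows "finite (stab \<Gamma> (Fin \<xi>))"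
  by (rule finite_subset[OF _ finite_returning[of "Im \<xi>" "norm \<xi>"]])
     (use assms in \<open>auto simp: stab_Fin_iff uhp_def\<close>)

text \<open>The number \<open>1 / j(g, \<xi>)\<^sup>2\<close> is the derivative of \<open>g\<close> at its fixed point \<open>\<xi>\<close>, hence the multiplier by which
\<open>g\<close> acts in the disc coordinate.\<close>

definition rotations :: "complex \<Rightarrow> complex set" where
  "rotations \<xi> = (\<lambda>g. 1 / (autf g \<xi>)\<^sup>2) ` stab \<Gamma> (Fin \<xi>)"

text \<open>Two elements of the stabiliser have the same multiplier if and only if they agree up to sign, that
is, if and only if they lie in the same coset of the central elements.\<close>

lemma card_rotations:
  assumes "\<xi> \<in> uhp"
  shows "card (rotations \<xi>) = elliptic_index \<Gamma> \<xi>"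
proof -
  let ?S = "stab \<Gamma> (Fin \<xi>)" and ?C = "\<Gamma> \<inter> {mat 1, - mat 1}"
  let ?G = "SL2R\<lparr>carrier := ?S\<rparr>"
  have coset: "?C #>\<^bsub>?G\<^esub> a = (\<lambda>h. h ** a) ` ?C" for a
    by (auto simp: r_coset_def SL2R_def)
  have "rcosets\<^bsub>?G\<^esub> ?C = (\<lambda>a. (\<lambda>h. h ** a) ` ?C) ` ?S"
    unfolding RCOSETS_def coset by (auto simp: SL2R_def)
  moreover have "card ((\<lambda>a. (\<lambda>h. h ** a) ` ?C) ` ?S) = card (rotations \<xi>)"
    unfolding rotations_def
  proof (rule card_image_eq_card_image)
    fix a b assume ab: "a \<in> ?S" "b \<in> ?S"
    then have in\<Gamma>: "a \<in> \<Gamma>" "b \<in> \<Gamma>" and fixed: "mob a \<xi> = \<xi>" "mob b \<xi> = \<xi>"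
      using assms by (auto simp: stab_Fin_iff)
    have minus: "- mat 1 ** x = - x" for x :: "real^2^2"
      by (intro mat2_eqI) auto
    have "(\<lambda>h. h ** a) ` ?C = (\<lambda>h. h ** b) ` ?C \<longleftrightarrow> a = b \<or> a = - b"
    proof
      assume eq: "(\<lambda>h. h ** a) ` ?C = (\<lambda>h. h ** b) ` ?C"
      have "mat 1 ** a \<in> (\<lambda>h. h ** a) ` ?C" by (intro imageI) simp
      then have "a \<in> (\<lambda>h. h ** b) ` ?C" unfolding eq by simp
      then show "a = b \<or> a = - b" by (auto simp: minus)
    next
      have "(\<lambda>h. h ** a) ` ?C = (\<lambda>h. h ** b) ` ?C" if "a = - b"
      proof -
        have "a ** matrix_inv b = - mat 1 ** (b ** matrix_inv b)"
          unfolding that minus[of b, symmetric] by (rule matrix_mul_assoc[symmetric])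
        also have "\<dots> = - mat 1"
          using in\<Gamma> by (simp add: SL2_inv)
        finally have "a ** matrix_inv b = - mat 1" .
        then have "- mat 1 \<in> \<Gamma>" using in\<Gamma> by (metis inv_in mult_in)
        then have "?C = {mat 1, - mat 1}" by auto
        then show ?thesis using that by (auto simp: minus)
      qed
      moreover assume "a = b \<or> a = - b"
      ultimately show "(\<lambda>h. h ** a) ` ?C = (\<lambda>h. h ** b) ` ?C" by auto
    qed
    also have "\<dots> \<longleftrightarrow> 1 / (autf a \<xi>)\<^sup>2 = 1 / (autf b \<xi>)\<^sup>2"
      using SL2_eq_pm_if_autf_eq[of \<xi> a b] assms in\<Gamma> fixed
      by (auto simp: autf_def power2_eq_iff)
    finally show "((\<lambda>h. h ** a) ` ?C = (\<lambda>h. h ** b) ` ?C) = (1 / (autf a \<xi>)\<^sup>2 = 1 / (autf b \<xi>)\<^sup>2)" .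
  qed
  ultimately show ?thesis by (simp add: elliptic_index_def)
qed

text \<open>Consequently the \<open>e\<close>-th power of the disc coordinate separates the orbits of the stabiliser, and
it is a good coordinate on the quotient.\<close>

lemma rotations_eq:
  assumes "\<xi> \<in> uhp"
  shows "rotations \<xi> = {\<zeta>. \<zeta> ^ elliptic_index \<Gamma> \<xi> = 1}" "elliptic_index \<Gamma> \<xi> > 0"
proof -
  have fin: "finite (rotations \<xi>)"
    unfolding rotations_def by (intro finite_imageI finite_stab assms)
  have 1: "mat 1 \<in> stab \<Gamma> (Fin \<xi>)" using assms by (simp add: stab_Fin_iff)
  then show "elliptic_index \<Gamma> \<xi> > 0"
    using fin unfolding card_rotations[OF assms, symmetric] by (auto simp: card_gt_0_iff rotations_def)
  have "rotations \<xi> = {\<zeta>. \<zeta> ^ card (rotations \<xi>) = 1}"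
  proof (rule finite_subgroup_roots_of_unity[OF fin])
    show "rotations \<xi> \<noteq> {}" using 1 by (auto simp: rotations_def)
    show "0 \<notin> rotations \<xi>" using assms by (auto simp: rotations_def stab_Fin_iff autf_nonzero)
    show "a * b \<in> rotations \<xi>" if "a \<in> rotations \<xi>" "b \<in> rotations \<xi>" for a b
    proof -
      from that obtain g h where gh: "g \<in> stab \<Gamma> (Fin \<xi>)" "h \<in> stab \<Gamma> (Fin \<xi>)"
        "a = 1 / (autf g \<xi>)\<^sup>2" "b = 1 / (autf h \<xi>)\<^sup>2" unfolding rotations_def by blast
      then have "g ** h \<in> stab \<Gamma> (Fin \<xi>)" "a * b = 1 / (autf (g ** h) \<xi>)\<^sup>2"
        using assms by (auto simp: stab_Fin_iff mob_mult autf_mult power_mult_distrib)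
      then show ?thesis by (auto simp: rotations_def)
    qed
  qed
  then show "rotations \<xi> = {\<zeta>. \<zeta> ^ elliptic_index \<Gamma> \<xi> = 1}"
    by (simp add: card_rotations assms)
qed

text \<open>A conjugate transformation has the same multiplier at the corresponding fixed point.\<close>

lemma elliptic_index_mob:
  assumes "g \<in> \<Gamma>" "\<xi> \<in> uhp"
  shows "elliptic_index \<Gamma> (mob g \<xi>) = elliptic_index \<Gamma> \<xi>"
proof -
  have *: "rotations \<xi> \<subseteq> rotations (mob g \<xi>)" if "g \<in> \<Gamma>" "\<xi> \<in> uhp" for g \<xi>
  proof
    fix a assume "a \<in> rotations \<xi>"
    then obtain h where "h \<in> stab \<Gamma> (Fin \<xi>)" and a: "a = 1 / (autf h \<xi>)\<^sup>2"
      unfolding rotations_def by blast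
    then have h: "h \<in> \<Gamma>" "mob h \<xi> = \<xi>"
      using that by (auto simp: stab_Fin_iff)
    let ?k = "g ** (h ** matrix_inv g)"
    have d: "det (h ** matrix_inv g) = 1" using that h by simp
    have 1: "mob (h ** matrix_inv g) (mob g \<xi>) = \<xi>"
      using that h by (simp add: mob_mult SL2_inv mob_inv)
    then have "mob ?k (mob g \<xi>) = mob g \<xi>"
      using that h d by (subst mob_mult) auto
    moreover have "autf ?k (mob g \<xi>) = autf h \<xi>"
    proof -
      have "autf ?k (mob g \<xi>) = autf g \<xi> * (autf h \<xi> * autf (matrix_inv g) (mob g \<xi>))"
        using that h d 1 by (subst autf_mult) (auto simp: autf_mult[of h] SL2_inv mob_inv)
      then show ?thesis using that by (simp add: autf_inv autf_nonzero)
    qed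
    ultimately show "a \<in> rotations (mob g \<xi>)"
      using that h a unfolding rotations_def by (intro image_eqI[of _ _ ?k]) (auto simp: stab_Fin_iff)
  qed
  have "rotations (mob g \<xi>) \<subseteq> rotations \<xi>"
    using *[of "matrix_inv g" "mob g \<xi>"] assms by (simp add: mob_inv)
  then have "rotations (mob g \<xi>) = rotations \<xi>"
    using * assms by blast
  then show ?thesis using assms by (simp flip: card_rotations)
qed

text \<open>Only finitely many elements return a compact neighbourhood of \<open>\<xi>\<close> to itself. Those among
them that move \<open>\<xi>\<close> are discarded by separating \<open>\<xi>\<close> from its image.\<close>

lemma exists_small_disc:
  assumes \<xi>: "\<xi> \<in> uhp"
  shows "\<exists>r>0. \<forall>g\<in>\<Gamma>. mob g ` {z \<in> uhp. norm (disc_coord \<xi> z) < r} \<inter> {z \<in> uhp. norm (disc_coord \<xi> z) < r} \<noteq> {}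
            \<longrightarrow> g \<in> stab \<Gamma> (Fin \<xi>)"
proof -
  define y where "y = Im \<xi>"
  have y: "y > 0" using \<xi> by (simp add: y_def uhp_def)
  define F where "F = {g \<in> \<Gamma>. \<exists>z. Im z \<ge> y/2 \<and> norm z \<le> norm \<xi> + y/2 \<and> Im (mob g z) \<ge> y/2 \<and> norm (mob g z) \<le> norm \<xi> + y/2}"
  have "finite F"
    unfolding F_def by (rule finite_returning) (use y in auto)
  define F' where "F' = F - stab \<Gamma> (Fin \<xi>)"
  have F': "finite F'" "g \<in> F' \<Longrightarrow> g \<in> \<Gamma>" "g \<in> F' \<Longrightarrow> mob g \<xi> \<noteq> \<xi>" for g
    using \<open>finite F\<close> \<xi> by (auto simp: F'_def F_def stab_Fin_iff)
  have "\<exists>U V. open U \<and> open V \<and> mob g \<xi> \<in> U \<and> \<xi> \<in> V \<and> U \<inter> V = {}" if "g \<in> F'" for g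
    using F'(3)[OF that] hausdorff by blast
  then obtain U V where UV: "\<And>g. g \<in> F' \<Longrightarrow> open (U g)" "\<And>g. g \<in> F' \<Longrightarrow> open (V g)"
     "\<And>g. g \<in> F' \<Longrightarrow> mob g \<xi> \<in> U g" "\<And>g. g \<in> F' \<Longrightarrow> \<xi> \<in> V g" "\<And>g. g \<in> F' \<Longrightarrow> U g \<inter> V g = {}"
    by metis
  have "\<forall>\<^sub>F z in nhds \<xi>. \<forall>g\<in>F'. mob g z \<in> U g \<and> z \<in> V g"
  proof (rule eventually_ball_finite[OF F'(1)], safe)
    fix g assume g: "g \<in> F'"
    have "isCont (mob g) \<xi>"
      using has_field_derivative_mob[of g \<xi>] F'(2)[OF g] \<xi> DERIV_isCont by auto
    then have "\<forall>\<^sub>F z in nhds \<xi>. mob g z \<in> U g"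
      using UV(1,3)[OF g] by (intro topological_tendstoD) (auto simp: isCont_def tendsto_at_iff_tendsto_nhds)
    moreover have "\<forall>\<^sub>F z in nhds \<xi>. z \<in> V g"
      using UV(2,4)[OF g] by (rule eventually_nhds_in_open)
    ultimately show "\<forall>\<^sub>F z in nhds \<xi>. mob g z \<in> U g \<and> z \<in> V g"
      by eventually_elim auto
  qed
  then obtain e where e: "e > 0" "\<And>z g. dist z \<xi> < e \<Longrightarrow> g \<in> F' \<Longrightarrow> mob g z \<in> U g \<and> z \<in> V g"
    by (auto simp: eventually_nhds_metric)
  \<comment> \<open>A point of the disc of radius \<open>r \<le> 1/2\<close> is at Euclidean distance less than \<open>4 r y\<close> from \<open>\<xi>\<close>. This should be
    at most \<open>y / 2\<close>, to stay in the compact neighbourhood, and at most \<open>e\<close>.\<close>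
  define r where "r = min (1/8) (e / (4 * y))"
  have r: "r > 0" "r \<le> 1/8" "r * (4 * y) \<le> e"
    using e y by (auto simp: r_def min_def field_simps)
  have near: "norm (z - \<xi>) < r * (4 * y)" if "z \<in> uhp" "norm (disc_coord \<xi> z) < r" for z
  proof -
    have "norm (z - \<xi>) < r * norm (z - cnj \<xi>)"
      using that uhp_minus_cnj_nonzero[OF that(1) \<xi>] by (simp add: disc_coord_def norm_divide field_simps)
    also have "norm (z - cnj \<xi>) \<le> norm (z - \<xi>) + norm (\<xi> - cnj \<xi>)"
      using norm_triangle_ineq[of "z - \<xi>" "\<xi> - cnj \<xi>"] by simp
    also have "\<xi> - cnj \<xi> = \<i> * of_real (2 * y)"
      by (simp add: complex_eq_iff y_def)
    also have "norm \<dots> = 2 * y" using y by (simp add: norm_mult)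
    finally have "norm (z - \<xi>) < r * norm (z - \<xi>) + r * (2 * y)"
      using r by (simp add: algebra_simps)
    moreover have "r * norm (z - \<xi>) \<le> 1/2 * norm (z - \<xi>)"
      using r by (intro mult_right_mono) auto
    ultimately show ?thesis by (simp add: algebra_simps)
  qed
  have near': "norm (z - \<xi>) \<le> y / 2" "dist z \<xi> < e" if "z \<in> uhp" "norm (disc_coord \<xi> z) < r" for z
  proof -
    have "r * (4 * y) \<le> 1/8 * (4 * y)" using r y by (intro mult_right_mono) auto
    then show "norm (z - \<xi>) \<le> y / 2" using near[OF that] by simp
    show "dist z \<xi> < e" using near[OF that] r by (simp add: dist_norm)
  qed
  have box: "Im z \<ge> y/2" "norm z \<le> norm \<xi> + y/2" if "norm (z - \<xi>) \<le> y / 2" for z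
    using that abs_Im_le_cmod[of "z - \<xi>"] norm_triangle_ineq[of \<xi> "z - \<xi>"] by (auto simp: y_def)
  show ?thesis
  proof (intro exI[of _ r] conjI r ballI impI)
    fix g assume g: "g \<in> \<Gamma>"
    assume "mob g ` {z \<in> uhp. norm (disc_coord \<xi> z) < r} \<inter> {z \<in> uhp. norm (disc_coord \<xi> z) < r} \<noteq> {}"
    then obtain z where z: "z \<in> uhp" "norm (disc_coord \<xi> z) < r" "mob g z \<in> uhp" "norm (disc_coord \<xi> (mob g z)) < r"
      by auto
    have "g \<in> F"
      using g box[OF near'(1)[OF z(1,2)]] box[OF near'(1)[OF z(3,4)]] by (auto simp: F_def)
    moreover have "g \<notin> F'"
      using e(2)[OF near'(2)[OF z(1,2)], of g] e(2)[OF near'(2)[OF z(3,4)], of g] UV(5)[of g] by auto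
    ultimately show "g \<in> stab \<Gamma> (Fin \<xi>)" by (auto simp: F'_def)
  qed
qed

end

section \<open>Cusps and Fourier expansions\<close>

definition cusp_coord :: "real^2^2 \<Rightarrow> real \<Rightarrow> complex \<Rightarrow> complex" where
  "cusp_coord \<sigma> h z = exp (2 * of_real pi * \<i> * mob \<sigma> z / of_real h)"

lemma cusp_coord_nonzero [simp]: "cusp_coord \<sigma> h z \<noteq> 0"
  by (simp add: cusp_coord_def)

lemma cusp_frameD:
  assumes "cusp_frame \<Gamma> x \<sigma> h"
  shows "det \<sigma> = 1" "act \<sigma> x = Infty" "h > 0"
  using assms by (auto simp: cusp_frame_def SL2R_def)

lemma has_field_derivative_cusp_coord:
  assumes "det \<sigma> = 1" "z \<in> uhp"
  shows "(cusp_coord \<sigma> h has_field_derivative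
            cusp_coord \<sigma> h z * (2 * of_real pi * \<i> / of_real h) / (autf \<sigma> z)\<^sup>2) (at z)"
proof -
  define K where "K = 2 * of_real pi * \<i> / complex_of_real h"
  have eq: "cusp_coord \<sigma> h = (\<lambda>z. exp (mob \<sigma> z * K))"
    by (rule ext) (simp add: cusp_coord_def K_def mult_ac)
  have "((\<lambda>z. exp (mob \<sigma> z * K)) has_field_derivative exp (mob \<sigma> z * K) * (1 / autf \<sigma> z ^ 2 * K)) (at z)"
    by (intro DERIV_fun_exp DERIV_cmult_right has_field_derivative_mob assms)
  then show ?thesis by (simp add: eq K_def mult.commute)
qed

lemma holomorphic_cusp_coord: "det \<sigma> = 1 \<Longrightarrow> cusp_coord \<sigma> h holomorphic_on uhp"
  using has_field_derivative_cusp_coord holomorphic_on_open[OF open_uhp] by blast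

lemma norm_cusp_coord:
  "norm (cusp_coord \<sigma> h z) = exp (- (2 * pi * Im (mob \<sigma> z) / h))"
  by (simp add: cusp_coord_def Im_divide_of_real Re_divide_of_real)

lemma norm_cusp_coord_less:
  assumes "h > 0"
  shows "norm (cusp_coord \<sigma> h z) < exp (- (2 * pi * L / h)) \<longleftrightarrow> Im (mob \<sigma> z) > L"
  using assms by (simp add: norm_cusp_coord divide_less_cancel)

lemma open_horodisc:
  assumes "det \<sigma> = 1"
  shows "open {z \<in> uhp. Im (mob \<sigma> z) > L}"
proof -
  have "continuous_on uhp (\<lambda>z. Im (mob \<sigma> z))"
    using holomorphic_mob[OF assms] by (intro continuous_intros holomorphic_on_imp_continuous_on)
  then have "open ((\<lambda>z. Im (mob \<sigma> z)) -` {L<..} \<inter> uhp)"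
    using continuous_on_open_vimage[OF open_uhp] open_greaterThan by blast
  also have "(\<lambda>z. Im (mob \<sigma> z)) -` {L<..} \<inter> uhp = {z \<in> uhp. Im (mob \<sigma> z) > L}"
    by auto
  finally show ?thesis .
qed

lemma cusp_coord_surj:
  assumes "det \<sigma> = 1" "h > 0" "u \<noteq> 0" "norm u < 1"
  obtains z where "z \<in> uhp" "cusp_coord \<sigma> h z = u"
proof -
  define \<zeta> where "\<zeta> = of_real h * Ln u / (2 * of_real pi * \<i>)"
  define z where "z = mob (matrix_inv \<sigma>) \<zeta>"
  have eq: "2 * of_real pi * \<i> * \<zeta> / of_real h = Ln u"
    using assms by (simp add: \<zeta>_def)
  have "Re (2 * of_real pi * \<i> * \<zeta> / of_real h) = - (2 * pi * Im \<zeta> / h)"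
    by (simp add: Re_divide_of_real)
  moreover have "Re (Ln u) < 0" using assms by simp
  ultimately have "2 * pi * Im \<zeta> / h > 0" unfolding eq by simp
  then have "\<zeta> \<in> uhp" using assms by (simp add: uhp_def zero_less_mult_iff zero_less_divide_iff)
  then have "z \<in> uhp" "mob \<sigma> z = \<zeta>" using assms by (auto simp: z_def SL2_inv mob_inv)
  then have "cusp_coord \<sigma> h z = u" using assms eq by (simp add: cusp_coord_def)
  with \<open>z \<in> uhp\<close> show ?thesis using that by blast
qed

lemma cusp_coord_eqD:
  assumes "h > 0" "cusp_coord \<sigma> h z = cusp_coord \<sigma> h z'"
  obtains l :: int where "mob \<sigma> z' = mob \<sigma> z + of_int l * of_real h"
proof -
  from assms(2)[symmetric] have "\<exists>l::int.
    2 * of_real pi * \<i> * mob \<sigma> z' / of_real h = 2 * of_real pi * \<i> * mob \<sigma> z / of_real h + of_real (of_int (2 * l) * pi) * \<i>"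
    unfolding cusp_coord_def exp_eq .
  then obtain l :: int where
    "2 * of_real pi * \<i> * mob \<sigma> z' / of_real h = 2 * of_real pi * \<i> * mob \<sigma> z / of_real h + of_real (of_int (2 * l) * pi) * \<i>" ..
  then have "2 * of_real pi * \<i> * (mob \<sigma> z' / of_real h) = 2 * of_real pi * \<i> * (mob \<sigma> z / of_real h + of_int l)"
    by (simp add: algebra_simps)
  then have "mob \<sigma> z' / of_real h = mob \<sigma> z / of_real h + of_int l"
    by (subst (asm) mult_left_cancel) auto
  then have "mob \<sigma> z' = mob \<sigma> z + of_int l * of_real h"
    using assms(1) by (simp add: field_simps)
  then show ?thesis using that by blast
qed

lemma slash_mob:
  assumes "det \<sigma> = 1" "z \<in> uhp"
  shows "slash m f (matrix_inv \<sigma>) (mob \<sigma> z) = f z * autf \<sigma> z ^ m"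
  using assms by (simp add: slash_def mob_inv autf_inv power_one_over)

text \<open>The expansion rewritten on the original half plane, where the coordinate of the cusp is a function of
\<open>z\<close>; this avoids the inverse of \<open>\<sigma>\<close>.\<close>

lemma fourier_expansion_iff:
  assumes "det \<sigma> = 1"
  shows "fourier_expansion m f \<sigma> h a \<longleftrightarrow>
           (\<forall>z\<in>uhp. (\<lambda>n. a n * cusp_coord \<sigma> h z ^ n) sums (f z * autf \<sigma> z ^ m))"
proof -
  have pow: "exp (2 * of_real pi * \<i> * of_nat n * \<zeta> / of_real h) = exp (2 * of_real pi * \<i> * \<zeta> / of_real h) ^ n" for n \<zeta>
    by (simp add: mult_ac flip: exp_of_nat_mult)
  have "fourier_expansion m f \<sigma> h a \<longleftrightarrow>
      (\<forall>z\<in>uhp. (\<lambda>n. a n * exp (2 * of_real pi * \<i> * z / of_real h) ^ n) sums slash m f (matrix_inv \<sigma>) z)"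
    by (simp only: fourier_expansion_def pow)
  also have "\<dots> \<longleftrightarrow> (\<forall>z\<in>uhp. (\<lambda>n. a n * exp (2 * of_real pi * \<i> * mob \<sigma> z / of_real h) ^ n) sums slash m f (matrix_inv \<sigma>) (mob \<sigma> z))"
  proof (intro iffI ballI)
    fix z assume "z \<in> uhp"
      "\<forall>z\<in>uhp. (\<lambda>n. a n * exp (2 * of_real pi * \<i> * mob \<sigma> z / of_real h) ^ n) sums slash m f (matrix_inv \<sigma>) (mob \<sigma> z)"
    from this(2)[rule_format, of "mob (matrix_inv \<sigma>) z"] this(1)
    show "(\<lambda>n. a n * exp (2 * of_real pi * \<i> * z / of_real h) ^ n) sums slash m f (matrix_inv \<sigma>) z"
      using assms by (simp add: SL2_inv mob_inv)
  qed (use assms in auto)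
  also have "\<dots> \<longleftrightarrow> (\<forall>z\<in>uhp. (\<lambda>n. a n * cusp_coord \<sigma> h z ^ n) sums (f z * autf \<sigma> z ^ m))"
    using assms by (simp add: slash_mob cusp_coord_def)
  finally show ?thesis .
qed

text \<open>The coordinate takes every value in the punctured unit disc, hence the power series converges in the whole
disc, and \<open>f(z) j(\<sigma>, z)\<^sup>m\<close> is a holomorphic function of the coordinate that extends to the cusp.\<close>

lemma fourier_expansion_power_series:
  assumes "det \<sigma> = 1" "h > 0" "fourier_expansion m f \<sigma> h a"
  obtains P where "P holomorphic_on ball 0 1" "\<And>u. norm u < 1 \<Longrightarrow> (\<lambda>n. a n * u ^ n) sums P u"
    "\<And>z. z \<in> uhp \<Longrightarrow> P (cusp_coord \<sigma> h z) = f z * autf \<sigma> z ^ m"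
proof -
  define P where "P u = (\<Sum>n. a n * u ^ n)" for u
  have four: "(\<lambda>n. a n * cusp_coord \<sigma> h z ^ n) sums (f z * autf \<sigma> z ^ m)" if "z \<in> uhp" for z
    using assms that by (simp add: fourier_expansion_iff)
  have sums: "(\<lambda>n. a n * u ^ n) sums P u" if u: "norm u < 1" for u
  proof (cases "u = 0")
    case True
    then show ?thesis using powser_sums_zero[of a] unfolding P_def by (auto intro: summable_sums sums_summable)
  next
    case False
    obtain z where "z \<in> uhp" "cusp_coord \<sigma> h z = u"
      by (rule cusp_coord_surj[OF assms(1,2) False u])
    then show ?thesis using four[of z] unfolding P_def by (metis summable_sums sums_summable)
  qed
  show ?thesis
  proof (rule that)
    show "P holomorphic_on ball 0 1"
      by (rule power_series_holomorphic[where a = a]) (use sums in auto)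
    show "P (cusp_coord \<sigma> h z) = f z * autf \<sigma> z ^ m" if "z \<in> uhp" for z
      unfolding P_def using four[OF that] by (rule sums_unique[symmetric])
  qed (use sums in auto)
qed

lemma power_series_zero:
  fixes c :: "nat \<Rightarrow> complex"
  assumes "r > 0" "\<And>u. u \<noteq> 0 \<Longrightarrow> norm u < r \<Longrightarrow> (\<lambda>n. c n * u ^ n) sums 0"
  shows "c n = 0"
proof -
  define F where "F u = (if u = 0 then c 0 else 0)" for u :: complex
  have sums: "(\<lambda>n. c n * u ^ n) sums F u" if "norm u < r" for u
    using assms(2)[of u] that powser_sums_zero[of c] by (auto simp: F_def)
  have "F holomorphic_on ball 0 r"
    by (rule power_series_holomorphic[where a = c]) (use sums in auto)
  then have "isCont F 0"
    using assms(1) by (meson centre_in_ball continuous_on_eq_continuous_at holomorphic_on_imp_continuous_on open_ball)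
  then have "F \<midarrow>0\<rightarrow> c 0" by (simp add: isCont_def F_def)
  moreover have "F \<midarrow>0\<rightarrow> 0"
    by (rule tendsto_eventually) (auto simp: F_def eventually_at_filter)
  ultimately have c0: "c 0 = 0" using LIM_unique by blast
  show ?thesis
  proof (rule ccontr)
    assume nz: "c n \<noteq> 0"
    then have "n > 0" using c0 by (cases n) auto
    obtain s where s: "0 < s" "\<And>z. z \<in> cball 0 s - {0} \<Longrightarrow> F z \<noteq> 0"
      by (rule powser_0_nonzero[of r 0 c F n]) (use assms(1) sums nz \<open>n > 0\<close> c0 in \<open>auto simp: F_def\<close>)
    then have "F (of_real s) \<noteq> 0" by auto
    then show False using c0 by (auto simp: F_def split: if_splits)
  qed
qed

lemma sums_zero_prefix_iff:
  fixes g :: "nat \<Rightarrow> complex"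
  assumes "\<And>n. n < l \<Longrightarrow> g n = 0"
  shows "g sums s \<longleftrightarrow> (\<lambda>n. g (n + l)) sums s"
proof -
  have "(\<Sum>i<l. g i) = 0" using assms by simp
  then show ?thesis using sums_iff_shift[of g l s] by simp
qed

lemma scaleR_mat2_mult:
  fixes A B :: "real^2^2"
  shows "(s *\<^sub>R A) ** B = s *\<^sub>R (A ** B)" "A ** (s *\<^sub>R B) = s *\<^sub>R (A ** B)"
  by (intro mat2_eqI; simp add: algebra_simps)+

lemma cusp_translation:
  assumes "cusp_frame \<Gamma> x \<sigma> h"
  obtains g s where "g \<in> stab \<Gamma> x" "s \<in> {1, -1}" "\<sigma> ** g = s *\<^sub>R (translation (of_int l * h) ** \<sigma>)"
proof -
  have "1 *\<^sub>R translation (of_int l * h) \<in> {s *\<^sub>R translation (of_int l * h) | s (l::int). s \<in> {1, -1}}"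
    by blast
  also have "\<dots> = {s *\<^sub>R (\<sigma> ** g ** matrix_inv \<sigma>) | s g. s \<in> {1, -1} \<and> g \<in> stab \<Gamma> x}"
    using assms unfolding cusp_frame_def by blast
  finally obtain s g where sg: "s \<in> {1, -1}" "g \<in> stab \<Gamma> x"
      "translation (of_int l * h) = s *\<^sub>R (\<sigma> ** g ** matrix_inv \<sigma>)"
    unfolding scaleR_one by blast
  have "translation (of_int l * h) ** \<sigma> = s *\<^sub>R (\<sigma> ** g ** (matrix_inv \<sigma> ** \<sigma>))"
    unfolding sg(3) by (simp only: scaleR_mat2_mult matrix_mul_assoc)
  also have "\<dots> = s *\<^sub>R (\<sigma> ** g)"
    using cusp_frameD[OF assms] by (simp add: SL2_inv)
  finally have "s *\<^sub>R (translation (of_int l * h) ** \<sigma>) = (s * s) *\<^sub>R (\<sigma> ** g)"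
    by (simp only: scaleR_scaleR)
  also have "s * s = 1" using sg(1) by auto
  finally have "\<sigma> ** g = s *\<^sub>R (translation (of_int l * h) ** \<sigma>)" by simp
  then show ?thesis using sg that by blast
qed

lemma cusp_not_uhp: "x \<in> cusps \<Gamma> \<Longrightarrow> z \<in> uhp \<Longrightarrow> x \<noteq> Fin z"
  by (auto simp: cusps_def uhp_def)

lemma cusp_moved_to_infinity:
  assumes "x \<in> cusps \<Gamma>"
  obtains \<sigma> where "det \<sigma> = 1" "act \<sigma> x = Infty"
proof (cases "x = Infty")
  case True
  then show ?thesis using that[of "mat 1"] by simp
next
  case False
  then obtain r where r: "x = Fin (of_real r)" using assms by (auto simp: cusps_def)
  show ?thesis
    by (rule that[of "vector [vector [0, -1], vector [1, -r]]"]) (auto simp: r det_2 autf_def)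
qed

lemma cusp_coord_change:
  assumes "h > 0" "\<alpha> \<noteq> 0" "h' = \<alpha>\<^sup>2 * h" "mob \<sigma>' (mob \<gamma> z) = of_real (\<alpha>\<^sup>2) * mob \<sigma> z + of_real \<beta>"
  shows "cusp_coord \<sigma>' h' (mob \<gamma> z) = exp (2 * of_real pi * \<i> * of_real \<beta> / of_real h') * cusp_coord \<sigma> h z"
proof -
  have "2 * of_real pi * \<i> * mob \<sigma>' (mob \<gamma> z) / of_real h' =
     2 * of_real pi * \<i> * of_real \<beta> / of_real h' + 2 * of_real pi * \<i> * mob \<sigma> z / of_real h"
    using assms(1,2) unfolding assms(3,4) by (simp add: field_simps)
  then show ?thesis unfolding cusp_coord_def by (simp add: exp_add)
qed

context discrete_SL2_subgroup
begin

text \<open>Every multiple of the width is the translation length of an element of the group. The sign \<open>s\<close>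
appears because the frame describes the stabiliser only up to sign; it disappears in even weight.\<close>

lemma translation_on_uhp:
  assumes "cusp_frame \<Gamma> x \<sigma> h"
  obtains g s where "g \<in> \<Gamma>" "s \<in> {1, -1::real}"
    "\<And>z. z \<in> uhp \<Longrightarrow> mob \<sigma> (mob g z) = mob \<sigma> z + of_int l * of_real h"
    "\<And>z. z \<in> uhp \<Longrightarrow> autf \<sigma> (mob g z) * autf g z = of_real s * autf \<sigma> z"
proof -
  note d = cusp_frameD[OF assms]
  obtain g s where g: "g \<in> stab \<Gamma> x" and s: "s \<in> {1, -1}" and eq: "\<sigma> ** g = s *\<^sub>R (translation (of_int l * h) ** \<sigma>)"
    using cusp_translation[OF assms, of l] by blast
  have g\<Gamma>: "g \<in> \<Gamma>" using g by (simp add: stab_def)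
  show ?thesis
  proof (rule that[OF g\<Gamma> s])
    fix z assume z: "z \<in> uhp"
    have "mob \<sigma> (mob g z) = mob (\<sigma> ** g) z" using d g\<Gamma> z by (simp add: mob_mult)
    also have "\<dots> = mob (translation (of_int l * h)) (mob \<sigma> z)"
      unfolding eq mob_scale[OF s] using d z by (simp add: mob_mult)
    finally show "mob \<sigma> (mob g z) = mob \<sigma> z + of_int l * of_real h" by simp
    have "autf \<sigma> (mob g z) * autf g z = autf (\<sigma> ** g) z" using d g\<Gamma> z by (simp add: autf_mult)
    also have "\<dots> = of_real s * autf (translation (of_int l * h)) (mob \<sigma> z) * autf \<sigma> z"
      unfolding eq autf_scale using d z by (simp add: autf_mult)
    finally show "autf \<sigma> (mob g z) * autf g z = of_real s * autf \<sigma> z" by (simp add: autf_def[of "translation _"])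
  qed
qed

lemma stab_conj_iff:
  assumes "det \<sigma> = 1" "act \<sigma> x = Infty" "g \<in> \<Gamma>"
  shows "g \<in> stab \<Gamma> x \<longleftrightarrow> (\<sigma> ** g ** matrix_inv \<sigma>)$2$1 = 0"
proof -
  have "act (matrix_inv \<sigma>) Infty = x" using act_inv(1)[OF assms(1), of x] assms(2) by simp
  then have "act (\<sigma> ** g ** matrix_inv \<sigma>) Infty = act \<sigma> (act g x)"
    using assms by (simp add: act_mult det_mul SL2_inv del: act.simps)
  moreover have "act \<sigma> (act g x) = Infty \<longleftrightarrow> act g x = x"
    using act_inv(1)[OF assms(1)] assms(2) by metis
  moreover have "act (\<sigma> ** g ** matrix_inv \<sigma>) Infty = Infty \<longleftrightarrow> (\<sigma> ** g ** matrix_inv \<sigma>)$2$1 = 0"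
    by (simp del: mat2_mult)
  ultimately show ?thesis using assms(3) unfolding stab_def by auto
qed

text \<open>A parabolic element that fixes the cusp becomes, up to sign, a translation when the cusp is moved to infinity,
and its square is a translation without sign. Then all elements of the stabiliser are
translations up to sign, and their lengths form a cyclic group.\<close>

lemma cusp_frame_exists:
  assumes "x \<in> cusps \<Gamma>"
  obtains \<sigma> h where "cusp_frame \<Gamma> x \<sigma> h"
proof -
  obtain \<sigma> where \<sigma>: "det \<sigma> = 1" "act \<sigma> x = Infty"
    by (rule cusp_moved_to_infinity[OF assms])
  let ?c = "\<lambda>g. \<sigma> ** g ** matrix_inv \<sigma>"
  interpret C: discrete_SL2_subgroup "?c ` \<Gamma>"
    by (rule conj_group[OF \<sigma>(1)])
  obtain p where p: "p \<in> \<Gamma>" "parabolic p" "act p x = x"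
    using assms by (auto simp: cusps_def)
  have dc: "matrix_inv \<sigma> ** ?c g ** \<sigma> = g" for g
  proof -
    have "matrix_inv \<sigma> ** ?c g ** \<sigma> = (matrix_inv \<sigma> ** \<sigma>) ** g ** (matrix_inv \<sigma> ** \<sigma>)"
      by (simp only: matrix_mul_assoc)
    then show ?thesis by (simp add: \<sigma> SL2_inv)
  qed
  have c0: "?c p$2$1 = 0"
    using stab_conj_iff[OF \<sigma> p(1)] p by (simp add: stab_def del: mat2_mult)
  have det: "det (?c p) = 1" using p \<sigma> by (simp add: det_mul SL2_inv)
  have "?c p$1$1 + ?c p$2$2 = (p$1$1 + p$2$2) * det \<sigma>"
    by (simp add: matrix_inv_entries[OF \<sigma>(1)] det_2) (simp add: algebra_simps)
  then have tr: "\<bar>?c p$1$1 + ?c p$2$2\<bar> = 2" using p \<sigma> by (simp add: parabolic_def del: mat2_mult)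
  define a d b where "a = ?c p$1$1" and "d = ?c p$2$2" and "b = ?c p$1$2"
  have "a * d = 1" using det c0 by (simp add: det_2 a_def d_def del: mat2_mult)
  have "(a + d)\<^sup>2 = 4" using tr unfolding a_def[symmetric] d_def[symmetric]
    by (metis power2_abs numeral_Bit0 power2_eq_square mult_2 numeral_times_numeral semiring_norm(13) semiring_norm(11))
  then have "(a - d)\<^sup>2 = 0" using \<open>a * d = 1\<close> by (simp add: power2_eq_square algebra_simps)
  then have "a = d" by simp
  then have a1: "a = 1 \<or> a = -1" using \<open>a * d = 1\<close> by (simp add: square_eq_1_iff)
  \<comment> \<open>Otherwise the parabolic element would be the identity up to sign.\<close>
  have b: "b \<noteq> 0"
  proof
    assume b0: "b = 0"
    have "?c p = a *\<^sub>R mat 1"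
      using c0 b0 \<open>a = d\<close> by (intro mat2_eqI) (simp_all add: a_def d_def b_def del: mat2_mult)
    then have "p = matrix_inv \<sigma> ** (a *\<^sub>R mat 1) ** \<sigma>" using dc[of p] by simp
    also have "\<dots> = a *\<^sub>R mat 1" by (simp add: scaleR_mat2_mult SL2_inv \<sigma>)
    finally show False using a1 p(2) by (auto simp: parabolic_def)
  qed
  define k where "k = 2 * a * b"
  have "?c p ** ?c p = translation k"
    using c0 \<open>a = d\<close> a1 unfolding a_def d_def b_def k_def by (intro mat2_eqI) (auto simp del: mat2_mult simp: mat2_mult[of "?c p" "?c p"])
  moreover have "?c p ** ?c p \<in> ?c ` \<Gamma>" using p by (intro C.mult_in imageI) auto
  ultimately have k: "translation k \<in> ?c ` \<Gamma>" "k \<noteq> 0" using b a1 by (auto simp: k_def)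
  have "translation \<bar>k\<bar> \<in> ?c ` \<Gamma>"
  proof (cases "k \<ge> 0")
    case False
    have "matrix_inv (translation k) = translation (- k)"
      by (intro mat2_eqI) (simp_all add: matrix_inv_entries)
    then show ?thesis using C.inv_in[OF k(1)] False by (simp add: abs_if)
  qed (use k in simp)
  then obtain h where h: "h > 0" "{b. \<exists>s\<in>{1,-1}. s *\<^sub>R translation b \<in> ?c ` \<Gamma>} = {of_int l * h | l. True}"
    using C.translations_discrete[of "\<bar>k\<bar>"] k(2) by auto
  have "{s *\<^sub>R ?c g | s g. s \<in> {1, -1} \<and> g \<in> stab \<Gamma> x} = {s *\<^sub>R translation (of_int l * h) | s (l::int). s \<in> {1, -1}}"
  proof (intro equalityI subsetI)
    fix A assume "A \<in> {s *\<^sub>R ?c g | s g. s \<in> {1, -1} \<and> g \<in> stab \<Gamma> x}"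
    then obtain s g where A: "A = s *\<^sub>R ?c g" "s \<in> {1, -1}" "g \<in> stab \<Gamma> x" by blast
    then have "?c g \<in> ?c ` \<Gamma>" "?c g$2$1 = 0"
      using stab_conj_iff[OF \<sigma>, of g] by (auto simp: stab_def simp del: mat2_mult)
    then obtain t b where t: "t \<in> {1, -1}" "?c g = t *\<^sub>R translation b"
      using C.upper_triangular_translation[OF k(2,1)] by blast
    then have "t *\<^sub>R translation b \<in> ?c ` \<Gamma>" using \<open>?c g \<in> ?c ` \<Gamma>\<close> by simp
    then have "b \<in> {of_int l * h | l. True}" unfolding h(2)[symmetric] using t(1) by blast
    then obtain l where "b = of_int l * h" by blast
    moreover have "A = (s * t) *\<^sub>R translation b" "s * t \<in> {1, -1}"
      using A(1,2) t by auto
    ultimately show "A \<in> {s *\<^sub>R translation (of_int l * h) | s (l::int). s \<in> {1, -1}}" by blast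
  next
    fix A assume "A \<in> {s *\<^sub>R translation (of_int l * h) | s (l::int). s \<in> {1, -1}}"
    then obtain s l where A: "A = s *\<^sub>R translation (of_int l * h)" "s \<in> {1, -1}" by blast
    have "of_int l * h \<in> {b. \<exists>s\<in>{1,-1}. s *\<^sub>R translation b \<in> ?c ` \<Gamma>}" unfolding h(2) by blast
    then obtain t g where t: "t \<in> {1, -1}" "g \<in> \<Gamma>" "t *\<^sub>R translation (of_int l * h) = ?c g" by blast
    have "?c g$2$1 = 0" unfolding t(3)[symmetric] by simp
    then have "g \<in> stab \<Gamma> x" using stab_conj_iff[OF \<sigma> t(2)] by simp
    moreover have "A = (s * t) *\<^sub>R ?c g" unfolding A(1) t(3)[symmetric] using t(1) by auto
    moreover have "s * t \<in> {1, -1}" using A(2) t(1) by auto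
    ultimately show "A \<in> {s *\<^sub>R ?c g | s g. s \<in> {1, -1} \<and> g \<in> stab \<Gamma> x}" by blast
  qed
  then have "cusp_frame \<Gamma> x \<sigma> h"
    using \<sigma> h(1) by (simp add: cusp_frame_def SL2R_def)
  then show ?thesis using that by blast
qed

text \<open>The square of a generator of the stabiliser is the translation by \<open>k = 2h\<close>, whatever its sign. If \<open>g\<close> does not fix
the cusp, Shimizu's lemma gives \<open>\<bar>c\<bar> k \<ge> 1\<close> for the conjugate of \<open>g\<close>, and a point of
height more than \<open>k\<close> is mapped to a point of height at most \<open>1 / (c\<^sup>2 k) \<le> k\<close>.\<close>

lemma exists_small_horodisc:
  assumes frame: "cusp_frame \<Gamma> x \<sigma> h"
  shows "\<exists>L>0. \<forall>g\<in>\<Gamma>. mob g ` {z \<in> uhp. Im (mob \<sigma> z) > L} \<inter> {z \<in> uhp. Im (mob \<sigma> z) > L} \<noteq> {} \<longrightarrow> g \<in> stab \<Gamma> x"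
proof -
  note d = cusp_frameD[OF frame]
  let ?c = "\<lambda>g. \<sigma> ** g ** matrix_inv \<sigma>"
  interpret C: discrete_SL2_subgroup "?c ` \<Gamma>"
    by (rule conj_group[OF d(1)])
  define k where "k = 2 * h"
  obtain g s where g: "g \<in> stab \<Gamma> x" "s \<in> {1, -1}" "\<sigma> ** g = s *\<^sub>R (translation (of_int 1 * h) ** \<sigma>)"
    using cusp_translation[OF frame, of 1] by blast
  have "?c g = s *\<^sub>R (translation h ** (\<sigma> ** matrix_inv \<sigma>))"
    unfolding g(3) by (simp only: scaleR_mat2_mult matrix_mul_assoc of_int_1 mult_1)
  then have "?c g ** ?c g = (s * s) *\<^sub>R (translation h ** translation h)"
    using d by (simp add: SL2_inv scaleR_mat2_mult)
  also have "\<dots> = translation k" using g(2) by (auto simp: translation_mult k_def)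
  finally have k: "translation k \<in> ?c ` \<Gamma>"
    using g by (metis (no_types, lifting) C.mult_in imageI mem_Collect_eq stab_def)
  have "k > 0" using d by (simp add: k_def)
  show ?thesis
  proof (intro exI[of _ k] conjI \<open>k > 0\<close> ballI impI)
    fix g assume g: "g \<in> \<Gamma>" and ne: "mob g ` {z \<in> uhp. Im (mob \<sigma> z) > k} \<inter> {z \<in> uhp. Im (mob \<sigma> z) > k} \<noteq> {}"
    from ne obtain z where z: "z \<in> uhp" "Im (mob \<sigma> z) > k" "Im (mob \<sigma> (mob g z)) > k" by auto
    define \<zeta> where "\<zeta> = mob \<sigma> z"
    have \<zeta>: "\<zeta> \<in> uhp" "Im \<zeta> > k" using z d by (auto simp: \<zeta>_def)
    have det: "det (?c g) = 1" using d g by (simp add: det_mul SL2_inv)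
    have eq: "mob (?c g) \<zeta> = mob \<sigma> (mob g z)"
      using d g z by (simp add: mob_mult det_mul SL2_inv mob_inv \<zeta>_def)
    have "?c g$2$1 = 0"
    proof (rule ccontr)
      define c where "c = ?c g$2$1"
      assume "?c g$2$1 \<noteq> 0"
      then have c: "\<bar>c\<bar> * k \<ge> 1" "c \<noteq> 0"
        using C.shimizu[OF \<open>k > 0\<close> k, of "?c g"] g unfolding c_def by auto
      have "\<bar>c\<bar> * Im \<zeta> = \<bar>Im (autf (?c g) \<zeta>)\<bar>"
        using uhpD[OF \<zeta>(1)] by (simp add: autf_def c_def abs_mult del: mat2_mult)
      also have "\<dots> \<le> norm (autf (?c g) \<zeta>)" by (rule abs_Im_le_cmod)
      finally have "(\<bar>c\<bar> * Im \<zeta>)\<^sup>2 \<le> (norm (autf (?c g) \<zeta>))\<^sup>2"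
        using uhpD[OF \<zeta>(1)] by (intro power_mono) auto
      moreover have "Im (mob (?c g) \<zeta>) * (norm (autf (?c g) \<zeta>))\<^sup>2 = Im \<zeta>"
        using autf_nonzero[OF det \<zeta>(1)] by (simp add: Im_mob[OF det])
      moreover have "Im (mob (?c g) \<zeta>) > k" using z(3) eq by simp
      ultimately have "k * (\<bar>c\<bar> * Im \<zeta>)\<^sup>2 \<le> Im \<zeta>"
        using \<open>k > 0\<close> by (smt (verit) mult_mono zero_le_power2)
      then have "k * (\<bar>c\<bar> * \<bar>c\<bar> * Im \<zeta>) * Im \<zeta> \<le> 1 * Im \<zeta>"
        by (simp add: power2_eq_square algebra_simps)
      then have "k * (\<bar>c\<bar> * \<bar>c\<bar> * Im \<zeta>) \<le> 1"
        using uhpD[OF \<zeta>(1)] mult_le_cancel_right_pos by blast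
      moreover have "k * (\<bar>c\<bar> * \<bar>c\<bar> * k) < k * (\<bar>c\<bar> * \<bar>c\<bar> * Im \<zeta>)"
        using \<open>k > 0\<close> c \<zeta>(2) by (intro mult_strict_left_mono) (auto simp: zero_less_mult_iff linorder_neq_iff)
      moreover have "1 * 1 \<le> (\<bar>c\<bar> * k) * (\<bar>c\<bar> * k)" using c by (intro mult_mono) auto
      ultimately show False by (simp add: algebra_simps)
    qed
    then show "g \<in> stab \<Gamma> x" using stab_conj_iff[OF d(1,2) g] by simp
  qed
qed

text \<open>The matrix \<open>M\<close> that relates the two frames fixes infinity, and conjugation by \<open>M\<close> multiplies translation
lengths by \<open>M\<^sub>1\<^sub>1\<^sup>2\<close>.\<close>

lemma change_of_frame_width:
  assumes frame: "cusp_frame \<Gamma> x \<sigma> h" and frame': "cusp_frame \<Gamma> x' \<sigma>' h'"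
    and \<gamma>: "\<gamma> \<in> \<Gamma>" "x' = act \<gamma> x" and M: "M = \<sigma>' ** \<gamma> ** matrix_inv \<sigma>"
  shows "\<exists>l::int. (M$1$1)\<^sup>2 * h = of_int l * h'" "M$2$1 = 0" "M$1$1 * M$2$2 = 1" "\<sigma>' ** \<gamma> = M ** \<sigma>"
proof -
  note d = cusp_frameD[OF frame] and d' = cusp_frameD[OF frame']
  have detM: "det M = 1" using d d' \<gamma> by (simp add: M det_mul SL2_inv)
  have "act (matrix_inv \<sigma>) Infty = x" using act_inv(1)[OF d(1), of x] d(2) by simp
  then have "act M Infty = Infty"
    using d d' \<gamma> by (simp add: M act_mult det_mul SL2_inv del: act.simps)
  then show M21: "M$2$1 = 0" by (simp split: if_splits)
  then show M11: "M$1$1 * M$2$2 = 1" using detM by (simp add: det_2)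
  show M\<sigma>: "\<sigma>' ** \<gamma> = M ** \<sigma>"
    using d by (simp add: M SL2_inv flip: matrix_mul_assoc)
  obtain g s where g: "g \<in> stab \<Gamma> x" "s \<in> {1, -1}" "\<sigma> ** g = s *\<^sub>R (translation (of_int 1 * h) ** \<sigma>)"
    using cusp_translation[OF frame, of 1] by blast
  define k where "k = \<gamma> ** g ** matrix_inv \<gamma>"
  have kst: "k \<in> stab \<Gamma> x'"
    using \<gamma> g by (auto simp: stab_def k_def act_mult det_mul SL2_inv act_inv)
  have "\<sigma>' ** k ** matrix_inv \<sigma>' = (\<sigma>' ** \<gamma>) ** g ** (matrix_inv \<gamma> ** matrix_inv \<sigma>')"
    by (simp only: k_def matrix_mul_assoc)
  also have "matrix_inv \<gamma> ** matrix_inv \<sigma>' = matrix_inv (M ** \<sigma>)"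
    unfolding M\<sigma>[symmetric] using \<gamma> d' by (simp add: matrix_inv_mult_SL2)
  also have "(\<sigma>' ** \<gamma>) ** g ** matrix_inv (M ** \<sigma>) = M ** (\<sigma> ** g) ** matrix_inv (M ** \<sigma>)"
    unfolding M\<sigma> by (simp only: matrix_mul_assoc)
  also have "\<dots> = s *\<^sub>R (M ** translation h ** (\<sigma> ** matrix_inv \<sigma>) ** matrix_inv M)"
    unfolding g(3) using detM d by (simp add: matrix_inv_mult_SL2 scaleR_mat2_mult matrix_mul_assoc)
  also have "\<dots> = s *\<^sub>R (M ** translation h ** matrix_inv M)"
    using d by (simp add: SL2_inv)
  also have "M ** translation h ** matrix_inv M = translation ((M$1$1)\<^sup>2 * h)"
    using M21 M11 by (intro mat2_eqI) (auto simp: matrix_inv_entries[OF detM] power2_eq_square algebra_simps)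
  finally have eq: "\<sigma>' ** k ** matrix_inv \<sigma>' = s *\<^sub>R translation ((M$1$1)\<^sup>2 * h)" .
  have "1 *\<^sub>R (\<sigma>' ** k ** matrix_inv \<sigma>') \<in> {s *\<^sub>R (\<sigma>' ** g ** matrix_inv \<sigma>') | s g. s \<in> {1, -1} \<and> g \<in> stab \<Gamma> x'}"
    using kst by blast
  also have "\<dots> = {s *\<^sub>R translation (of_int l * h') | s (l::int). s \<in> {1, -1}}"
    using frame' unfolding cusp_frame_def by blast
  finally have "s *\<^sub>R translation ((M$1$1)\<^sup>2 * h) \<in> {s *\<^sub>R translation (of_int l * h') | s (l::int). s \<in> {1, -1}}"
    unfolding eq scaleR_one .
  then obtain t l where tl: "s *\<^sub>R translation ((M$1$1)\<^sup>2 * h) = t *\<^sub>R translation (of_int l * h')" by blast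
  have "s = t" using arg_cong[OF tl, of "\<lambda>A. A$1$1"] by simp
  moreover have "s * ((M$1$1)\<^sup>2 * h) = t * (of_int l * h')" using arg_cong[OF tl, of "\<lambda>A. A$1$2"] by simp
  ultimately have "(M$1$1)\<^sup>2 * h = of_int l * h'" using g(2) by auto
  then show "\<exists>l::int. (M$1$1)\<^sup>2 * h = of_int l * h'" by blast
qed

text \<open>The widths divide each other, by the preceding lemma applied in both directions; being positive, they
correspond. The two coordinates at infinity are thus related by a real affine map.\<close>

lemma change_of_frame:
  assumes frame: "cusp_frame \<Gamma> x \<sigma> h" and frame': "cusp_frame \<Gamma> x' \<sigma>' h'" and orb: "orb \<Gamma> x = orb \<Gamma> x'"
  obtains \<gamma> \<alpha> \<beta> where "\<gamma> \<in> \<Gamma>" "\<alpha> \<noteq> 0" "h' = \<alpha>\<^sup>2 * h"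
    "\<And>z. z \<in> uhp \<Longrightarrow> mob \<sigma>' (mob \<gamma> z) = of_real (\<alpha>\<^sup>2) * mob \<sigma> z + of_real \<beta>"
    "\<And>z. z \<in> uhp \<Longrightarrow> autf \<sigma>' (mob \<gamma> z) * autf \<gamma> z = autf \<sigma> z / of_real \<alpha>"
proof -
  note d = cusp_frameD[OF frame] and d' = cusp_frameD[OF frame']
  obtain \<gamma> where \<gamma>: "\<gamma> \<in> \<Gamma>" "x' = act \<gamma> x" using orb by (auto simp: orb_eq_iff)
  define M where "M = \<sigma>' ** \<gamma> ** matrix_inv \<sigma>"
  define N where "N = \<sigma> ** matrix_inv \<gamma> ** matrix_inv \<sigma>'"
  note Mp = change_of_frame_width[OF frame frame' \<gamma> M_def]
  have detM: "det M = 1" using d d' \<gamma> by (simp add: M_def det_mul SL2_inv)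
  have "x = act (matrix_inv \<gamma>) x'" using \<gamma> by (simp add: act_inv)
  note Np = change_of_frame_width[OF frame' frame inv_in[OF \<gamma>(1)] this N_def]
  have "N = matrix_inv M"
    using d d' \<gamma> by (simp add: N_def M_def matrix_inv_mult_SL2 det_mul SL2_inv matrix_mul_assoc)
  then have N11: "N$1$1 = M$2$2" by (simp add: matrix_inv_entries[OF detM])
  define \<alpha> where "\<alpha> = M$1$1"
  have "\<alpha> \<noteq> 0" using Mp(3) by (auto simp: \<alpha>_def)
  then have \<alpha>: "\<alpha> \<noteq> 0" "M$2$2 = 1 / \<alpha>"
    using Mp(3) unfolding \<alpha>_def[symmetric] by (simp_all add: nonzero_eq_divide_eq mult.commute)
  obtain l where l: "\<alpha>\<^sup>2 * h = of_int l * h'" using Mp(1) by (auto simp: \<alpha>_def)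
  obtain l' where l': "(1 / \<alpha>)\<^sup>2 * h' = of_int l' * h" using Np(1) by (auto simp: N11 \<alpha>)
  have "h' = \<alpha>\<^sup>2 * ((1 / \<alpha>)\<^sup>2 * h')" using \<alpha> by (simp add: power_divide)
  also have "\<dots> = of_int l' * (\<alpha>\<^sup>2 * h)" unfolding l' by simp
  also have "\<dots> = of_int (l' * l) * h'" unfolding l by simp
  finally have "of_int (l' * l) = (1::real)" using d' by simp
  then have "l' * l = 1" by (metis of_int_eq_1_iff)
  moreover have "of_int l * h' > 0" unfolding l[symmetric] using \<alpha> d by simp
  then have "l > 0" using d' by (simp add: zero_less_mult_iff)
  ultimately have "l = 1" by (simp add: zmult_eq_1_iff)
  have num: "of_real (M$1$1) * \<zeta> + of_real (M$1$2) = of_real \<alpha> * \<zeta> + of_real (M$1$2)" for \<zeta> :: complex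
    by (simp add: \<alpha>_def)
  have autfM: "autf M \<zeta> = 1 / of_real \<alpha>" for \<zeta> using Mp(2) \<alpha> by (simp add: autf_def)
  show ?thesis
  proof (rule that[OF \<gamma>(1) \<alpha>(1), of "\<alpha> * M$1$2"])
    show "h' = \<alpha>\<^sup>2 * h" using l \<open>l = 1\<close> by simp
    fix z assume z: "z \<in> uhp"
    have "mob \<sigma>' (mob \<gamma> z) = mob M (mob \<sigma> z)"
      using d d' \<gamma> z detM Mp(4) by (simp flip: mob_mult)
    also have "\<dots> = of_real (\<alpha>\<^sup>2) * mob \<sigma> z + of_real (\<alpha> * M$1$2)"
      using \<alpha> by (simp add: mob_def[of M] autfM \<alpha>_def[symmetric] power2_eq_square algebra_simps)
    finally show "mob \<sigma>' (mob \<gamma> z) = of_real (\<alpha>\<^sup>2) * mob \<sigma> z + of_real (\<alpha> * M$1$2)" .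
    have "autf \<sigma>' (mob \<gamma> z) * autf \<gamma> z = autf M (mob \<sigma> z) * autf \<sigma> z"
      using d d' \<gamma> z detM Mp(4) by (simp flip: autf_mult)
    then show "autf \<sigma>' (mob \<gamma> z) * autf \<gamma> z = autf \<sigma> z / of_real \<alpha>" by (simp add: autfM)
  qed
qed

text \<open>A change of frame multiplies the coordinate of the cusp by a constant, and so it multiplies the \<open>n\<close>-th
coefficient by a non-zero number. Vanishing conditions on coefficients can therefore be checked in
any frame at any cusp of the orbit.\<close>

lemma fourier_expansion_change_of_frame:
  assumes frame: "cusp_frame \<Gamma> x \<sigma> h" and frame': "cusp_frame \<Gamma> x' \<sigma>' h'" and orb: "orb \<Gamma> x = orb \<Gamma> x'"
    and f: "\<And>g z. g \<in> \<Gamma> \<Longrightarrow> z \<in> uhp \<Longrightarrow> f (mob g z) = autf g z ^ m * f z"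
    and a': "fourier_expansion m f \<sigma>' h' a'"
  obtains a where "fourier_expansion m f \<sigma> h a" "\<And>n. a n = 0 \<longleftrightarrow> a' n = 0"
proof -
  note d = cusp_frameD[OF frame] and d' = cusp_frameD[OF frame']
  obtain \<gamma> \<alpha> \<beta> where \<gamma>: "\<gamma> \<in> \<Gamma>" "\<alpha> \<noteq> 0" "h' = \<alpha>\<^sup>2 * h"
    "\<And>z. z \<in> uhp \<Longrightarrow> mob \<sigma>' (mob \<gamma> z) = of_real (\<alpha>\<^sup>2) * mob \<sigma> z + of_real \<beta>"
    "\<And>z. z \<in> uhp \<Longrightarrow> autf \<sigma>' (mob \<gamma> z) * autf \<gamma> z = autf \<sigma> z / of_real \<alpha>"
    using change_of_frame[OF frame frame' orb] by metis
  define C where "C = exp (2 * of_real pi * \<i> * of_real \<beta> / of_real h' :: complex)"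
  show ?thesis
  proof (rule that)
    show "fourier_expansion m f \<sigma> h (\<lambda>n. of_real \<alpha> ^ m * a' n * C ^ n)"
      unfolding fourier_expansion_iff[OF d(1)]
    proof
      fix z assume z: "z \<in> uhp"
      have "(\<lambda>n. a' n * cusp_coord \<sigma>' h' (mob \<gamma> z) ^ n) sums (f (mob \<gamma> z) * autf \<sigma>' (mob \<gamma> z) ^ m)"
        using a' z \<gamma> by (auto simp: fourier_expansion_iff[OF d'(1)])
      also have "cusp_coord \<sigma>' h' (mob \<gamma> z) = C * cusp_coord \<sigma> h z"
        unfolding C_def by (rule cusp_coord_change[OF d(3) \<gamma>(2,3) \<gamma>(4)[OF z]])
      also have "f (mob \<gamma> z) * autf \<sigma>' (mob \<gamma> z) ^ m = f z * (autf \<sigma>' (mob \<gamma> z) * autf \<gamma> z) ^ m"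
        using f[OF \<gamma>(1) z] by (simp add: power_mult_distrib)
      also have "\<dots> = f z * autf \<sigma> z ^ m / of_real \<alpha> ^ m"
        by (simp add: \<gamma>(5)[OF z] power_divide)
      finally have "(\<lambda>n. of_real \<alpha> ^ m * (a' n * (C * cusp_coord \<sigma> h z) ^ n)) sums (of_real \<alpha> ^ m * (f z * autf \<sigma> z ^ m / of_real \<alpha> ^ m))"
        by (rule sums_mult)
      then show "(\<lambda>n. of_real \<alpha> ^ m * a' n * C ^ n * cusp_coord \<sigma> h z ^ n) sums (f z * autf \<sigma> z ^ m)"
        using \<gamma>(2) by (simp add: power_mult_distrib mult_ac)
    qed
    show "of_real \<alpha> ^ m * a' n * C ^ n = 0 \<longleftrightarrow> a' n = 0" for n
      using \<gamma>(2) by (simp add: C_def)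
  qed
qed

end

section \<open>Functions of a branched coordinate\<close>

text \<open>A local coordinate of the surface, read on the half plane: it is locally biholomorphic except over its
centre 0, where it may be branched, and it is nowhere locally constant.\<close>

definition branched_over_0 :: "complex set \<Rightarrow> (complex \<Rightarrow> complex) \<Rightarrow> bool" where
  "branched_over_0 W \<tau> \<longleftrightarrow> open W \<and> \<tau> holomorphic_on W \<and> (\<forall>z\<in>W. \<tau> z \<noteq> 0 \<longrightarrow> deriv \<tau> z \<noteq> 0) \<and>
     (\<forall>z\<in>W. \<forall>\<^sub>F w in at z. \<tau> w \<noteq> 0)"

lemma branched_over_0_subset:
  "branched_over_0 W \<tau> \<Longrightarrow> open W' \<Longrightarrow> W' \<subseteq> W \<Longrightarrow> branched_over_0 W' \<tau>"
  by (auto simp: branched_over_0_def intro: holomorphic_on_subset)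

lemma open_image_branched:
  assumes "branched_over_0 W \<tau>" "open O'" "O' \<subseteq> W"
  shows "open (\<tau> ` O')"
proof (subst open_subopen, intro ballI)
  fix u assume "u \<in> \<tau> ` O'"
  then obtain z where z: "z \<in> O'" "u = \<tau> z" by auto
  then obtain r where r: "r > 0" "ball z r \<subseteq> O'" using assms(2) openE by blast
  have hol: "\<tau> holomorphic_on ball z r"
    using assms r by (auto simp: branched_over_0_def intro: holomorphic_on_subset)
  have "\<not> \<tau> constant_on ball z r"
  proof
    assume "\<tau> constant_on ball z r"
    then obtain k where "\<And>w. w \<in> ball z r \<Longrightarrow> \<tau> w = k" by (auto simp: constant_on_def)
    then have c: "\<tau> w = \<tau> z" if "w \<in> ball z r" for w
      using that r(1) by simp
    have ev: "\<forall>\<^sub>F w in nhds z. \<tau> w = \<tau> z"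
      by (rule eventually_mono[OF eventually_nhds_in_open[of "ball z r" z] c]) (use r(1) in auto)
    show False
    proof (cases "\<tau> z = 0")
      case True
      have "\<forall>\<^sub>F w in at z. \<tau> w \<noteq> 0" using assms z by (auto simp: branched_over_0_def)
      moreover have "\<forall>\<^sub>F w in at z. \<tau> w = 0" using ev True by (auto simp: eventually_at_filter elim: eventually_mono)
      ultimately have "\<forall>\<^sub>F w in at z. False" by eventually_elim simp
      then show False by simp
    next
      case False
      then have "deriv \<tau> z \<noteq> 0" using assms z by (auto simp: branched_over_0_def)
      moreover have "deriv \<tau> z = deriv (\<lambda>_. \<tau> z) z" by (rule deriv_cong_ev[OF ev refl])
      ultimately show False by simp
    qed
  qed
  then have "open (\<tau> ` ball z r)"
    by (rule open_mapping_thm[OF hol open_ball connected_ball open_ball order_refl])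
  then show "\<exists>T. open T \<and> u \<in> T \<and> T \<subseteq> \<tau> ` O'"
    using z r by (intro exI[of _ "\<tau> ` ball z r"]) auto
qed

text \<open>The quotient function \<open>F\<close> is continuous because \<open>\<tau>\<close> is open, it is holomorphic away from 0 because \<open>\<tau>\<close> has
local inverses there, and the singularity at 0 is removable by continuity.\<close>

lemma descend_holomorphic:
  assumes br: "branched_over_0 W \<tau>" and g: "g holomorphic_on W"
    and fib: "\<And>z z'. z \<in> W \<Longrightarrow> z' \<in> W \<Longrightarrow> \<tau> z = \<tau> z' \<Longrightarrow> g z = g z'"
  obtains F where "F holomorphic_on \<tau> ` W" "\<And>z. z \<in> W \<Longrightarrow> F (\<tau> z) = g z"
proof -
  have W: "open W" "\<tau> holomorphic_on W" using br by (auto simp: branched_over_0_def)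
  define F where "F u = g (SOME z. z \<in> W \<and> \<tau> z = u)" for u
  have F: "F (\<tau> z) = g z" if "z \<in> W" for z
    unfolding F_def by (rule fib) (use someI[of "\<lambda>w. w \<in> W \<and> \<tau> w = \<tau> z" z] that in auto)
  have op: "open (\<tau> ` W)" by (rule open_image_branched[OF br W(1) order_refl])
  have cont: "continuous_on (\<tau> ` W) F"
    unfolding continuous_on_open_vimage[OF op]
  proof (intro allI impI)
    fix B :: "complex set" assume "open B"
    then have "open (g -` B \<inter> W)"
      using g W(1) continuous_on_open_vimage holomorphic_on_imp_continuous_on by blast
    moreover have "F -` B \<inter> \<tau> ` W = \<tau> ` (g -` B \<inter> W)" using F by (auto simp: image_iff)
    ultimately show "open (F -` B \<inter> \<tau> ` W)" using open_image_branched[OF br] by simp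
  qed
  have "F field_differentiable at u" if "u \<in> \<tau> ` W - {0}" for u
  proof -
    from that obtain z where z: "z \<in> W" "u = \<tau> z" "\<tau> z \<noteq> 0" by auto
    then have "deriv \<tau> z \<noteq> 0" using br by (auto simp: branched_over_0_def)
    then obtain r where r: "r > 0" "ball z r \<subseteq> W" "inj_on \<tau> (ball z r)"
      using has_complex_derivative_locally_injective[OF W(2) z(1) W(1)] by blast
    have "\<tau> holomorphic_on ball z r" using W r holomorphic_on_subset by blast
    then obtain k where k: "k holomorphic_on \<tau> ` ball z r" "\<And>w. w \<in> ball z r \<Longrightarrow> k (\<tau> w) = w"
      using holomorphic_has_inverse[OF _ open_ball r(3)] by metis
    have "g holomorphic_on ball z r" using g r holomorphic_on_subset by blast
    then have "(g \<circ> k) holomorphic_on \<tau> ` ball z r"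
      by (intro holomorphic_on_compose_gen[OF k(1)]) (use k(2) in auto)
    then have "F holomorphic_on \<tau> ` ball z r"
      by (rule holomorphic_transform) (use r F k(2) in auto)
    moreover have "open (\<tau> ` ball z r)" using r by (intro open_image_branched[OF br]) auto
    moreover have "u \<in> \<tau> ` ball z r" using z r by auto
    ultimately show ?thesis using holomorphic_on_imp_differentiable_at by blast
  qed
  then have "F holomorphic_on \<tau> ` W - {0}"
    by (auto simp: holomorphic_on_def intro: field_differentiable_at_within)
  then have "F holomorphic_on \<tau> ` W"
    by (rule no_isolated_singularity[OF cont _ op]) simp
  with F that show ?thesis by blast
qed

text \<open>Here \<open>\<tau> / \<tau>' = w / (e w')\<close>. At the zero \<open>\<xi>\<close> of \<open>w\<close> this holds as well: for \<open>e > 1\<close> the left hand side is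
the quotient 0/0, which by convention is the correct value 0.\<close>

lemma branched_disc_coord_power:
  assumes "\<xi> \<in> uhp" "e > 0"
  shows "branched_over_0 uhp (\<lambda>z. disc_coord \<xi> z ^ e)"
    "\<And>z. z \<in> uhp \<Longrightarrow> deriv (\<lambda>z. disc_coord \<xi> z ^ e) z = of_nat e * disc_coord \<xi> z ^ (e - 1) * ((\<xi> - cnj \<xi>) / (z - cnj \<xi>)\<^sup>2)"
    "(\<lambda>z. disc_coord \<xi> z ^ e / deriv (\<lambda>z. disc_coord \<xi> z ^ e) z) holomorphic_on uhp"
proof -
  have ne: "\<xi> - cnj \<xi> \<noteq> 0" using assms by (auto simp: uhp_def complex_eq_iff)
  show d: "deriv (\<lambda>z. disc_coord \<xi> z ^ e) z = of_nat e * disc_coord \<xi> z ^ (e - 1) * ((\<xi> - cnj \<xi>) / (z - cnj \<xi>)\<^sup>2)"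
    if "z \<in> uhp" for z
    by (rule DERIV_imp_deriv)
       (auto intro!: derivative_eq_intros has_field_derivative_disc_coord[OF that assms(1)])
  have ev: "\<forall>\<^sub>F w in at z. disc_coord \<xi> w ^ e \<noteq> 0" if "z \<in> uhp" for z
  proof -
    have "\<forall>\<^sub>F w in at z. w \<in> uhp" using that by (intro eventually_at_in_open') auto
    moreover have "\<forall>\<^sub>F w in at z. w \<noteq> \<xi>" by (rule eventually_neq_at_within)
    ultimately show ?thesis by eventually_elim (simp add: disc_coord_eq_0_iff assms)
  qed
  show "branched_over_0 uhp (\<lambda>z. disc_coord \<xi> z ^ e)"
    unfolding branched_over_0_def
  proof (intro conjI ballI impI ev open_uhp)
    show "(\<lambda>z. disc_coord \<xi> z ^ e) holomorphic_on uhp"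
      by (intro holomorphic_intros holomorphic_disc_coord assms)
    fix z assume "z \<in> uhp" "disc_coord \<xi> z ^ e \<noteq> 0"
    then show "deriv (\<lambda>z. disc_coord \<xi> z ^ e) z \<noteq> 0"
      using ne assms uhp_minus_cnj_nonzero[of z \<xi>] by (auto simp: d)
  qed
  have "(\<lambda>z. disc_coord \<xi> z / (of_nat e * ((\<xi> - cnj \<xi>) / (z - cnj \<xi>)\<^sup>2))) holomorphic_on uhp"
    using ne assms uhp_minus_cnj_nonzero[of _ \<xi>] by (intro holomorphic_intros holomorphic_disc_coord) auto
  then show "(\<lambda>z. disc_coord \<xi> z ^ e / deriv (\<lambda>z. disc_coord \<xi> z ^ e) z) holomorphic_on uhp"
  proof (rule holomorphic_transform)
    fix z assume z: "z \<in> uhp"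
    have "disc_coord \<xi> z ^ e = disc_coord \<xi> z * disc_coord \<xi> z ^ (e - 1)"
      using assms by (simp add: power_eq_if)
    then show "disc_coord \<xi> z / (of_nat e * ((\<xi> - cnj \<xi>) / (z - cnj \<xi>)\<^sup>2)) = disc_coord \<xi> z ^ e / deriv (\<lambda>z. disc_coord \<xi> z ^ e) z"
      using z by (cases "disc_coord \<xi> z = 0") (auto simp: d)
  qed
qed

lemma branched_cusp_coord:
  assumes "det \<sigma> = 1" "h > 0"
  shows "branched_over_0 uhp (cusp_coord \<sigma> h)"
    "\<And>z. z \<in> uhp \<Longrightarrow> cusp_coord \<sigma> h z / deriv (cusp_coord \<sigma> h) z = of_real h / (2 * of_real pi * \<i>) * (autf \<sigma> z)\<^sup>2"
    "(\<lambda>z. cusp_coord \<sigma> h z / deriv (cusp_coord \<sigma> h) z) holomorphic_on uhp"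
proof -
  have d: "deriv (cusp_coord \<sigma> h) z = cusp_coord \<sigma> h z * (2 * of_real pi * \<i> / of_real h) / (autf \<sigma> z)\<^sup>2" if "z \<in> uhp" for z
    using has_field_derivative_cusp_coord[OF assms(1) that] by (rule DERIV_imp_deriv)
  show q: "cusp_coord \<sigma> h z / deriv (cusp_coord \<sigma> h) z = of_real h / (2 * of_real pi * \<i>) * (autf \<sigma> z)\<^sup>2" if "z \<in> uhp" for z
    using assms that autf_nonzero[OF assms(1) that] by (simp add: d field_simps)
  show "branched_over_0 uhp (cusp_coord \<sigma> h)"
    unfolding branched_over_0_def using holomorphic_cusp_coord[OF assms(1)] assms autf_nonzero[OF assms(1)]
    by (auto simp: d)
  have "(\<lambda>z. of_real h / (2 * of_real pi * \<i>) * (autf \<sigma> z)\<^sup>2) holomorphic_on uhp"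
    by (auto simp: autf_def intro!: holomorphic_intros)
  then show "(\<lambda>z. cusp_coord \<sigma> h z / deriv (cusp_coord \<sigma> h) z) holomorphic_on uhp"
    by (rule holomorphic_transform) (simp add: q)
qed

context discrete_SL2_subgroup
begin

section \<open>Charts and transition maps\<close>

definition preim :: "csphere set set \<Rightarrow> complex set" where
  "preim U = {z \<in> uhp. quot_map \<Gamma> z \<in> U}"

definition lift :: "(csphere set \<Rightarrow> complex) \<Rightarrow> complex \<Rightarrow> complex" where
  "lift t z = t (quot_map \<Gamma> z)"

lemma lift_comp: "t \<circ> quot_map \<Gamma> = lift t"
  by (simp add: fun_eq_iff lift_def)

lemma preim_mob: "z \<in> preim U \<Longrightarrow> g \<in> \<Gamma> \<Longrightarrow> mob g z \<in> preim U"
  by (simp add: preim_def)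

lemma lift_mob: "z \<in> uhp \<Longrightarrow> g \<in> \<Gamma> \<Longrightarrow> lift t (mob g z) = lift t z"
  by (simp add: lift_def)

lemma quot_map_eqE:
  assumes "z \<in> uhp" "quot_map \<Gamma> z = quot_map \<Gamma> z'"
  obtains g where "g \<in> \<Gamma>" "z' = mob g z"
  using assms quot_map_eq_iff by blast

text \<open>All that is needed of a chart. The requirement on \<open>\<tau> / \<tau>'\<close> makes sense at the centre, too, since a zero of \<open>\<tau>\<close> is always
a simple zero of this quotient, in agreement with the convention \<open>x / 0 = 0\<close>. The
centre itself need not be in the image of the half plane: it is missing when it is a cusp.\<close>

definition coordinate_chart :: "csphere set set \<Rightarrow> (csphere set \<Rightarrow> complex) \<Rightarrow> bool" where
  "coordinate_chart U t \<longleftrightarrow> branched_over_0 (preim U) (lift t) \<and> inj_on t U \<and>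
     (\<lambda>z. lift t z / deriv (lift t) z) holomorphic_on preim U \<and>
     (\<exists>R>0. t ` U = ball 0 R \<and> ball 0 R - {0} \<subseteq> lift t ` preim U)"

text \<open>A chart prescribes its coordinate on the disc or horodisc \<open>D\<close> only. On the translates of \<open>D\<close> it is known
through the invariance of the quotient map, and the local properties are carried along by \<open>g\<close>.\<close>

lemma lift_from_disc:
  assumes D: "open D" "D \<subseteq> uhp" and U: "preim U = {z \<in> uhp. quot_map \<Gamma> z \<in> quot_map \<Gamma> ` D}"
    and t: "\<And>z. z \<in> D \<Longrightarrow> t (quot_map \<Gamma> z) = \<tau> z" and br: "branched_over_0 D \<tau>"
    and q: "(\<lambda>z. \<tau> z / deriv \<tau> z) holomorphic_on D"
  shows "branched_over_0 (preim U) (lift t)" "(\<lambda>z. lift t z / deriv (lift t) z) holomorphic_on preim U"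
proof -
  have tau: "\<tau> holomorphic_on D" using br by (auto simp: branched_over_0_def)
  have ex: "\<exists>g N. g \<in> \<Gamma> \<and> open N \<and> z \<in> N \<and> N \<subseteq> preim U \<and> mob g ` N \<subseteq> D" if "z \<in> preim U" for z
  proof -
    from that have z: "z \<in> uhp" and "quot_map \<Gamma> z \<in> quot_map \<Gamma> ` D" by (auto simp: U)
    then obtain w where "w \<in> D" "quot_map \<Gamma> z = quot_map \<Gamma> w" by auto
    then obtain g where g: "g \<in> \<Gamma>" "mob g z \<in> D" using quot_map_eqE[OF z] by metis
    define N where "N = mob g -` D \<inter> uhp"
    have "open N"
      unfolding N_def using holomorphic_mob[of g] g D(1)
      by (metis continuous_on_open_vimage det_1 holomorphic_on_imp_continuous_on open_uhp)
    moreover have "N \<subseteq> preim U"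
    proof
      fix w assume w: "w \<in> N"
      then have "quot_map \<Gamma> w = quot_map \<Gamma> (mob g w)" using g by (simp add: N_def)
      then show "w \<in> preim U" using w by (auto simp: U N_def)
    qed
    ultimately show ?thesis using g z by (intro exI[of _ g] exI[of _ N]) (auto simp: N_def)
  qed
  have loc: "lift t w = \<tau> (mob g w)" "(lift t has_field_derivative deriv \<tau> (mob g w) / (autf g w)\<^sup>2) (at w)"
    if "g \<in> \<Gamma>" "open N" "N \<subseteq> preim U" "mob g ` N \<subseteq> D" "w \<in> N" for g N w
  proof -
    have eq: "lift t w = \<tau> (mob g w)" if "w \<in> N" for w
      using t[of "mob g w"] that \<open>mob g ` N \<subseteq> D\<close> \<open>N \<subseteq> preim U\<close> \<open>g \<in> \<Gamma>\<close> by (force simp: lift_def preim_def)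
    show "lift t w = \<tau> (mob g w)" by (rule eq[OF that(5)])
    have w: "w \<in> uhp" "mob g w \<in> D" using that by (auto simp: preim_def)
    have "((\<lambda>w. \<tau> (mob g w)) has_field_derivative deriv \<tau> (mob g w) * (1 / (autf g w)\<^sup>2)) (at w)"
      using tau D(1) w that(1) has_field_derivative_mob[of g w]
      by (intro DERIV_chain2[of \<tau>] holomorphic_derivI[of \<tau> D]) auto
    then have "((\<lambda>w. \<tau> (mob g w)) has_field_derivative deriv \<tau> (mob g w) / (autf g w)\<^sup>2) (at w)"
      by simp
    then show "(lift t has_field_derivative deriv \<tau> (mob g w) / (autf g w)\<^sup>2) (at w)"
      by (rule has_field_derivative_transform_within_open[OF _ that(2,5)]) (simp add: eq)
  qed
  have open_preim: "open (preim U)"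
    using ex by (subst open_subopen) blast
  have lift_hol: "lift t holomorphic_on preim U"
    unfolding holomorphic_on_open[OF open_preim] using ex loc(2) by metis
  have nz: "deriv (lift t) z \<noteq> 0" if z: "z \<in> preim U" "lift t z \<noteq> 0" for z
  proof -
    obtain g N where g: "g \<in> \<Gamma>" "open N" "z \<in> N" "N \<subseteq> preim U" "mob g ` N \<subseteq> D" using ex[OF z(1)] by metis
    note l = loc[OF g(1,2,4,5,3)]
    have "deriv \<tau> (mob g z) \<noteq> 0" using br g z(2) l(1) by (auto simp: branched_over_0_def)
    moreover have "autf g z \<noteq> 0" using g by (intro autf_nonzero) (auto simp: preim_def)
    ultimately show ?thesis using DERIV_imp_deriv[OF l(2)] by simp
  qed
  have ev: "\<forall>\<^sub>F w in at z. lift t w \<noteq> 0" if z: "z \<in> preim U" for z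
  proof -
    obtain g N where g: "g \<in> \<Gamma>" "open N" "z \<in> N" "N \<subseteq> preim U" "mob g ` N \<subseteq> D" using ex[OF z(1)] by metis
    have zu: "z \<in> uhp" using z by (simp add: preim_def)
    have "\<forall>\<^sub>F v in at (mob g z). \<tau> v \<noteq> 0" using br g by (auto simp: branched_over_0_def)
    moreover have "filterlim (mob g) (at (mob g z)) (at z)"
    proof -
      have "mob g \<midarrow>z\<rightarrow> mob g z"
        using has_field_derivative_mob[of g z] g zu DERIV_isCont by (auto simp: isCont_def)
      moreover have "\<forall>\<^sub>F w in at z. mob g w \<noteq> mob g z"
      proof -
        have "\<forall>\<^sub>F w in at z. w \<in> uhp \<and> w \<noteq> z"
          using zu by (auto simp: eventually_at_filter eventually_nhds_in_open elim: eventually_mono[OF eventually_nhds_in_open[OF open_uhp]])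
        then show ?thesis
          by eventually_elim (metis det_1 g(1) mob_inv(1) zu)
      qed
      ultimately show ?thesis by (simp add: filterlim_at)
    qed
    ultimately have "\<forall>\<^sub>F w in at z. \<tau> (mob g w) \<noteq> 0" by (rule eventually_compose_filterlim)
    moreover have "\<forall>\<^sub>F w in at z. w \<in> N" using g by (intro eventually_at_in_open') auto
    ultimately show ?thesis
      by eventually_elim (use loc(1)[OF g(1,2,4,5)] in auto)
  qed
  show "branched_over_0 (preim U) (lift t)"
    unfolding branched_over_0_def using open_preim lift_hol nz ev by blast
  have "(\<lambda>z. lift t z / deriv (lift t) z) field_differentiable at z" if z: "z \<in> preim U" for z
  proof -
    obtain g N where g: "g \<in> \<Gamma>" "open N" "z \<in> N" "N \<subseteq> preim U" "mob g ` N \<subseteq> D" using ex[OF z(1)] by metis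
    have "mob g holomorphic_on N"
      using g by (intro holomorphic_on_subset[OF holomorphic_mob]) (auto simp: preim_def)
    then have "((\<lambda>z. \<tau> z / deriv \<tau> z) \<circ> mob g) holomorphic_on N"
      by (rule holomorphic_on_compose_gen[OF _ q g(5)])
    moreover have "(\<lambda>z. (autf g z)\<^sup>2) holomorphic_on N"
      unfolding autf_def by (intro holomorphic_intros)
    ultimately have "(\<lambda>z. ((\<lambda>z. \<tau> z / deriv \<tau> z) \<circ> mob g) z * (autf g z)\<^sup>2) holomorphic_on N"
      by (rule holomorphic_on_mult)
    then have "(\<lambda>z. lift t z / deriv (lift t) z) holomorphic_on N"
      by (rule holomorphic_transform)
         (simp add: loc(1)[OF g(1,2,4,5)] DERIV_imp_deriv[OF loc(2)[OF g(1,2,4,5)]])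
    then show ?thesis using g holomorphic_on_imp_differentiable_at by blast
  qed
  then show "(\<lambda>z. lift t z / deriv (lift t) z) holomorphic_on preim U"
    by (auto simp: holomorphic_on_def intro: field_differentiable_at_within)
qed

lemma deriv_lift_mob:
  assumes "branched_over_0 (preim U) (lift t)" "z \<in> preim U" "g \<in> \<Gamma>"
  shows "deriv (lift t) (mob g z) = deriv (lift t) z * (autf g z)\<^sup>2"
proof -
  have op: "open (preim U)" and hol: "lift t holomorphic_on preim U"
    using assms(1) by (auto simp: branched_over_0_def)
  have z: "z \<in> uhp" using assms by (simp add: preim_def)
  have "((\<lambda>w. lift t (mob g w)) has_field_derivative deriv (lift t) (mob g z) * (1 / (autf g z)\<^sup>2)) (at z)"
    using has_field_derivative_mob[of g z] assms z preim_mob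
    by (intro DERIV_chain2[of "lift t"] holomorphic_derivI[OF hol op]) auto
  then have "(lift t has_field_derivative deriv (lift t) (mob g z) * (1 / (autf g z)\<^sup>2)) (at z)"
    by (rule has_field_derivative_transform_within_open[OF _ op assms(2)])
       (use assms in \<open>auto simp: lift_mob preim_def\<close>)
  then have "deriv (lift t) z = deriv (lift t) (mob g z) / (autf g z)\<^sup>2"
    by (simp add: DERIV_imp_deriv)
  then show ?thesis using autf_nonzero[of g z] assms z by simp
qed

lemma cusp_orbit_not_interior:
  assumes "x \<in> cusps \<Gamma>" "z \<in> uhp"
  shows "orb \<Gamma> x \<noteq> quot_map \<Gamma> z"
proof
  assume "orb \<Gamma> x = quot_map \<Gamma> z"
  then have "orb \<Gamma> (Fin z) = orb \<Gamma> x" by (simp add: quot_map_def)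
  then obtain g where "g \<in> \<Gamma>" "x = act g (Fin z)" by (auto simp: orb_eq_iff)
  then have "x = Fin (mob g z)" "mob g z \<in> uhp" using assms by (auto simp: autf_nonzero)
  then show False using cusp_not_uhp[OF assms(1)] by blast
qed

lemma interior_chartE:
  assumes "(U, t) \<in> interior_charts \<Gamma>"
  obtains \<xi> r where "\<xi> \<in> uhp" "r > 0"
    "\<And>g. g \<in> \<Gamma> \<Longrightarrow> mob g ` {z \<in> uhp. norm (disc_coord \<xi> z) < r} \<inter> {z \<in> uhp. norm (disc_coord \<xi> z) < r} \<noteq> {} \<Longrightarrow> g \<in> stab \<Gamma> (Fin \<xi>)"
    "U = quot_map \<Gamma> ` {z \<in> uhp. norm (disc_coord \<xi> z) < r}"
    "\<And>z. z \<in> uhp \<Longrightarrow> norm (disc_coord \<xi> z) < r \<Longrightarrow> t (quot_map \<Gamma> z) = disc_coord \<xi> z ^ elliptic_index \<Gamma> \<xi>"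
  using assms unfolding interior_charts_def disc_coord_def by (auto simp: Let_def)

lemma cusp_chartE:
  assumes "(U, t) \<in> cusp_charts \<Gamma>"
  obtains x \<sigma> h L where "x \<in> cusps \<Gamma>" "cusp_frame \<Gamma> x \<sigma> h" "L > 0"
    "U = insert (orb \<Gamma> x) (quot_map \<Gamma> ` {z \<in> uhp. Im (mob \<sigma> z) > L})"
    "t (orb \<Gamma> x) = 0" "\<And>z. z \<in> uhp \<Longrightarrow> Im (mob \<sigma> z) > L \<Longrightarrow> t (quot_map \<Gamma> z) = cusp_coord \<sigma> h z"
  using assms unfolding cusp_charts_def cusp_coord_def by (auto simp: Let_def)

text \<open>Injectivity of the chart around \<open>\<xi>\<close>: the quotient of two coordinates with equal \<open>e\<close>-th powers is a root of
unity, hence the multiplier of an element of the stabiliser.\<close>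

lemma disc_coord_power_eqD:
  assumes "\<xi> \<in> uhp" "z \<in> uhp" "z' \<in> uhp"
    "disc_coord \<xi> z ^ elliptic_index \<Gamma> \<xi> = disc_coord \<xi> z' ^ elliptic_index \<Gamma> \<xi>"
  shows "\<exists>g\<in>stab \<Gamma> (Fin \<xi>). z' = mob g z"
proof (cases "z = \<xi>")
  case True
  then have "disc_coord \<xi> z' ^ elliptic_index \<Gamma> \<xi> = 0"
    using assms(4) rotations_eq(2)[OF assms(1)] by (simp add: zero_power)
  then have "z' = \<xi>" using assms by (simp add: disc_coord_eq_0_iff)
  then show ?thesis using True assms by (intro bexI[of _ "mat 1"]) (auto simp: stab_Fin_iff)
next
  case False
  then have nz: "disc_coord \<xi> z \<noteq> 0" using assms by (simp add: disc_coord_eq_0_iff)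
  then have "(disc_coord \<xi> z' / disc_coord \<xi> z) ^ elliptic_index \<Gamma> \<xi> = 1"
    using assms(4) rotations_eq(2)[OF assms(1)] by (auto simp: power_divide zero_power)
  then have "disc_coord \<xi> z' / disc_coord \<xi> z \<in> rotations \<xi>"
    using rotations_eq(1)[OF assms(1)] by simp
  then obtain g where g: "g \<in> stab \<Gamma> (Fin \<xi>)" "disc_coord \<xi> z' / disc_coord \<xi> z = 1 / (autf g \<xi>)\<^sup>2"
    by (auto simp: rotations_def)
  then have g': "g \<in> \<Gamma>" "mob g \<xi> = \<xi>" using assms by (auto simp: stab_Fin_iff)
  have "disc_coord \<xi> z' = disc_coord \<xi> z / (autf g \<xi>)\<^sup>2"
    using g(2) nz by (simp add: field_simps)
  also have "\<dots> = disc_coord \<xi> (mob g z)"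
    using disc_coord_mob(1)[of g z \<xi>] assms g' by simp
  finally have "z' = mob g z" using assms g' by (intro disc_coord_inj[of z' _ \<xi>]) auto
  then show ?thesis using g by blast
qed

lemma coordinate_chart_interior:
  assumes "(U, t) \<in> interior_charts \<Gamma>"
  shows "coordinate_chart U t" "U \<subseteq> quot_map \<Gamma> ` uhp"
proof -
  obtain \<xi> r where c: "\<xi> \<in> uhp" "r > 0"
    "U = quot_map \<Gamma> ` {z \<in> uhp. norm (disc_coord \<xi> z) < r}"
    "\<And>z. z \<in> uhp \<Longrightarrow> norm (disc_coord \<xi> z) < r \<Longrightarrow> t (quot_map \<Gamma> z) = disc_coord \<xi> z ^ elliptic_index \<Gamma> \<xi>"
    by (rule interior_chartE[OF assms]) blast
  define e where "e = elliptic_index \<Gamma> \<xi>"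
  have e: "e > 0" using rotations_eq(2)[OF c(1)] by (simp add: e_def)
  define D where "D = {z \<in> uhp. norm (disc_coord \<xi> z) < r}"
  have D: "open D" "D \<subseteq> uhp" using open_disc[OF c(1)] by (auto simp: D_def)
  have U: "preim U = {z \<in> uhp. quot_map \<Gamma> z \<in> quot_map \<Gamma> ` D}" by (auto simp: preim_def c(3) D_def)
  have t: "t (quot_map \<Gamma> z) = disc_coord \<xi> z ^ e" if "z \<in> D" for z using c(4) that by (simp add: D_def e_def)
  show "U \<subseteq> quot_map \<Gamma> ` uhp" using c(3) by auto
  note b = branched_disc_coord_power[OF c(1) e]
  have inj: "inj_on t U"
  proof (rule inj_onI)
    fix p p' assume "p \<in> U" "p' \<in> U" "t p = t p'"
    then obtain z z' where z: "z \<in> D" "z' \<in> D" "p = quot_map \<Gamma> z" "p' = quot_map \<Gamma> z'"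
      unfolding c(3) D_def[symmetric] by blast
    then have "disc_coord \<xi> z ^ e = disc_coord \<xi> z' ^ e" using \<open>t p = t p'\<close> t by simp
    then obtain g where "g \<in> stab \<Gamma> (Fin \<xi>)" "z' = mob g z"
      using disc_coord_power_eqD[OF c(1), of z z'] z D by (auto simp: e_def)
    then show "p = p'" using z D by (auto simp: stab_def)
  qed
  define R where "R = min r 1 ^ e"
  have R: "R > 0" using c(2) by (simp add: R_def)
  have tU: "t ` U = ball 0 R"
  proof (intro equalityI subsetI)
    fix u assume "u \<in> t ` U"
    then obtain z where z: "z \<in> D" "u = disc_coord \<xi> z ^ e" using c(3) t by (auto simp: D_def)
    then have "norm (disc_coord \<xi> z) < min r 1" using norm_disc_coord_less_1[OF _ c(1)] by (auto simp: D_def)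
    then have "norm (disc_coord \<xi> z) ^ e < R" unfolding R_def using e by (intro power_strict_mono) auto
    then show "u \<in> ball 0 R" by (simp add: z norm_power)
  next
    fix u :: complex assume "u \<in> ball 0 R"
    obtain v where v: "v ^ e = u"
    proof (cases "u = 0")
      case True
      then show ?thesis using that[of 0] e by simp
    next
      case False
      then have "exp (Ln u / of_nat e) ^ e = u" using e by (simp flip: exp_of_nat_mult)
      then show ?thesis using that by blast
    qed
    have "norm v ^ e < min r 1 ^ e" using \<open>u \<in> ball 0 R\<close> by (simp add: R_def flip: v norm_power)
    then have "norm v < min r 1" by (rule power_less_imp_less_base) (use c(2) in auto)
    then obtain z where "z \<in> uhp" "disc_coord \<xi> z = v" using disc_coord_surj[OF _ c(1), of v] by auto
    then have "z \<in> D" "t (quot_map \<Gamma> z) = u" using \<open>norm v < min r 1\<close> v t by (auto simp: D_def)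
    then show "u \<in> t ` U" using c(3) by (auto simp: D_def)
  qed
  have "t ` U \<subseteq> lift t ` preim U"
    using c(3) by (force simp: lift_def preim_def)
  moreover have "branched_over_0 D (\<lambda>z. disc_coord \<xi> z ^ e)"
    by (rule branched_over_0_subset[OF b(1) D])
  moreover have "(\<lambda>z. disc_coord \<xi> z ^ e / deriv (\<lambda>z. disc_coord \<xi> z ^ e) z) holomorphic_on D"
    by (rule holomorphic_on_subset[OF b(3) D(2)])
  ultimately show "coordinate_chart U t"
    unfolding coordinate_chart_def using inj tU R lift_from_disc[where \<tau> = "\<lambda>z. disc_coord \<xi> z ^ e", OF D U t] by auto
qed

text \<open>Two points with the same coordinate differ by a multiple of the width, which is a translation in the
stabiliser of the cusp.\<close>

lemma coordinate_chart_cusp: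
  assumes "(U, t) \<in> cusp_charts \<Gamma>"
  shows "coordinate_chart U t"
proof -
  obtain x \<sigma> h L where c: "x \<in> cusps \<Gamma>" "cusp_frame \<Gamma> x \<sigma> h" "L > 0"
    "U = insert (orb \<Gamma> x) (quot_map \<Gamma> ` {z \<in> uhp. Im (mob \<sigma> z) > L})"
    "t (orb \<Gamma> x) = 0" "\<And>z. z \<in> uhp \<Longrightarrow> Im (mob \<sigma> z) > L \<Longrightarrow> t (quot_map \<Gamma> z) = cusp_coord \<sigma> h z"
    by (rule cusp_chartE[OF assms]) blast
  note d = cusp_frameD[OF c(2)]
  define D where "D = {z \<in> uhp. Im (mob \<sigma> z) > L}"
  have D: "open D" "D \<subseteq> uhp"
    using open_horodisc[OF d(1)] by (auto simp: D_def)
  have U: "preim U = {z \<in> uhp. quot_map \<Gamma> z \<in> quot_map \<Gamma> ` D}"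
    using cusp_orbit_not_interior[OF c(1)] by (auto simp: preim_def c(4) D_def)
  have t: "t (quot_map \<Gamma> z) = cusp_coord \<sigma> h z" if "z \<in> D" for z using c(6) that by (simp add: D_def)
  note b = branched_cusp_coord[OF d(1,3)]
  have inj: "inj_on t U"
    unfolding c(4) D_def[symmetric]
  proof (subst inj_on_insert, intro conjI)
    show "inj_on t (quot_map \<Gamma> ` D)"
    proof (rule inj_onI)
      fix p p' assume "p \<in> quot_map \<Gamma> ` D" "p' \<in> quot_map \<Gamma> ` D" "t p = t p'"
      then obtain z z' where z: "z \<in> D" "z' \<in> D" "p = quot_map \<Gamma> z" "p' = quot_map \<Gamma> z'" by blast
      then have "cusp_coord \<sigma> h z = cusp_coord \<sigma> h z'" using \<open>t p = t p'\<close> t by simp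
      then obtain l where l: "mob \<sigma> z' = mob \<sigma> z + of_int l * of_real h" using cusp_coord_eqD[OF d(3)] by blast
      obtain g s where g: "g \<in> \<Gamma>" "\<And>z. z \<in> uhp \<Longrightarrow> mob \<sigma> (mob g z) = mob \<sigma> z + of_int l * of_real h"
        using translation_on_uhp[OF c(2), of l] by metis
      have u: "z \<in> uhp" "z' \<in> uhp" using z D by auto
      then have "mob \<sigma> (mob g z) = mob \<sigma> z'" using l g by simp
      then have "mob g z = z'" using u g d by (metis det_1 mob_inv(1) mob_uhp)
      then show "p = p'" using z u g by auto
    qed
    show "t (orb \<Gamma> x) \<notin> t ` (quot_map \<Gamma> ` D - {orb \<Gamma> x})" using c(5) t by force
  qed
  define R where "R = exp (- (2 * pi * L / h))"
  have R: "R > 0" "R < 1" using c(3) d(3) by (auto simp: R_def)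
  have im: "cusp_coord \<sigma> h ` D = ball 0 R - {0}"
  proof (intro equalityI subsetI)
    fix u assume "u \<in> cusp_coord \<sigma> h ` D"
    then show "u \<in> ball 0 R - {0}" using norm_cusp_coord_less[OF d(3), of \<sigma> _ L] by (auto simp: D_def R_def)
  next
    fix u :: complex assume u: "u \<in> ball 0 R - {0}"
    then have "u \<noteq> 0" "norm u < 1" using R by auto
    then obtain z where "z \<in> uhp" "cusp_coord \<sigma> h z = u" using cusp_coord_surj[OF d(1,3)] by blast
    then show "u \<in> cusp_coord \<sigma> h ` D" using u norm_cusp_coord_less[OF d(3), of \<sigma> z L] by (auto simp: D_def R_def)
  qed
  have "t ` quot_map \<Gamma> ` D = cusp_coord \<sigma> h ` D" using t by (simp add: image_image)
  then have tU: "t ` U = ball 0 R" unfolding c(4) D_def[symmetric] using c(5) im R by auto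
  have "cusp_coord \<sigma> h ` D \<subseteq> lift t ` preim U"
    using t D(2) unfolding lift_def U by force
  moreover have "branched_over_0 D (cusp_coord \<sigma> h)"
    by (rule branched_over_0_subset[OF b(1) D])
  moreover have "(\<lambda>z. cusp_coord \<sigma> h z / deriv (cusp_coord \<sigma> h) z) holomorphic_on D"
    by (rule holomorphic_on_subset[OF b(3) D(2)])
  ultimately show "coordinate_chart U t"
    unfolding coordinate_chart_def using inj tU R im lift_from_disc[where \<tau> = "cusp_coord \<sigma> h", OF D U t] by auto
qed

lemma coordinate_chart_atlas: "(U, t) \<in> surface_atlas \<Gamma> \<Longrightarrow> coordinate_chart U t"
  by (auto simp: surface_atlas_def coordinate_chart_interior coordinate_chart_cusp)

text \<open>The coordinate is well defined on orbits because points of the small disc are equivalent only under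
the stabiliser, whose multipliers are \<open>e\<close>-th roots of unity.\<close>

lemma interior_chart_exists:
  assumes \<xi>: "\<xi> \<in> uhp"
  obtains U t r where "(U, t) \<in> interior_charts \<Gamma>" "r > 0" "\<xi> \<in> preim U"
    "\<And>z. z \<in> uhp \<Longrightarrow> norm (disc_coord \<xi> z) < r \<Longrightarrow> z \<in> preim U \<and> lift t z = disc_coord \<xi> z ^ elliptic_index \<Gamma> \<xi>"
proof -
  define e where "e = elliptic_index \<Gamma> \<xi>"
  obtain r where r: "r > 0" and st: "\<forall>g\<in>\<Gamma>. mob g ` {z \<in> uhp. norm (disc_coord \<xi> z) < r} \<inter> {z \<in> uhp. norm (disc_coord \<xi> z) < r} \<noteq> {} \<longrightarrow> g \<in> stab \<Gamma> (Fin \<xi>)"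
    using exists_small_disc[OF \<xi>] by blast
  define D where "D = {z \<in> uhp. norm (disc_coord \<xi> z) < r}"
  define U where "U = quot_map \<Gamma> ` D"
  define t where "t = (\<lambda>p. if p \<in> U then disc_coord \<xi> (SOME z. z \<in> D \<and> quot_map \<Gamma> z = p) ^ e else undefined)"
  have t: "t (quot_map \<Gamma> z) = disc_coord \<xi> z ^ e" if "z \<in> D" for z
  proof -
    define z' where "z' = (SOME w. w \<in> D \<and> quot_map \<Gamma> w = quot_map \<Gamma> z)"
    have z': "z' \<in> D" "quot_map \<Gamma> z = quot_map \<Gamma> z'"
      using someI[of "\<lambda>w. w \<in> D \<and> quot_map \<Gamma> w = quot_map \<Gamma> z" z] that by (auto simp: z'_def)
    have zu: "z \<in> uhp" using that by (simp add: D_def)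
    obtain g where g: "g \<in> \<Gamma>" "z' = mob g z" by (rule quot_map_eqE[OF zu z'(2)])
    then have gs: "g \<in> stab \<Gamma> (Fin \<xi>)" using st that z'(1) unfolding D_def[symmetric] by blast
    then have "1 / (autf g \<xi>)\<^sup>2 \<in> rotations \<xi>" by (auto simp: rotations_def)
    then have "(1 / (autf g \<xi>)\<^sup>2) ^ e = 1" using rotations_eq(1)[OF \<xi>] by (simp add: e_def)
    moreover have "disc_coord \<xi> z' = disc_coord \<xi> z * (1 / (autf g \<xi>)\<^sup>2)"
      using disc_coord_mob(1)[of g z \<xi>] g gs \<xi> zu by (simp add: stab_Fin_iff)
    ultimately have "disc_coord \<xi> z' ^ e = disc_coord \<xi> z ^ e" by (simp only: power_mult_distrib mult_1_right)
    then show ?thesis using that by (simp add: t_def U_def z'_def)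
  qed
  have "(U, t) \<in> interior_charts \<Gamma>"
    unfolding interior_charts_def Let_def mem_Collect_eq prod.case
    by (rule bexI[OF _ \<xi>], rule exI[of _ r])
       (use r st t in \<open>auto simp: U_def D_def e_def t_def disc_coord_def extensional_def\<close>)
  then show ?thesis
    by (rule that[OF _ r]) (use t \<xi> r in \<open>auto simp: preim_def U_def D_def lift_def e_def\<close>)
qed

lemma stab_cusp_coord:
  assumes "cusp_frame \<Gamma> x \<sigma> h" "g \<in> stab \<Gamma> x" "z \<in> uhp"
  shows "cusp_coord \<sigma> h (mob g z) = cusp_coord \<sigma> h z"
proof -
  note d = cusp_frameD[OF assms(1)]
  have g: "g \<in> \<Gamma>" using assms(2) by (simp add: stab_def)
  have "1 *\<^sub>R (\<sigma> ** g ** matrix_inv \<sigma>) \<in> {s *\<^sub>R (\<sigma> ** g ** matrix_inv \<sigma>) | s g. s \<in> {1, -1} \<and> g \<in> stab \<Gamma> x}"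
    using assms(2) by blast
  also have "\<dots> = {s *\<^sub>R translation (of_int l * h) | s (l::int). s \<in> {1, -1}}"
    using assms(1) unfolding cusp_frame_def by blast
  finally obtain s l where sl: "s \<in> {1, -1}" "\<sigma> ** g ** matrix_inv \<sigma> = s *\<^sub>R translation (of_int l * h)"
    unfolding scaleR_one by blast
  have "mob \<sigma> (mob g z) = mob (\<sigma> ** g ** matrix_inv \<sigma>) (mob \<sigma> z)"
    using d g assms(3) by (simp add: mob_mult det_mul SL2_inv mob_inv)
  also have "\<dots> = mob \<sigma> z + of_int l * of_real h"
    unfolding sl(2) mob_scale[OF sl(1)] by simp
  finally have eq: "2 * of_real pi * \<i> * mob \<sigma> (mob g z) / of_real h = 2 * of_real pi * \<i> * mob \<sigma> z / of_real h + 2 * of_real pi * \<i> * of_int l"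
    using d(3) by (simp add: field_simps)
  show ?thesis unfolding cusp_coord_def eq exp_add using exp_integer_2pi[of "of_int l"] by (simp add: mult_ac)
qed

lemma cusp_chart_exists:
  assumes x: "x \<in> cusps \<Gamma>" and frame: "cusp_frame \<Gamma> x \<sigma> h"
  obtains U t L where "(U, t) \<in> cusp_charts \<Gamma>" "L > 0" "orb \<Gamma> x \<in> U" "t (orb \<Gamma> x) = 0"
    "\<And>z. z \<in> uhp \<Longrightarrow> Im (mob \<sigma> z) > L \<Longrightarrow> z \<in> preim U \<and> lift t z = cusp_coord \<sigma> h z"
proof -
  obtain L where L: "L > 0" and st: "\<forall>g\<in>\<Gamma>. mob g ` {z \<in> uhp. Im (mob \<sigma> z) > L} \<inter> {z \<in> uhp. Im (mob \<sigma> z) > L} \<noteq> {} \<longrightarrow> g \<in> stab \<Gamma> x"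
    using exists_small_horodisc[OF frame] by blast
  define D where "D = {z \<in> uhp. Im (mob \<sigma> z) > L}"
  define U where "U = insert (orb \<Gamma> x) (quot_map \<Gamma> ` D)"
  define t where "t = (\<lambda>p. if p = orb \<Gamma> x then 0 else if p \<in> U then cusp_coord \<sigma> h (SOME z. z \<in> D \<and> quot_map \<Gamma> z = p) else undefined)"
  have t: "t (quot_map \<Gamma> z) = cusp_coord \<sigma> h z" if "z \<in> D" for z
  proof -
    define z' where "z' = (SOME w. w \<in> D \<and> quot_map \<Gamma> w = quot_map \<Gamma> z)"
    have z': "z' \<in> D" "quot_map \<Gamma> z = quot_map \<Gamma> z'"
      using someI[of "\<lambda>w. w \<in> D \<and> quot_map \<Gamma> w = quot_map \<Gamma> z" z] that by (auto simp: z'_def)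
    have zu: "z \<in> uhp" using that by (simp add: D_def)
    obtain g where g: "g \<in> \<Gamma>" "z' = mob g z" by (rule quot_map_eqE[OF zu z'(2)])
    then have gs: "g \<in> stab \<Gamma> x" using st that z'(1) unfolding D_def[symmetric] by blast
    then have "cusp_coord \<sigma> h z' = cusp_coord \<sigma> h z" using g zu stab_cusp_coord[OF frame] by simp
    then show ?thesis using that cusp_orbit_not_interior[OF x zu] by (auto simp: t_def U_def z'_def)
  qed
  have "(U, t) \<in> cusp_charts \<Gamma>"
    unfolding cusp_charts_def Let_def mem_Collect_eq prod.case
  proof (rule bexI[OF _ x], intro exI conjI)
    show "t \<in> extensional U" by (auto simp: t_def extensional_def U_def)
    show "t (orb \<Gamma> x) = 0" by (simp add: t_def)
    show "\<forall>z\<in>{z \<in> uhp. Im (mob \<sigma> z) > L}. t (quot_map \<Gamma> z) = exp (2 * of_real pi * \<i> * mob \<sigma> z / of_real h)"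
      using t by (simp add: D_def cusp_coord_def)
  qed (use frame L st in \<open>simp_all add: U_def D_def\<close>)
  then show ?thesis
    by (rule that[OF _ L]) (use t in \<open>auto simp: preim_def U_def D_def lift_def t_def\<close>)
qed

text \<open>Over a point of the half plane the transition map is obtained by descending the second coordinate along
the first. At a cusp both charts are cusp charts, and since their frames are related by an affine map,
the transition map is multiplication by a constant. The derivative has no zero because the
transition map is injective.\<close>

lemma transition_holomorphic:
  assumes "(U, t) \<in> surface_atlas \<Gamma>" "(V, s) \<in> surface_atlas \<Gamma>" "p \<in> U \<inter> V"
  obtains N where "open N" "t p \<in> N" "N \<subseteq> t ` (U \<inter> V)" "(s \<circ> inv_into U t) holomorphic_on N"
    "\<And>u. u \<in> N \<Longrightarrow> deriv (s \<circ> inv_into U t) u \<noteq> 0"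
proof -
  let ?F = "s \<circ> inv_into U t"
  note cU = coordinate_chart_atlas[OF assms(1)] and cV = coordinate_chart_atlas[OF assms(2)]
  have injs: "inj_on t U" "inj_on s V" using cU cV by (auto simp: coordinate_chart_def)
  have F: "?F (t p) = s p" if "p \<in> U" for p using injs that by simp
  have injF: "inj_on ?F (t ` (U \<inter> V))"
  proof (rule inj_onI, elim imageE)
    fix u v p p' assume "?F u = ?F v" "u = t p" "p \<in> U \<inter> V" "v = t p'" "p' \<in> U \<inter> V"
    then show "u = v" using F inj_onD[OF injs(2), of p p'] by auto
  qed
  have "\<exists>N. open N \<and> t p \<in> N \<and> N \<subseteq> t ` (U \<inter> V) \<and> ?F holomorphic_on N"
  proof (cases "p \<in> quot_map \<Gamma> ` uhp")
    case True
    then obtain z where z: "z \<in> uhp" "p = quot_map \<Gamma> z" by auto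
    have bU: "branched_over_0 (preim U) (lift t)" and bV: "branched_over_0 (preim V) (lift s)"
      using cU cV by (auto simp: coordinate_chart_def)
    define W where "W = preim U \<inter> preim V"
    have W: "open W" using bU bV by (auto simp: branched_over_0_def W_def)
    have bW: "branched_over_0 W (lift t)" by (rule branched_over_0_subset[OF bU W]) (simp add: W_def)
    have "lift s holomorphic_on W"
      using bV by (auto simp: branched_over_0_def W_def intro: holomorphic_on_subset)
    moreover have "lift s z = lift s z'" if "z \<in> W" "z' \<in> W" "lift t z = lift t z'" for z z'
      using inj_onD[OF injs(1), of "quot_map \<Gamma> z" "quot_map \<Gamma> z'"] that by (simp add: lift_def W_def preim_def)
    ultimately obtain F where F': "F holomorphic_on lift t ` W" "\<And>z. z \<in> W \<Longrightarrow> F (lift t z) = lift s z"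
      using descend_holomorphic[OF bW] by blast
    have "?F holomorphic_on lift t ` W"
      by (rule holomorphic_transform[OF F'(1)]) (use F'(2) F in \<open>auto simp: lift_def W_def preim_def\<close>)
    moreover have "open (lift t ` W)" by (rule open_image_branched[OF bW W order_refl])
    moreover have "t p \<in> lift t ` W" using z assms(3) by (auto simp: lift_def W_def preim_def)
    moreover have "lift t ` W \<subseteq> t ` (U \<inter> V)" by (auto simp: lift_def W_def preim_def)
    ultimately show ?thesis by blast
  next
    case False
    then have "(U, t) \<in> cusp_charts \<Gamma>" "(V, s) \<in> cusp_charts \<Gamma>"
      using assms coordinate_chart_interior(2) by (auto simp: surface_atlas_def)
    note cusp = this
    obtain x \<sigma> h L where c: "x \<in> cusps \<Gamma>" "cusp_frame \<Gamma> x \<sigma> h" "L > 0"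
      "U = insert (orb \<Gamma> x) (quot_map \<Gamma> ` {z \<in> uhp. Im (mob \<sigma> z) > L})"
      "t (orb \<Gamma> x) = 0" "\<And>z. z \<in> uhp \<Longrightarrow> Im (mob \<sigma> z) > L \<Longrightarrow> t (quot_map \<Gamma> z) = cusp_coord \<sigma> h z"
      by (rule cusp_chartE[OF cusp(1)]) blast
    obtain x' \<sigma>' h' L' where c': "x' \<in> cusps \<Gamma>" "cusp_frame \<Gamma> x' \<sigma>' h'" "L' > 0"
      "V = insert (orb \<Gamma> x') (quot_map \<Gamma> ` {z \<in> uhp. Im (mob \<sigma>' z) > L'})"
      "s (orb \<Gamma> x') = 0" "\<And>z. z \<in> uhp \<Longrightarrow> Im (mob \<sigma>' z) > L' \<Longrightarrow> s (quot_map \<Gamma> z) = cusp_coord \<sigma>' h' z"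
      by (rule cusp_chartE[OF cusp(2)]) blast
    have p: "p = orb \<Gamma> x" "p = orb \<Gamma> x'" using False assms(3) c(4) c'(4) by auto
    note d = cusp_frameD[OF c(2)] and d' = cusp_frameD[OF c'(2)]
    obtain \<gamma> \<alpha> \<beta> where \<gamma>: "\<gamma> \<in> \<Gamma>" "\<alpha> \<noteq> 0" "h' = \<alpha>\<^sup>2 * h"
      "\<And>z. z \<in> uhp \<Longrightarrow> mob \<sigma>' (mob \<gamma> z) = of_real (\<alpha>\<^sup>2) * mob \<sigma> z + of_real \<beta>"
      using change_of_frame[OF c(2) c'(2)] p by metis
    define C where "C = exp (2 * of_real pi * \<i> * of_real \<beta> / of_real h' :: complex)"
    \<comment> \<open>Height \<open>K\<close> in the first frame suffices for both horodiscs, as \<open>\<gamma>\<close> multiplies heights by \<open>\<alpha>\<^sup>2\<close>.\<close>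
    define K where "K = max L (L' / \<alpha>\<^sup>2)"
    have K: "K > 0" "K \<ge> L" "\<alpha>\<^sup>2 * K \<ge> L'"
    proof -
      have "K \<ge> L' / \<alpha>\<^sup>2" by (simp add: K_def)
      then show "\<alpha>\<^sup>2 * K \<ge> L'" using \<gamma>(2) by (simp add: pos_divide_le_eq mult.commute)
    qed (use c(3) in \<open>auto simp: K_def\<close>)
    define N where "N = ball (0::complex) (exp (- (2 * pi * K / h)))"
    have N1: "exp (- (2 * pi * K / h)) \<le> 1" using K d by simp
    have *: "u \<in> t ` (U \<inter> V) \<and> ?F u = C * u" if "u \<in> N" for u
    proof (cases "u = 0")
      case True
      then have "u = t p" "s p = 0" using p c(5) c'(5) by auto
      then show ?thesis using True assms(3) F[of p] by auto
    next
      case False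
      have "norm u < exp (- (2 * pi * K / h))" using that by (simp add: N_def)
      then have "norm u < 1" using N1 by linarith
      then obtain z where z: "z \<in> uhp" "cusp_coord \<sigma> h z = u" using cusp_coord_surj[OF d(1,3) False] by blast
      have "Im (mob \<sigma> z) > K" using that z norm_cusp_coord_less[OF d(3), of \<sigma> z K] by (simp add: N_def)
      then have "Im (mob \<sigma> z) > L" "\<alpha>\<^sup>2 * Im (mob \<sigma> z) > L'"
        using K \<gamma>(2) by (auto intro: less_le_trans) (smt (verit) mult_strict_left_mono zero_less_power2)
      moreover have "Im (mob \<sigma>' (mob \<gamma> z)) = \<alpha>\<^sup>2 * Im (mob \<sigma> z)"
        unfolding \<gamma>(4)[OF z(1)] by (simp del: of_real_power)
      ultimately have L': "Im (mob \<sigma>' (mob \<gamma> z)) > L'" by simp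
      have \<gamma>z: "mob \<gamma> z \<in> uhp" using z \<gamma>(1) by simp
      have tz: "t (quot_map \<Gamma> z) = u" "quot_map \<Gamma> z \<in> U"
        using z c(6)[OF z(1)] \<open>Im (mob \<sigma> z) > L\<close> by (auto simp: c(4))
      have "quot_map \<Gamma> (mob \<gamma> z) \<in> V" using \<gamma>z L' unfolding c'(4) by blast
      then have sz: "s (quot_map \<Gamma> z) = C * u" "quot_map \<Gamma> z \<in> V"
        using z \<gamma>(1) c'(6)[OF \<gamma>z L'] cusp_coord_change[OF d(3) \<gamma>(2,3) \<gamma>(4)[OF z(1)]]
        by (simp_all add: C_def)
      then show ?thesis using tz F[of "quot_map \<Gamma> z"] by auto
    qed
    have "(\<lambda>u. C * u) holomorphic_on N" by (intro holomorphic_intros)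
    then have "?F holomorphic_on N" by (rule holomorphic_transform) (use * in simp)
    moreover have "open N" "t p \<in> N" using p(1) c(5) by (auto simp: N_def)
    moreover have "N \<subseteq> t ` (U \<inter> V)" using * by blast
    ultimately show ?thesis by blast
  qed
  then obtain N where N: "open N" "t p \<in> N" "N \<subseteq> t ` (U \<inter> V)" "?F holomorphic_on N" by blast
  moreover have "deriv ?F u \<noteq> 0" if "u \<in> N" for u
    by (rule holomorphic_injective_imp_regular[OF N(4,1) inj_on_subset[OF injF N(3)] that])
  ultimately show ?thesis using that by blast
qed

end

section \<open>The differential of a form\<close>

lemma nicely_meromorphic_on_cong_open:
  assumes "open S" "\<And>u. u \<in> S \<Longrightarrow> f u = g u" "f nicely_meromorphic_on S"
  shows "g nicely_meromorphic_on S"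
proof -
  have ev': "\<forall>\<^sub>F v in at u. f v = g v" if "u \<in> S" for u
    using eventually_at_in_open'[OF assms(1) that] by eventually_elim (rule assms(2))
  have "g meromorphic_on S"
    using assms(3) meromorphic_on_cong[of S f g] ev' by (auto simp: nicely_meromorphic_on_def)
  moreover have "is_pole g u \<and> g u = 0 \<or> g \<midarrow>u\<rightarrow> g u" if "u \<in> S" for u
    using assms(3) that is_pole_cong[OF ev'[OF that] refl] tendsto_cong[OF ev'[OF that]] assms(2)[OF that]
    by (auto simp: nicely_meromorphic_on_def)
  ultimately show ?thesis by (auto simp: nicely_meromorphic_on_def)
qed

lemma filterlim_at_regular:
  assumes "open N" "u \<in> N" "F holomorphic_on N" "deriv F u \<noteq> 0"
  shows "filterlim F (at (F u)) (at u)"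
proof -
  obtain r where r: "r > 0" "ball u r \<subseteq> N" "inj_on F (ball u r)"
    using has_complex_derivative_locally_injective[OF assms(3,2,1,4)] by blast
  have "isCont F u"
    using assms by (meson continuous_on_eq_continuous_at holomorphic_on_imp_continuous_on)
  then have "F \<midarrow>u\<rightarrow> F u" by (simp add: isCont_def)
  moreover have "\<forall>\<^sub>F v in at u. F v \<noteq> F u"
  proof -
    have "\<forall>\<^sub>F v in at u. v \<in> ball u r - {u}" using r(1) by (intro eventually_at_in_open) auto
    then show ?thesis
      by eventually_elim (use r in \<open>auto simp: inj_on_def\<close>)
  qed
  ultimately show ?thesis by (simp add: filterlim_at)
qed

text \<open>Two normalised meromorphic functions related by a regular change of coordinate in a punctured
neighbourhood of a point are related at the point itself: either both have limits, or both
have poles and the value 0. This transports identities to the centres of charts.\<close>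

lemma nicely_meromorphic_relation_at:
  assumes \<phi>: "\<phi> nicely_meromorphic_on {u}" and \<psi>: "\<psi> nicely_meromorphic_on {F u}"
    and F: "open N" "u \<in> N" "F holomorphic_on N" "deriv F u \<noteq> 0"
    and eq: "\<forall>\<^sub>F v in at u. \<phi> v = \<psi> (F v) * deriv F v ^ l"
  shows "\<phi> u = \<psi> (F u) * deriv F u ^ l"
proof -
  note lim = filterlim_at_regular[OF F]
  have "deriv F holomorphic_on N" using F by (intro holomorphic_deriv)
  then have "isCont (deriv F) u"
    using F by (meson continuous_on_eq_continuous_at holomorphic_on_imp_continuous_on)
  then have d: "((\<lambda>v. deriv F v ^ l) \<longlongrightarrow> deriv F u ^ l) (at u)"
    by (intro tendsto_power) (simp add: isCont_def)
  from \<psi> consider "is_pole \<psi> (F u)" "\<psi> (F u) = 0" | "\<psi> \<midarrow>F u\<rightarrow> \<psi> (F u)"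
    by (auto simp: nicely_meromorphic_on_def)
  then show ?thesis
  proof cases
    case 1
    have "filterlim (\<lambda>v. \<psi> (F v)) at_infinity (at u)"
      using filterlim_compose[OF _ lim, of \<psi> at_infinity] 1(1) by (simp add: is_pole_def)
    then have "filterlim (\<lambda>v. deriv F v ^ l * \<psi> (F v)) at_infinity (at u)"
      by (intro tendsto_mult_filterlim_at_infinity[OF d]) (use F in auto)
    moreover have "\<forall>\<^sub>F v in at u. deriv F v ^ l * \<psi> (F v) = \<phi> v"
      using eq by eventually_elim simp
    ultimately have inf: "filterlim \<phi> at_infinity (at u)"
      by (rule filterlim_cong[OF refl refl, THEN iffD1, rotated])
    then have "\<not> \<phi> \<midarrow>u\<rightarrow> \<phi> u"
      using not_tendsto_and_filterlim_at_infinity[of "at u"] by auto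
    then have "\<phi> u = 0" using \<phi> by (auto simp: nicely_meromorphic_on_def)
    then show ?thesis using 1 by simp
  next
    case 2
    have "((\<lambda>v. \<psi> (F v)) \<longlongrightarrow> \<psi> (F u)) (at u)"
      by (rule filterlim_compose[OF 2 lim])
    then have "((\<lambda>v. \<psi> (F v) * deriv F v ^ l) \<longlongrightarrow> \<psi> (F u) * deriv F u ^ l) (at u)"
      by (intro tendsto_mult d)
    then have t: "\<phi> \<midarrow>u\<rightarrow> \<psi> (F u) * deriv F u ^ l"
      using tendsto_cong[OF eq] by simp
    then have "\<not> is_pole \<phi> u"
      unfolding is_pole_def using not_tendsto_and_filterlim_at_infinity[of "at u"] by auto
    then have "\<phi> \<midarrow>u\<rightarrow> \<phi> u" using \<phi> by (auto simp: nicely_meromorphic_on_def)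
    then show ?thesis using t LIM_unique by blast
  qed
qed

lemma nicely_meromorphic_eq_at:
  assumes "\<phi> nicely_meromorphic_on {u}" "\<psi> nicely_meromorphic_on {u}" "\<forall>\<^sub>F v in at u. \<phi> v = \<psi> v"
  shows "\<phi> u = \<psi> u"
  using nicely_meromorphic_relation_at[of \<phi> u \<psi> "\<lambda>v. v" UNIV 0] assms by simp

context discrete_SL2_subgroup
begin

definition automorphic :: "nat \<Rightarrow> (complex \<Rightarrow> complex) \<Rightarrow> bool" where
  "automorphic m f \<longleftrightarrow> f holomorphic_on uhp \<and> (\<forall>g\<in>\<Gamma>. \<forall>z\<in>uhp. f (mob g z) = autf g z ^ m * f z)"

lemma modular_forms_automorphic: "f \<in> modular_forms \<Gamma> m \<Longrightarrow> automorphic m f"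
  by (simp add: modular_forms_def automorphic_def)

lemma lift_eqD:
  assumes "coordinate_chart U t" "z \<in> preim U" "z' \<in> preim U" "lift t z = lift t z'"
  obtains g where "g \<in> \<Gamma>" "z' = mob g z"
proof -
  have "quot_map \<Gamma> z = quot_map \<Gamma> z'"
    using assms by (auto simp: coordinate_chart_def lift_def preim_def inj_on_def)
  moreover have "z \<in> uhp" using assms by (simp add: preim_def)
  ultimately show ?thesis using that quot_map_eqE by metis
qed

text \<open>The coefficient with respect to \<open>(du / u)\<^sup>l\<close> is used instead of the one with respect to \<open>(du)\<^sup>l\<close>, because it
has no pole at the branch point. It is invariant: an element \<open>g\<close> multiplies \<open>f\<close> and \<open>\<tau>'\<^sup>l\<close> by
the same factor \<open>j\<^bsup>2l\<^esup>\<close>.\<close>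

lemma reduced_form_exists:
  assumes c: "coordinate_chart U t" and f: "automorphic (2 * l) f"
  obtains H where "H holomorphic_on lift t ` preim U"
    "\<And>z. z \<in> preim U \<Longrightarrow> H (lift t z) = f z * (lift t z / deriv (lift t) z) ^ l"
proof -
  have br: "branched_over_0 (preim U) (lift t)"
    and q: "(\<lambda>z. lift t z / deriv (lift t) z) holomorphic_on preim U"
    using c by (auto simp: coordinate_chart_def)
  have "f holomorphic_on preim U"
    using f by (auto simp: automorphic_def preim_def intro: holomorphic_on_subset)
  then have hol: "(\<lambda>z. f z * (lift t z / deriv (lift t) z) ^ l) holomorphic_on preim U"
    by (intro holomorphic_on_mult holomorphic_on_power q)
  have "f z * (lift t z / deriv (lift t) z) ^ l = f z' * (lift t z' / deriv (lift t) z') ^ l"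
    if z: "z \<in> preim U" "z' \<in> preim U" "lift t z = lift t z'" for z z'
  proof -
    obtain g where g: "g \<in> \<Gamma>" "z' = mob g z" using lift_eqD[OF c z] by metis
    have zu: "z \<in> uhp" using z by (simp add: preim_def)
    have nz: "autf g z \<noteq> 0" using g zu by (simp add: autf_nonzero)
    have "f z' = autf g z ^ (2 * l) * f z" using f g zu by (simp add: automorphic_def)
    moreover have "deriv (lift t) z' = deriv (lift t) z * (autf g z)\<^sup>2"
      using deriv_lift_mob[OF br z(1) g(1)] g(2) by simp
    ultimately show ?thesis
      using nz z(3) by (simp add: power_divide power_mult_distrib power_mult)
  qed
  then show ?thesis using descend_holomorphic[OF br hol] that by blast
qed

lemma fourier_expansion_any_frame:
  assumes f: "f \<in> modular_forms \<Gamma> m" and frame: "cusp_frame \<Gamma> x \<sigma> h" and x: "x \<in> cusps \<Gamma>"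
  obtains a where "fourier_expansion m f \<sigma> h a"
proof -
  obtain \<sigma>' h' a' where "cusp_frame \<Gamma> x \<sigma>' h'" "fourier_expansion m f \<sigma>' h' a'"
    using f x unfolding modular_forms_def by blast
  moreover have "f (mob g z) = autf g z ^ m * f z" if "g \<in> \<Gamma>" "z \<in> uhp" for g z
    using modular_forms_automorphic[OF f] that by (simp add: automorphic_def)
  ultimately show ?thesis
    using fourier_expansion_change_of_frame[OF frame _ refl] that by metis
qed

text \<open>In a cusp chart \<open>\<tau> / \<tau>'\<close> is a constant multiple of \<open>j(\<sigma>, z)\<^sup>2\<close>, so the coefficient is a constant multiple of the
Fourier series and extends to the cusp.\<close>

lemma reduced_form_holomorphic:
  assumes c: "(U, t) \<in> surface_atlas \<Gamma>" and f: "f \<in> modular_forms \<Gamma> (2 * l)"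
  obtains H where "H holomorphic_on t ` U"
    "\<And>z. z \<in> preim U \<Longrightarrow> H (lift t z) = f z * (lift t z / deriv (lift t) z) ^ l"
proof -
  note cc = coordinate_chart_atlas[OF c]
  obtain H where H: "H holomorphic_on lift t ` preim U"
    "\<And>z. z \<in> preim U \<Longrightarrow> H (lift t z) = f z * (lift t z / deriv (lift t) z) ^ l"
    using reduced_form_exists[OF cc modular_forms_automorphic[OF f]] by metis
  show ?thesis
  proof (cases "(U, t) \<in> interior_charts \<Gamma>")
    case True
    then have "t ` U = lift t ` preim U"
      using coordinate_chart_interior(2)[OF True] by (auto simp: lift_def preim_def image_iff)
    then show ?thesis using H that by metis
  next
    case False
    then have "(U, t) \<in> cusp_charts \<Gamma>" using c by (simp add: surface_atlas_def)
    then obtain x \<sigma> h L where cu: "x \<in> cusps \<Gamma>" "cusp_frame \<Gamma> x \<sigma> h" "L > 0"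
      "U = insert (orb \<Gamma> x) (quot_map \<Gamma> ` {z \<in> uhp. Im (mob \<sigma> z) > L})"
      "t (orb \<Gamma> x) = 0" "\<And>z. z \<in> uhp \<Longrightarrow> Im (mob \<sigma> z) > L \<Longrightarrow> t (quot_map \<Gamma> z) = cusp_coord \<sigma> h z"
      by (rule cusp_chartE) blast
    note d = cusp_frameD[OF cu(2)]
    obtain a where a: "fourier_expansion (2 * l) f \<sigma> h a"
      using fourier_expansion_any_frame[OF f cu(2,1)] by blast
    obtain P where P: "P holomorphic_on ball 0 1"
      "\<And>z. z \<in> uhp \<Longrightarrow> P (cusp_coord \<sigma> h z) = f z * autf \<sigma> z ^ (2 * l)"
      using fourier_expansion_power_series[OF d(1,3) a] by metis
    define K where "K = (of_real h / (2 * of_real pi * \<i>) :: complex)"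
    define D where "D = {z \<in> uhp. Im (mob \<sigma> z) > L}"
    have "open D" unfolding D_def by (rule open_horodisc[OF d(1)])
    have lift_D: "lift t z = cusp_coord \<sigma> h z" "z \<in> preim U" if "z \<in> D" for z
      using that cu(4,6) by (auto simp: D_def lift_def preim_def)
    have deriv_D: "deriv (lift t) z = deriv (cusp_coord \<sigma> h) z" if "z \<in> D" for z
      by (rule deriv_cong_ev[OF _ refl])
         (use eventually_nhds_in_open[OF \<open>open D\<close> that] in eventually_elim, rule lift_D)
    have HD: "H (lift t z) = K ^ l * P (lift t z)" if "z \<in> D" for z
    proof -
      have zu: "z \<in> uhp" using that by (simp add: D_def)
      have "H (lift t z) = f z * (K * (autf \<sigma> z)\<^sup>2) ^ l"
        using H(2)[OF lift_D(2)[OF that]] branched_cusp_coord(2)[OF d(1,3) zu]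
        by (simp add: deriv_D[OF that] lift_D(1)[OF that] K_def)
      also have "\<dots> = K ^ l * P (cusp_coord \<sigma> h z)"
        using P(2)[OF zu] by (simp add: power_mult_distrib power_mult)
      finally show ?thesis by (simp add: lift_D(1)[OF that])
    qed
    have HP: "H (lift t z) = K ^ l * P (lift t z)" if z: "z \<in> preim U" for z
    proof -
      have "quot_map \<Gamma> z \<in> quot_map \<Gamma> ` D"
        using z cusp_orbit_not_interior[OF cu(1)] unfolding preim_def cu(4) D_def by force
      then obtain w where "w \<in> D" "quot_map \<Gamma> z = quot_map \<Gamma> w" by auto
      then have "lift t z = lift t w" by (simp add: lift_def)
      then show ?thesis using HD[OF \<open>w \<in> D\<close>] by simp
    qed
    have "t ` U \<subseteq> ball 0 1"
    proof
      fix u assume "u \<in> t ` U"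
      then consider "u = 0" | z where "z \<in> D" "u = cusp_coord \<sigma> h z"
        using cu(4,5,6) by (auto simp: D_def)
      then show "u \<in> ball 0 1"
      proof cases
        case (2 z)
        then show ?thesis using norm_cusp_coord_less[OF d(3), of \<sigma> z 0] cu(3) by (auto simp: D_def)
      qed simp
    qed
    then have "P holomorphic_on t ` U" using P(1) holomorphic_on_subset by blast
    then have "(\<lambda>u. K ^ l * P u) holomorphic_on t ` U"
      by (intro holomorphic_on_mult holomorphic_on_const)
    then show ?thesis using that HP H(2) by metis
  qed
qed

text \<open>The pull-back condition holds pointwise except over the centres of charts. There the coefficient may
have a pole, in which case its value 0 has no meaning.\<close>

definition pulls_back_off_centre :: "nat \<Rightarrow> csphere set mdiff \<Rightarrow> (complex \<Rightarrow> complex) \<Rightarrow> bool" where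
  "pulls_back_off_centre l \<phi> f \<longleftrightarrow>
     (\<forall>(U, t)\<in>surface_atlas \<Gamma>. \<forall>z\<in>preim U. lift t z \<noteq> 0 \<longrightarrow> f z = \<phi> (U, t) (lift t z) * deriv (lift t) z ^ l)"

lemma pulls_back_off_centreD:
  "pulls_back_off_centre l \<phi> f \<Longrightarrow> (U, t) \<in> surface_atlas \<Gamma> \<Longrightarrow> z \<in> preim U \<Longrightarrow> lift t z \<noteq> 0 \<Longrightarrow>
     f z = \<phi> (U, t) (lift t z) * deriv (lift t) z ^ l"
  by (auto simp: pulls_back_off_centre_def)

lemma atlas_branched:
  assumes "(U, t) \<in> surface_atlas \<Gamma>"
  shows "branched_over_0 (preim U) (lift t)" "open (preim U)" "lift t holomorphic_on preim U"
    "\<And>z. z \<in> preim U \<Longrightarrow> lift t z \<noteq> 0 \<Longrightarrow> deriv (lift t) z \<noteq> 0"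
    "\<And>z. z \<in> preim U \<Longrightarrow> \<forall>\<^sub>F w in at z. w \<in> preim U \<and> lift t w \<noteq> 0"
    "open (t ` U)" "\<And>u. u \<in> t ` U \<Longrightarrow> u \<noteq> 0 \<Longrightarrow> u \<in> lift t ` preim U"
    "inj_on t U"
proof -
  have cc: "coordinate_chart U t" by (rule coordinate_chart_atlas[OF assms])
  then show br: "branched_over_0 (preim U) (lift t)" by (simp add: coordinate_chart_def)
  then show op: "open (preim U)" "lift t holomorphic_on preim U"
    "\<And>z. z \<in> preim U \<Longrightarrow> lift t z \<noteq> 0 \<Longrightarrow> deriv (lift t) z \<noteq> 0"
    by (auto simp: branched_over_0_def)
  show "\<forall>\<^sub>F w in at z. w \<in> preim U \<and> lift t w \<noteq> 0" if "z \<in> preim U" for z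
    using br that eventually_at_in_open'[OF op(1) that]
    by (auto simp: branched_over_0_def intro: eventually_conj)
  show "open (t ` U)" "inj_on t U" using cc by (auto simp: coordinate_chart_def)
  show "u \<in> lift t ` preim U" if "u \<in> t ` U" "u \<noteq> 0" for u
    using cc that by (auto simp: coordinate_chart_def)
qed

lemma pulls_back_to_iff:
  "pulls_back_to (surface_atlas \<Gamma>) l (quot_map \<Gamma>) uhp \<phi> f \<longleftrightarrow>
     (\<forall>(U, t)\<in>surface_atlas \<Gamma>. \<forall>z\<in>preim U. \<forall>\<^sub>F w in at z. f w = \<phi> (U, t) (lift t w) * deriv (lift t) w ^ l)"
  unfolding pulls_back_to_def lift_comp by (auto simp: lift_def preim_def)

lemma pulls_back_off_centre_imp:
  assumes "pulls_back_off_centre l \<phi> f"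
  shows "pulls_back_to (surface_atlas \<Gamma>) l (quot_map \<Gamma>) uhp \<phi> f"
proof -
  have "\<forall>\<^sub>F w in at z. f w = \<phi> (U, t) (lift t w) * deriv (lift t) w ^ l"
    if "(U, t) \<in> surface_atlas \<Gamma>" "z \<in> preim U" for U t z
    using atlas_branched(5)[OF that] by eventually_elim (use pulls_back_off_centreD[OF assms that(1)] in auto)
  then show ?thesis unfolding pulls_back_to_iff by auto
qed

lemma deriv_lift_transition:
  assumes ch: "(U, t) \<in> surface_atlas \<Gamma>" "(V, s) \<in> surface_atlas \<Gamma>"
    and N: "open N" "(s \<circ> inv_into U t) holomorphic_on N" "lift t z \<in> N" and z: "z \<in> preim U" "z \<in> preim V"
  shows "lift s z = (s \<circ> inv_into U t) (lift t z)"
    "deriv (lift s) z = deriv (s \<circ> inv_into U t) (lift t z) * deriv (lift t) z"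
proof -
  let ?F = "s \<circ> inv_into U t"
  have F: "?F (lift t w) = lift s w" if "w \<in> preim U" for w
    using atlas_branched(8)[OF ch(1)] that by (simp add: lift_def preim_def)
  then show "lift s z = ?F (lift t z)" using z by simp
  have "((\<lambda>w. ?F (lift t w)) has_field_derivative deriv ?F (lift t z) * deriv (lift t) z) (at z)"
    by (intro DERIV_chain2[of ?F] holomorphic_derivI[OF N(2,1,3)] holomorphic_derivI[OF atlas_branched(3,2)[OF ch(1)] z(1)])
  then have "(lift s has_field_derivative deriv ?F (lift t z) * deriv (lift t) z) (at z)"
    by (rule has_field_derivative_transform_within_open[OF _ atlas_branched(2)[OF ch(1)] z(1) F])
  then show "deriv (lift s) z = deriv ?F (lift t z) * deriv (lift t) z"
    by (rule DERIV_imp_deriv)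
qed

text \<open>The transition law holds near the point, where the coefficients can be compared through \<open>f\<close>,
and it extends to the point because the coefficients are normalised.\<close>

lemma transition_law:
  assumes nm: "\<And>U t. (U, t) \<in> surface_atlas \<Gamma> \<Longrightarrow> \<phi> (U, t) nicely_meromorphic_on t ` U"
    and pb: "pulls_back_off_centre l \<phi> f"
    and ch: "(U, t) \<in> surface_atlas \<Gamma>" "(V, s) \<in> surface_atlas \<Gamma>" and p: "p \<in> U \<inter> V"
  shows "\<phi> (U, t) (t p) = \<phi> (V, s) (s p) * deriv (s \<circ> inv_into U t) (t p) ^ l"
proof -
  let ?F = "s \<circ> inv_into U t"
  obtain N where N: "open N" "t p \<in> N" "N \<subseteq> t ` (U \<inter> V)" "?F holomorphic_on N"
    "\<And>u. u \<in> N \<Longrightarrow> deriv ?F u \<noteq> 0"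
    using transition_holomorphic[OF ch p] by metis
  have Fp: "?F (t p) = s p" using atlas_branched(8)[OF ch(1)] p by simp
  have lim: "filterlim ?F (at (?F (t p))) (at (t p))"
    by (rule filterlim_at_regular[OF N(1,2,4) N(5)[OF N(2)]])
  have "\<forall>\<^sub>F v in at (t p). ?F v \<noteq> 0"
    by (rule eventually_compose_filterlim[OF eventually_neq_at_within lim])
  moreover have "\<forall>\<^sub>F v in at (t p). v \<noteq> 0" by (rule eventually_neq_at_within)
  moreover have "\<forall>\<^sub>F v in at (t p). v \<in> N" using N(1,2) by (rule eventually_at_in_open')
  ultimately have "\<forall>\<^sub>F v in at (t p). \<phi> (U, t) v = \<phi> (V, s) (?F v) * deriv ?F v ^ l"
  proof eventually_elim
    case (elim v)
    obtain p' where p': "p' \<in> U" "p' \<in> V" "v = t p'" using elim N(3) by auto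
    then obtain z where z: "z \<in> preim U" "v = lift t z" using atlas_branched(7)[OF ch(1), of v] elim by auto
    then have "quot_map \<Gamma> z = p'"
      using atlas_branched(8)[OF ch(1)] p' by (auto simp: lift_def preim_def inj_on_def)
    then have zV: "z \<in> preim V" using p' z by (simp add: preim_def)
    note tr = deriv_lift_transition[OF ch N(1,4) _ z(1) zV, folded z(2), OF elim(3)]
    have "\<phi> (U, t) v * deriv (lift t) z ^ l = f z"
      using pulls_back_off_centreD[OF pb ch(1) z(1)] elim z(2) by simp
    also have "f z = \<phi> (V, s) (?F v) * deriv (lift s) z ^ l"
      using pulls_back_off_centreD[OF pb ch(2) zV] elim tr(1) by simp
    also have "\<dots> = \<phi> (V, s) (?F v) * deriv ?F v ^ l * deriv (lift t) z ^ l"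
      by (simp only: tr(2) power_mult_distrib mult.assoc)
    finally show ?case
      using atlas_branched(4)[OF ch(1) z(1)] elim(2) z(2) by simp
  qed
  then have "\<phi> (U, t) (t p) = \<phi> (V, s) (?F (t p)) * deriv ?F (t p) ^ l"
    using nm[OF ch(1)] nm[OF ch(2)] p N(5)[OF N(2)] Fp
    by (intro nicely_meromorphic_relation_at[OF _ _ N(1,2,4)]) (auto intro: nicely_meromorphic_on_subset)
  then show ?thesis by (simp only: Fp)
qed

text \<open>The coefficient is \<open>H / u\<^sup>l\<close>, normalised at the centre.\<close>

lemma form_differential_exists:
  assumes f: "f \<in> modular_forms \<Gamma> (2 * l)"
  obtains \<phi> where "\<phi> \<in> meromorphic_differentials (surface_atlas \<Gamma>) l" "pulls_back_off_centre l \<phi> f"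
proof -
  have "\<exists>H. H holomorphic_on t ` U \<and> (\<forall>z\<in>preim U. H (lift t z) = f z * (lift t z / deriv (lift t) z) ^ l)"
    if "(U, t) \<in> surface_atlas \<Gamma>" for U t
    using reduced_form_holomorphic[OF that f] by metis
  then obtain H where H: "\<And>U t. (U, t) \<in> surface_atlas \<Gamma> \<Longrightarrow> H U t holomorphic_on t ` U"
    "\<And>U t z. (U, t) \<in> surface_atlas \<Gamma> \<Longrightarrow> z \<in> preim U \<Longrightarrow> H U t (lift t z) = f z * (lift t z / deriv (lift t) z) ^ l"
    by metis
  define \<phi> where "\<phi> = (\<lambda>(U, t) u. if (U, t) \<in> surface_atlas \<Gamma> \<and> u \<in> t ` U then remove_sings (\<lambda>v. H U t v / v ^ l) u else 0)"
  have nm: "\<phi> (U, t) nicely_meromorphic_on t ` U" if ch: "(U, t) \<in> surface_atlas \<Gamma>" for U t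
  proof -
    have "H U t analytic_on t ` U" using H(1)[OF ch] atlas_branched(6)[OF ch] by (simp add: analytic_on_open)
    then have "(\<lambda>v. H U t v / v ^ l) meromorphic_on t ` U"
      by (intro meromorphic_intros analytic_on_imp_meromorphic_on)
    then have "remove_sings (\<lambda>v. H U t v / v ^ l) nicely_meromorphic_on t ` U"
      by (rule remove_sings_nicely_meromorphic)
    then show ?thesis
      by (rule nicely_meromorphic_on_cong_open[OF atlas_branched(6)[OF ch], rotated]) (simp add: \<phi>_def ch)
  qed
  have pb: "pulls_back_off_centre l \<phi> f"
    unfolding pulls_back_off_centre_def
  proof safe
    fix U t z assume ch: "(U, t) \<in> surface_atlas \<Gamma>" and z: "z \<in> preim U" "lift t z \<noteq> 0"
    have zU: "lift t z \<in> t ` U" using z by (auto simp: lift_def preim_def)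
    have "H U t analytic_on {lift t z}" using H(1)[OF ch] atlas_branched(6)[OF ch] zU by (auto simp: analytic_at)
    then have "(\<lambda>v. H U t v / v ^ l) analytic_on {lift t z}"
      using z(2) by (intro analytic_intros) auto
    then have "\<phi> (U, t) (lift t z) = H U t (lift t z) / lift t z ^ l"
      using ch zU by (simp add: \<phi>_def)
    then show "f z = \<phi> (U, t) (lift t z) * deriv (lift t) z ^ l"
      using H(2)[OF ch z(1)] z(2) atlas_branched(4)[OF ch z] by (simp add: power_divide)
  qed
  have "\<phi> \<in> meromorphic_differentials (surface_atlas \<Gamma>) l"
    unfolding meromorphic_differentials_def
  proof (intro CollectI conjI)
    show "\<forall>c. c \<notin> surface_atlas \<Gamma> \<longrightarrow> \<phi> c = (\<lambda>_. 0)" by (auto simp: \<phi>_def)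
    show "\<forall>(U, t)\<in>surface_atlas \<Gamma>. \<phi> (U, t) nicely_meromorphic_on t ` U \<and> (\<forall>z. z \<notin> t ` U \<longrightarrow> \<phi> (U, t) z = 0)"
      using nm by (auto simp: \<phi>_def)
    show "\<forall>(U, t)\<in>surface_atlas \<Gamma>. \<forall>(V, s)\<in>surface_atlas \<Gamma>. \<forall>p\<in>U \<inter> V.
            \<phi> (U, t) (t p) = \<phi> (V, s) (s p) * deriv (s \<circ> inv_into U t) (t p) ^ l"
      using transition_law[of \<phi> l f, OF nm pb] by blast
  qed
  then show ?thesis using pb that by blast
qed

lemma meromorphic_differentialD:
  assumes "\<phi> \<in> meromorphic_differentials (surface_atlas \<Gamma>) l"
  shows "\<And>c. c \<notin> surface_atlas \<Gamma> \<Longrightarrow> \<phi> c = (\<lambda>_. 0)"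
    "\<And>U t. (U, t) \<in> surface_atlas \<Gamma> \<Longrightarrow> \<phi> (U, t) nicely_meromorphic_on t ` U"
    "\<And>U t u. (U, t) \<in> surface_atlas \<Gamma> \<Longrightarrow> u \<notin> t ` U \<Longrightarrow> \<phi> (U, t) u = 0"
    "\<And>U t V s p. (U, t) \<in> surface_atlas \<Gamma> \<Longrightarrow> (V, s) \<in> surface_atlas \<Gamma> \<Longrightarrow> p \<in> U \<Longrightarrow> p \<in> V \<Longrightarrow>
       \<phi> (U, t) (t p) = \<phi> (V, s) (s p) * deriv (s \<circ> inv_into U t) (t p) ^ l"
  using assms unfolding meromorphic_differentials_def by blast+

text \<open>The pull-back determines the coefficient in a punctured neighbourhood of every point of
the image of the half plane, hence by normalisation on this image. The only other point that a chart can
contain is a cusp at its centre, where normalisation is applied once more.\<close>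

lemma differential_unique:
  assumes \<phi>: "\<phi> \<in> meromorphic_differentials (surface_atlas \<Gamma>) l" "\<psi> \<in> meromorphic_differentials (surface_atlas \<Gamma>) l"
    and pb: "pulls_back_to (surface_atlas \<Gamma>) l (quot_map \<Gamma>) uhp \<phi> f"
      "pulls_back_to (surface_atlas \<Gamma>) l (quot_map \<Gamma>) uhp \<psi> f"
  shows "\<phi> = \<psi>"
proof (intro ext)
  fix c :: "csphere set chart" and u
  obtain U :: "csphere set set" and t :: "csphere set \<Rightarrow> complex" where c: "c = (U, t)"
    by (cases c)
  have "\<phi> (U, t) u = \<psi> (U, t) u" if ch: "(U, t) \<in> surface_atlas \<Gamma>" and u: "u \<in> t ` U"
  proof -
    have nm: "\<phi> (U, t) nicely_meromorphic_on {u}" "\<psi> (U, t) nicely_meromorphic_on {u}" if "u \<in> t ` U" for u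
      using \<phi>[THEN meromorphic_differentialD(2), OF ch] that by (auto intro: nicely_meromorphic_on_subset)
    have lifted: "\<phi> (U, t) u = \<psi> (U, t) u" if "u \<in> lift t ` preim U" for u
    proof -
      from that obtain z where z: "z \<in> preim U" "u = lift t z" by auto
      have "\<forall>\<^sub>F w in at z. w \<in> preim U \<and> \<phi> (U, t) (lift t w) = \<psi> (U, t) (lift t w)"
        using atlas_branched(5)[OF ch z(1)] pb[unfolded pulls_back_to_iff, THEN bspec, OF ch, unfolded prod.case, THEN bspec, OF z(1)]
        by eventually_elim (use atlas_branched(4)[OF ch] in auto)
      then obtain N where N: "open N" "z \<in> N" "\<And>w. w \<in> N \<Longrightarrow> w \<noteq> z \<Longrightarrow> w \<in> preim U \<and> \<phi> (U, t) (lift t w) = \<psi> (U, t) (lift t w)"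
        by (auto simp: eventually_at_topological)
      then have NU: "N \<subseteq> preim U" using z by blast
      have "open (lift t ` N)" by (rule open_image_branched[OF atlas_branched(1)[OF ch] N(1) NU])
      then have "\<forall>\<^sub>F v in at u. v \<in> lift t ` N - {u}" using N z by (intro eventually_at_in_open) auto
      then have "\<forall>\<^sub>F v in at u. \<phi> (U, t) v = \<psi> (U, t) v"
        by eventually_elim (use N(3) z(2) in auto)
      moreover have "u \<in> t ` U" using z by (auto simp: lift_def preim_def)
      ultimately show ?thesis using nm nicely_meromorphic_eq_at by blast
    qed
    show ?thesis
    proof (cases "u \<in> lift t ` preim U")
      case False
      then have "u = 0" using atlas_branched(7)[OF ch] u by blast
      have "\<forall>\<^sub>F v in at u. v \<in> t ` U - {u}" using u by (intro eventually_at_in_open atlas_branched(6)[OF ch])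
      then have "\<forall>\<^sub>F v in at u. \<phi> (U, t) v = \<psi> (U, t) v"
        by eventually_elim (use lifted atlas_branched(7)[OF ch] \<open>u = 0\<close> in auto)
      then show ?thesis using nm[OF u] nicely_meromorphic_eq_at by blast
    qed (rule lifted)
  qed
  then show "\<phi> c u = \<psi> c u"
    using \<phi>[THEN meromorphic_differentialD(1)] \<phi>[THEN meromorphic_differentialD(3)]
    unfolding c by (cases "(U, t) \<in> surface_atlas \<Gamma>"; cases "u \<in> t ` U") auto
qed

lemma form_differential_eqI:
  assumes "\<phi> \<in> meromorphic_differentials (surface_atlas \<Gamma>) l"
    "pulls_back_to (surface_atlas \<Gamma>) l (quot_map \<Gamma>) uhp \<phi> f"
  shows "form_differential \<Gamma> (2 * l) f = \<phi>"
  unfolding form_differential_def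
  by (rule the_equality) (use assms differential_unique in auto)

lemma form_differential:
  assumes "f \<in> modular_forms \<Gamma> (2 * l)"
  shows "form_differential \<Gamma> (2 * l) f \<in> meromorphic_differentials (surface_atlas \<Gamma>) l"
    "pulls_back_off_centre l (form_differential \<Gamma> (2 * l) f) f"
proof -
  obtain \<phi> where \<phi>: "\<phi> \<in> meromorphic_differentials (surface_atlas \<Gamma>) l" "pulls_back_off_centre l \<phi> f"
    by (rule form_differential_exists[OF assms])
  have "form_differential \<Gamma> (2 * l) f = \<phi>"
    by (rule form_differential_eqI[OF \<phi>(1) pulls_back_off_centre_imp[OF \<phi>(2)]])
  then show "form_differential \<Gamma> (2 * l) f \<in> meromorphic_differentials (surface_atlas \<Gamma>) l"
    "pulls_back_off_centre l (form_differential \<Gamma> (2 * l) f) f" using \<phi> by auto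
qed


section \<open>Poles at the centres of charts\<close>

text \<open>The relation between the coefficient in a cusp chart and the form, in the shape in which the Fourier series
appears on the left: \<open>\<tau>' = (2 \<pi> \<i> / h) \<tau> / j\<^sup>2\<close>.\<close>

lemma cusp_chart_at:
  assumes x: "x \<in> cusps \<Gamma>" and frame: "cusp_frame \<Gamma> x \<sigma> h"
  obtains V s \<rho> where "(V, s) \<in> surface_atlas \<Gamma>" "orb \<Gamma> x \<in> V" "s (orb \<Gamma> x) = 0" "0 < \<rho>" "\<rho> \<le> 1"
    "ball 0 \<rho> \<subseteq> s ` V"
    "\<And>z l \<phi> f. z \<in> uhp \<Longrightarrow> norm (cusp_coord \<sigma> h z) < \<rho> \<Longrightarrow> pulls_back_off_centre l \<phi> f \<Longrightarrow>
       f z * autf \<sigma> z ^ (2 * l) = \<phi> (V, s) (cusp_coord \<sigma> h z) * (2 * of_real pi * \<i> / of_real h * cusp_coord \<sigma> h z) ^ l"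
proof -
  note d = cusp_frameD[OF frame]
  obtain V s L where c: "(V, s) \<in> cusp_charts \<Gamma>" "L > 0" "orb \<Gamma> x \<in> V" "s (orb \<Gamma> x) = 0"
    "\<And>z. z \<in> uhp \<Longrightarrow> Im (mob \<sigma> z) > L \<Longrightarrow> z \<in> preim V \<and> lift s z = cusp_coord \<sigma> h z"
    by (rule cusp_chart_exists[OF x frame]) blast
  have ch: "(V, s) \<in> surface_atlas \<Gamma>" using c(1) by (simp add: surface_atlas_def)
  define \<rho> where "\<rho> = exp (- (2 * pi * L / h))"
  have \<rho>: "0 < \<rho>" "\<rho> \<le> 1" using c(2) d(3) by (auto simp: \<rho>_def)
  have near: "Im (mob \<sigma> z) > L" if "norm (cusp_coord \<sigma> h z) < \<rho>" for z
    using that norm_cusp_coord_less[OF d(3), of \<sigma> z L] by (simp add: \<rho>_def)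
  have sub: "ball 0 \<rho> \<subseteq> s ` V"
  proof
    fix u :: complex assume u: "u \<in> ball 0 \<rho>"
    show "u \<in> s ` V"
    proof (cases "u = 0")
      case True
      then show ?thesis using c(3,4) by force
    next
      case False
      have "norm u < 1" using u \<rho> by simp
      then obtain z where z: "z \<in> uhp" "cusp_coord \<sigma> h z = u"
        using cusp_coord_surj[OF d(1,3) False] by blast
      then have "Im (mob \<sigma> z) > L" using near[of z] u by simp
      then have "quot_map \<Gamma> z \<in> V" "s (quot_map \<Gamma> z) = u" using c(5)[OF z(1)] z(2) by (auto simp: preim_def lift_def)
      then show ?thesis by blast
    qed
  qed
  have rel: "f z * autf \<sigma> z ^ (2 * l) = \<phi> (V, s) (cusp_coord \<sigma> h z) * (2 * of_real pi * \<i> / of_real h * cusp_coord \<sigma> h z) ^ l"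
    if z: "z \<in> uhp" "norm (cusp_coord \<sigma> h z) < \<rho>" and pb: "pulls_back_off_centre l \<phi> f" for z l \<phi> f
  proof -
    have zV: "z \<in> preim V" "lift s z = cusp_coord \<sigma> h z" using c(5)[OF z(1) near[OF z(2)]] by auto
    have "\<forall>\<^sub>F w in nhds z. w \<in> {z \<in> uhp. Im (mob \<sigma> z) > L}"
      using z near by (intro eventually_nhds_in_open open_horodisc d) auto
    then have "\<forall>\<^sub>F w in nhds z. lift s w = cusp_coord \<sigma> h w"
      by eventually_elim (use c(5) in auto)
    then have "deriv (lift s) z = deriv (cusp_coord \<sigma> h) z" by (rule deriv_cong_ev) simp
    also have "\<dots> = cusp_coord \<sigma> h z * (2 * of_real pi * \<i> / of_real h) / (autf \<sigma> z)\<^sup>2"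
      by (rule DERIV_imp_deriv[OF has_field_derivative_cusp_coord[OF d(1) z(1)]])
    finally have "f z = \<phi> (V, s) (cusp_coord \<sigma> h z) * (cusp_coord \<sigma> h z * (2 * of_real pi * \<i> / of_real h) / (autf \<sigma> z)\<^sup>2) ^ l"
      using pulls_back_off_centreD[OF pb ch zV(1)] zV(2) by simp
    then have "f z * autf \<sigma> z ^ (2 * l) = \<phi> (V, s) (cusp_coord \<sigma> h z) *
        ((cusp_coord \<sigma> h z * (2 * of_real pi * \<i> / of_real h) / (autf \<sigma> z)\<^sup>2) ^ l * ((autf \<sigma> z)\<^sup>2) ^ l)"
      by (simp add: power_mult)
    also have "(cusp_coord \<sigma> h z * (2 * of_real pi * \<i> / of_real h) / (autf \<sigma> z)\<^sup>2) ^ l * ((autf \<sigma> z)\<^sup>2) ^ l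
        = (2 * of_real pi * \<i> / of_real h * cusp_coord \<sigma> h z) ^ l"
      using autf_nonzero[OF d(1) z(1)] unfolding power_mult_distrib[symmetric] by (simp add: mult.commute)
    finally show ?thesis .
  qed
  show ?thesis by (rule that[OF ch c(3,4) \<rho> sub]) (rule rel)
qed

text \<open>The Fourier series is, up to a constant, \<open>u\<^sup>l\<close> times the coefficient of the differential.\<close>

lemma analytic_at_cusp_iff:
  assumes x: "x \<in> cusps \<Gamma>" and frame: "cusp_frame \<Gamma> x \<sigma> h" and a: "fourier_expansion (2 * l) f \<sigma> h a"
  obtains V s where "(V, s) \<in> surface_atlas \<Gamma>" "orb \<Gamma> x \<in> V" "s (orb \<Gamma> x) = 0"
    "\<And>\<phi>. pulls_back_off_centre l \<phi> f \<Longrightarrow> \<phi> (V, s) nicely_meromorphic_on s ` V \<Longrightarrow>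
       \<phi> (V, s) analytic_on {0} \<longleftrightarrow> (\<forall>n<l. a n = 0)"
proof -
  note d = cusp_frameD[OF frame]
  obtain V s \<rho> where c: "(V, s) \<in> surface_atlas \<Gamma>" "orb \<Gamma> x \<in> V" "s (orb \<Gamma> x) = 0" "0 < \<rho>" "\<rho> \<le> 1"
    "ball 0 \<rho> \<subseteq> s ` V"
    and rel: "\<And>z l \<phi> f. z \<in> uhp \<Longrightarrow> norm (cusp_coord \<sigma> h z) < \<rho> \<Longrightarrow> pulls_back_off_centre l \<phi> f \<Longrightarrow>
       f z * autf \<sigma> z ^ (2 * l) = \<phi> (V, s) (cusp_coord \<sigma> h z) * (2 * of_real pi * \<i> / of_real h * cusp_coord \<sigma> h z) ^ l"
    by (rule cusp_chart_at[OF x frame]) blast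
  obtain P where P: "\<And>u. norm u < 1 \<Longrightarrow> (\<lambda>n. a n * u ^ n) sums P u"
    "\<And>z. z \<in> uhp \<Longrightarrow> P (cusp_coord \<sigma> h z) = f z * autf \<sigma> z ^ (2 * l)"
    by (rule fourier_expansion_power_series[OF d(1,3) a]) blast
  define K where "K = (2 * of_real pi * \<i> / of_real h) ^ l"
  have K: "K \<noteq> 0" using d(3) by (simp add: K_def)
  show ?thesis
  proof (rule that[OF c(1-3)])
    fix \<phi> assume pb: "pulls_back_off_centre l \<phi> f" and nm: "\<phi> (V, s) nicely_meromorphic_on s ` V"
    have PE: "P u = K * \<phi> (V, s) u * u ^ l" if u: "u \<noteq> 0" "norm u < \<rho>" for u
    proof -
      have "norm u < 1" using u c(5) by simp
      then obtain z where z: "z \<in> uhp" "cusp_coord \<sigma> h z = u" using cusp_coord_surj[OF d(1,3) u(1)] by blast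
      then show ?thesis using P(2)[OF z(1)] rel[OF z(1) _ pb] u(2)
        by (simp only: z(2) power_mult_distrib K_def mult_ac)
    qed
    show "\<phi> (V, s) analytic_on {0} \<longleftrightarrow> (\<forall>n<l. a n = 0)"
    proof
      assume "\<phi> (V, s) analytic_on {0}"
      then obtain r where r: "r > 0" "\<phi> (V, s) holomorphic_on ball 0 r" by (auto simp: analytic_on_def)
      define b where "b n = (deriv ^^ n) (\<phi> (V, s)) 0 / fact n" for n
      have b: "(\<lambda>n. b n * u ^ n) sums \<phi> (V, s) u" if "norm u < r" for u
        using holomorphic_power_series[OF r(2), of u] that by (simp add: b_def)
      \<comment> \<open>The coefficients of \<open>K u\<^sup>l \<phi>(u)\<close>.\<close>
      define b' where "b' n = (if n < l then 0 else K * b (n - l))" for n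
      show "\<forall>n<l. a n = 0"
      proof (intro allI impI)
        fix n assume n: "n < l"
        have "a n - b' n = 0"
        proof (rule power_series_zero[of "min r \<rho>" "\<lambda>n. a n - b' n"])
          fix u :: complex assume u: "u \<noteq> 0" "norm u < min r \<rho>"
          have "(\<lambda>n. K * u ^ l * (b n * u ^ n)) sums (K * u ^ l * \<phi> (V, s) u)"
            using b[of u] u by (intro sums_mult) auto
          then have "(\<lambda>n. b' (n + l) * u ^ (n + l)) sums P u"
            using PE[of u] u by (simp add: b'_def power_add mult_ac)
          then have "(\<lambda>n. b' n * u ^ n) sums P u"
            using sums_zero_prefix_iff[of l "\<lambda>n. b' n * u ^ n" "P u"] by (simp add: b'_def)
          moreover have "(\<lambda>n. a n * u ^ n) sums P u" using P(1)[of u] u c(5) by simp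
          ultimately have "(\<lambda>n. a n * u ^ n - b' n * u ^ n) sums (P u - P u)" by (intro sums_diff)
          then show "(\<lambda>n. (a n - b' n) * u ^ n) sums 0" by (simp add: algebra_simps)
        qed (use r c in auto)
        then show "a n = 0" using n by (simp add: b'_def)
      qed
    next
      assume a0: "\<forall>n<l. a n = 0"
      define Q where "Q u = (if u = 0 then a l else P u / u ^ l)" for u
      have "(\<lambda>n. a (n + l) * u ^ n) sums Q u" if "norm u < 1" for u
      proof (cases "u = 0")
        case True
        then show ?thesis using powser_sums_zero[of "\<lambda>n. a (n + l)"] by (simp add: Q_def)
      next
        case False
        have "(\<lambda>n. a (n + l) * u ^ (n + l)) sums P u"
          using sums_zero_prefix_iff[of l "\<lambda>n. a n * u ^ n" "P u"] P(1)[OF that] a0 by simp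
        then have "(\<lambda>n. a (n + l) * u ^ (n + l) / u ^ l) sums (P u / u ^ l)" by (rule sums_divide)
        then show ?thesis using False by (simp add: Q_def power_add)
      qed
      then have "Q holomorphic_on ball 0 1"
        by (intro power_series_holomorphic[where a = "\<lambda>n. a (n + l)"]) auto
      then have "isCont Q 0" by (meson centre_in_ball continuous_on_eq_continuous_at holomorphic_on_imp_continuous_on open_ball zero_less_one)
      then have "((\<lambda>u. Q u / K) \<longlongrightarrow> Q 0 / K) (at 0)" using K by (auto simp: isCont_def intro!: tendsto_intros)
      moreover have "\<forall>\<^sub>F u in at 0. Q u / K = \<phi> (V, s) u"
      proof -
        have "\<forall>\<^sub>F u in at (0::complex). u \<in> ball 0 \<rho> - {0}" using c(4) by (intro eventually_at_in_open) auto
        then show ?thesis by eventually_elim (use K PE in \<open>auto simp: Q_def\<close>)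
      qed
      ultimately have "\<phi> (V, s) \<midarrow>0\<rightarrow> Q 0 / K" by (rule Lim_transform_eventually)
      then have "\<not> is_pole (\<phi> (V, s)) 0"
        unfolding is_pole_def using not_tendsto_and_filterlim_at_infinity[of "at (0::complex)"] by auto
      moreover have "0 \<in> s ` V" using c(4,6) by auto
      ultimately show "\<phi> (V, s) analytic_on {0}" using nicely_meromorphic_on_imp_analytic_at[OF nm] by blast
    qed
  qed
qed

text \<open>Write \<open>f = \<phi>(w\<^sup>e) (e w\<^bsup>e-1\<^esup> w')\<^sup>l\<close>. If \<open>\<phi>\<close> has a zero of order \<open>k\<close> at 0, the right hand side vanishes to order
\<open>e k + l (e - 1)\<close> at \<open>\<xi>\<close>. Conversely, for such an order of \<open>f\<close>, \<open>\<phi>(w\<^sup>e)\<close> has a finite limit at \<open>\<xi>\<close>, so \<open>\<phi>\<close>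
has no pole.\<close>

lemma analytic_at_interior_iff:
  assumes \<xi>: "\<xi> \<in> uhp" and hol: "f holomorphic_on uhp" and nz: "\<exists>z\<in>uhp. f z \<noteq> 0"
  obtains V s where "(V, s) \<in> surface_atlas \<Gamma>" "quot_map \<Gamma> \<xi> \<in> V" "s (quot_map \<Gamma> \<xi>) = 0"
    "\<And>\<phi>. pulls_back_off_centre l \<phi> f \<Longrightarrow> \<phi> (V, s) nicely_meromorphic_on s ` V \<Longrightarrow>
       \<phi> (V, s) analytic_on {0} \<longleftrightarrow> (\<exists>k::nat. zorder f \<xi> = int (l * (elliptic_index \<Gamma> \<xi> - 1) + elliptic_index \<Gamma> \<xi> * k))"
proof -
  define e where "e = elliptic_index \<Gamma> \<xi>"
  have e: "e > 0" using rotations_eq(2)[OF \<xi>] by (simp add: e_def)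
  obtain V s r where c: "(V, s) \<in> interior_charts \<Gamma>" "r > 0" "\<xi> \<in> preim V"
    "\<And>z. z \<in> uhp \<Longrightarrow> norm (disc_coord \<xi> z) < r \<Longrightarrow> z \<in> preim V \<and> lift s z = disc_coord \<xi> z ^ e"
    unfolding e_def by (rule interior_chart_exists[OF \<xi>]) blast
  have ch: "(V, s) \<in> surface_atlas \<Gamma>" using c(1) by (simp add: surface_atlas_def)
  have s0: "s (quot_map \<Gamma> \<xi>) = 0" using c(4)[OF \<xi>] c(2) e by (simp add: lift_def)
  have ne: "\<xi> - cnj \<xi> \<noteq> 0" using \<xi> by (auto simp: uhp_def complex_eq_iff)
  define C where "C z = 1 / (z - cnj \<xi>)" for z
  define B where "B z = (of_nat e * C z ^ (e - 1) * ((\<xi> - cnj \<xi>) / (z - cnj \<xi>)\<^sup>2)) ^ l" for z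
  have Chol: "C holomorphic_on uhp" unfolding C_def
    using uhp_minus_cnj_nonzero[OF _ \<xi>] by (intro holomorphic_intros) auto
  have Cnz: "C z \<noteq> 0" if "z \<in> uhp" for z using uhp_minus_cnj_nonzero[OF that \<xi>] by (simp add: C_def)
  have Bhol: "B holomorphic_on uhp" unfolding B_def
    using uhp_minus_cnj_nonzero[OF _ \<xi>] by (intro holomorphic_intros Chol) auto
  have Bnz: "B z \<noteq> 0" if "z \<in> uhp" for z
    using uhp_minus_cnj_nonzero[OF that \<xi>] ne e Cnz[OF that] by (simp add: B_def)
  have wC: "disc_coord \<xi> z = (z - \<xi>) * C z" for z by (simp add: disc_coord_def C_def)
  have pull: "f z = \<phi> (V, s) (disc_coord \<xi> z ^ e) * ((z - \<xi>) ^ (l * (e - 1)) * B z)"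
    if z: "z \<in> uhp" "norm (disc_coord \<xi> z) < r" "z \<noteq> \<xi>" and pb: "pulls_back_off_centre l \<phi> f" for z \<phi>
  proof -
    have zV: "z \<in> preim V" "lift s z = disc_coord \<xi> z ^ e" using c(4)[OF z(1,2)] by auto
    have "\<forall>\<^sub>F w in nhds z. w \<in> {z \<in> uhp. norm (disc_coord \<xi> z) < r}"
      using z by (intro eventually_nhds_in_open open_disc \<xi>) auto
    then have "\<forall>\<^sub>F w in nhds z. lift s w = disc_coord \<xi> w ^ e"
      by eventually_elim (use c(4) in auto)
    then have "deriv (lift s) z = deriv (\<lambda>z. disc_coord \<xi> z ^ e) z" by (rule deriv_cong_ev) simp
    also have "\<dots> = (z - \<xi>) ^ (e - 1) * (of_nat e * C z ^ (e - 1) * ((\<xi> - cnj \<xi>) / (z - cnj \<xi>)\<^sup>2))"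
      by (subst branched_disc_coord_power(2)[OF \<xi> e z(1)]) (simp only: wC power_mult_distrib mult_ac)
    finally have "deriv (lift s) z ^ l = (z - \<xi>) ^ (l * (e - 1)) * B z"
      by (simp only: power_mult_distrib B_def power_mult mult.commute[of l])
    moreover have "lift s z \<noteq> 0" using z zV \<xi> by (simp add: disc_coord_eq_0_iff)
    ultimately show ?thesis using pulls_back_off_centreD[OF pb ch zV(1)] zV(2) by simp
  qed
  obtain g R where g: "g \<xi> \<noteq> 0" "R > 0" "cball \<xi> R \<subseteq> uhp" "g holomorphic_on cball \<xi> R"
    "\<And>w. w \<in> cball \<xi> R \<Longrightarrow> f w = g w * (w - \<xi>) ^ nat (zorder f \<xi>) \<and> g w \<noteq> 0"
    using zorder_exist_zero[OF hol open_uhp connected_uhp \<xi> nz] by (metis centre_in_cball less_eq_real_def)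
  show ?thesis
  proof (rule that[OF ch _ s0])
    show "quot_map \<Gamma> \<xi> \<in> V" using c(3) by (simp add: preim_def)
    fix \<phi> assume pb: "pulls_back_off_centre l \<phi> f" and nm: "\<phi> (V, s) nicely_meromorphic_on s ` V"
    show "\<phi> (V, s) analytic_on {0} \<longleftrightarrow> (\<exists>k::nat. zorder f \<xi> = int (l * (elliptic_index \<Gamma> \<xi> - 1) + elliptic_index \<Gamma> \<xi> * k))"
      unfolding e_def[symmetric]
    proof
      assume "\<phi> (V, s) analytic_on {0}"
      then obtain r1 where r1: "r1 > 0" "\<phi> (V, s) holomorphic_on ball 0 r1" by (auto simp: analytic_on_def)
      \<comment> \<open>So a bound for \<open>w\<close> serves for the chart coordinate as well.\<close>
      have small: "norm (disc_coord \<xi> z ^ e) \<le> norm (disc_coord \<xi> z)" if "z \<in> uhp" for z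
        using norm_disc_coord_less_1[OF that \<xi>] e power_decreasing[of 1 e "norm (disc_coord \<xi> z)"]
        by (simp add: norm_power)
      have "\<exists>u\<in>ball 0 r1. \<phi> (V, s) u \<noteq> 0"
      proof (rule ccontr)
        assume "\<not> ?thesis"
        then have 0: "\<phi> (V, s) u = 0" if "norm u < r1" for u using that by auto
        have "\<forall>\<^sub>F z in at \<xi>. z \<in> {z \<in> uhp. norm (disc_coord \<xi> z) < min r r1} - {\<xi>}"
          using \<xi> c(2) r1(1) by (intro eventually_at_in_open open_disc) auto
        moreover have "\<forall>\<^sub>F z in at \<xi>. z \<in> cball \<xi> R"
          using g(2) eventually_at_in_open'[of "ball \<xi> R" \<xi>] by (auto elim: eventually_mono)
        ultimately have "\<forall>\<^sub>F z in at \<xi>. False"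
        proof eventually_elim
          case (elim z)
          then have "f z = 0" using pull[OF _ _ _ pb, of z] 0[of "disc_coord \<xi> z ^ e"] small[of z] by auto
          moreover have "f z \<noteq> 0" using elim g(5)[of z] by auto
          ultimately show False by simp
        qed
        then show False by simp
      qed
      then obtain \<psi> r2 where \<psi>: "\<psi> 0 \<noteq> 0" "r2 > 0" "\<psi> holomorphic_on cball 0 r2"
        "\<And>u. u \<in> cball 0 r2 \<Longrightarrow> \<phi> (V, s) u = \<psi> u * (u - 0) ^ nat (zorder (\<phi> (V, s)) 0) \<and> \<psi> u \<noteq> 0"
        using zorder_exist_zero[OF r1(2) open_ball connected_ball _ , of 0] r1(1)
        by (metis centre_in_ball centre_in_cball less_eq_real_def)
      define k where "k = nat (zorder (\<phi> (V, s)) 0)"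
      define S where "S = {z \<in> uhp. norm (disc_coord \<xi> z) < min r r2}"
      define G where "G z = \<psi> (disc_coord \<xi> z ^ e) * (C z ^ (e * k) * B z)" for z
      have "zorder f \<xi> = int (l * (e - 1) + e * k)"
      proof (rule zorder_eqI)
        show "open S" unfolding S_def by (rule open_disc[OF \<xi>])
        show "\<xi> \<in> S" using \<xi> c(2) \<psi>(2) by (simp add: S_def)
        have sub: "S \<subseteq> uhp" by (auto simp: S_def)
        have "(\<lambda>z. disc_coord \<xi> z ^ e) holomorphic_on S"
          using holomorphic_on_subset[OF holomorphic_disc_coord[OF \<xi>] sub] by (intro holomorphic_intros)
        moreover have "(\<lambda>z. disc_coord \<xi> z ^ e) ` S \<subseteq> cball 0 r2"
          using small by (force simp: S_def)
        ultimately have "(\<psi> \<circ> (\<lambda>z. disc_coord \<xi> z ^ e)) holomorphic_on S"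
          by (rule holomorphic_on_compose_gen[OF _ \<psi>(3)])
        then have "(\<lambda>z. \<psi> (disc_coord \<xi> z ^ e)) holomorphic_on S" by (simp add: o_def)
        then show "G holomorphic_on S" unfolding G_def
          using holomorphic_on_subset[OF Chol sub] holomorphic_on_subset[OF Bhol sub] by (intro holomorphic_intros)
        show "G \<xi> \<noteq> 0" using \<psi>(1) e Cnz[OF \<xi>] Bnz[OF \<xi>] by (simp add: G_def zero_power)
        fix z assume z: "z \<in> S" "z \<noteq> \<xi>"
        then have zu: "z \<in> uhp" "norm (disc_coord \<xi> z) < r" by (auto simp: S_def)
        have "disc_coord \<xi> z ^ e \<in> cball 0 r2" using small[OF zu(1)] z by (auto simp: S_def)
        then have "f z = \<psi> (disc_coord \<xi> z ^ e) * (disc_coord \<xi> z ^ e) ^ k * ((z - \<xi>) ^ (l * (e - 1)) * B z)"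
          using pull[OF zu z(2) pb] \<psi>(4) by (simp add: k_def)
        also have "(disc_coord \<xi> z ^ e) ^ k = (z - \<xi>) ^ (e * k) * C z ^ (e * k)"
          unfolding power_mult[symmetric] wC by (rule power_mult_distrib)
        finally show "f z = G z * (z - \<xi>) powi int (l * (e - 1) + e * k)"
          by (simp only: power_int_of_nat power_add G_def mult_ac)
      qed
      then show "\<exists>k::nat. zorder f \<xi> = int (l * (e - 1) + e * k)" by blast
    next
      assume "\<exists>k::nat. zorder f \<xi> = int (l * (e - 1) + e * k)"
      then obtain k where k: "nat (zorder f \<xi>) = l * (e - 1) + e * k" by (metis nat_int)
      have "isCont g \<xi>" "isCont B \<xi>"
        using g(2,4) holomorphic_on_subset[of g "cball \<xi> R" "ball \<xi> R"] Bhol \<xi>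
        by (meson ball_subset_cball centre_in_ball continuous_on_eq_continuous_at holomorphic_on_imp_continuous_on open_ball open_uhp)+
      then have "((\<lambda>z. g z * (z - \<xi>) ^ (e * k) / B z) \<longlongrightarrow> g \<xi> * (\<xi> - \<xi>) ^ (e * k) / B \<xi>) (at \<xi>)"
        using Bnz[OF \<xi>] by (intro tendsto_intros) (auto simp: isCont_def)
      moreover have "\<forall>\<^sub>F z in at \<xi>. g z * (z - \<xi>) ^ (e * k) / B z = \<phi> (V, s) (disc_coord \<xi> z ^ e)"
      proof -
        have "\<forall>\<^sub>F z in at \<xi>. z \<in> {z \<in> uhp. norm (disc_coord \<xi> z) < r} - {\<xi>}"
          using \<xi> c(2) by (intro eventually_at_in_open open_disc) auto
        moreover have "\<forall>\<^sub>F z in at \<xi>. z \<in> cball \<xi> R"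
          using g(2) eventually_at_in_open'[of "ball \<xi> R" \<xi>] by (auto elim: eventually_mono)
        ultimately show ?thesis
        proof eventually_elim
          case (elim z)
          then have "g z * (z - \<xi>) ^ (l * (e - 1) + e * k) = \<phi> (V, s) (disc_coord \<xi> z ^ e) * ((z - \<xi>) ^ (l * (e - 1)) * B z)"
            using pull[OF _ _ _ pb, of z] g(5)[of z] k by auto
          then have "(z - \<xi>) ^ (l * (e - 1)) * (g z * (z - \<xi>) ^ (e * k)) = (z - \<xi>) ^ (l * (e - 1)) * (\<phi> (V, s) (disc_coord \<xi> z ^ e) * B z)"
            by (simp only: power_add mult_ac)
          then have "g z * (z - \<xi>) ^ (e * k) = \<phi> (V, s) (disc_coord \<xi> z ^ e) * B z"
            using elim by simp
          then show ?case using Bnz[of z] elim by (simp add: field_simps)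
        qed
      qed
      ultimately have lim: "((\<lambda>z. \<phi> (V, s) (disc_coord \<xi> z ^ e)) \<longlongrightarrow> g \<xi> * (\<xi> - \<xi>) ^ (e * k) / B \<xi>) (at \<xi>)"
        by (rule Lim_transform_eventually)
      have "isCont (disc_coord \<xi>) \<xi>" using has_field_derivative_disc_coord[OF \<xi> \<xi>] DERIV_isCont by blast
      then have "((\<lambda>z. disc_coord \<xi> z ^ e) \<longlongrightarrow> disc_coord \<xi> \<xi> ^ e) (at \<xi>)"
        by (intro tendsto_power) (simp add: isCont_def)
      then have "((\<lambda>z. disc_coord \<xi> z ^ e) \<longlongrightarrow> 0) (at \<xi>)" using e by (simp add: zero_power)
      moreover have "\<forall>\<^sub>F z in at \<xi>. disc_coord \<xi> z ^ e \<noteq> 0"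
        using branched_disc_coord_power(1)[OF \<xi> e] \<xi> by (auto simp: branched_over_0_def)
      ultimately have "filterlim (\<lambda>z. disc_coord \<xi> z ^ e) (at 0) (at \<xi>)" by (simp add: filterlim_at)
      then have "\<not> is_pole (\<phi> (V, s)) 0"
        unfolding is_pole_def using not_tendsto_and_filterlim_at_infinity[OF _ lim] filterlim_compose by fastforce
      moreover have "0 \<in> s ` V" using c(3) s0 by (force simp: preim_def)
      ultimately show "\<phi> (V, s) analytic_on {0}" using nicely_meromorphic_on_imp_analytic_at[OF nm] by blast
    qed
  qed
qed

lemma atlas_points:
  assumes "(U, t) \<in> surface_atlas \<Gamma>"
  shows "U \<subseteq> quot_map \<Gamma> ` uhp \<union> cusp_points \<Gamma>"
proof (cases "(U, t) \<in> interior_charts \<Gamma>")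
  case True
  then show ?thesis using coordinate_chart_interior(2) by blast
next
  case False
  then have "(U, t) \<in> cusp_charts \<Gamma>" using assms by (simp add: surface_atlas_def)
  then show ?thesis by (rule cusp_chartE) (auto simp: cusp_points_def)
qed

text \<open>By the transition law, holomorphy at a point can be tested in a single chart. This allows the choice of a
chart centred at a prescribed representative or adapted to a prescribed frame.\<close>

lemma holomorphic_differential_if_local:
  assumes \<phi>: "\<phi> \<in> meromorphic_differentials (surface_atlas \<Gamma>) l"
    and loc: "\<And>p. p \<in> quot_map \<Gamma> ` uhp \<union> cusp_points \<Gamma> \<Longrightarrow>
      \<exists>V s. (V, s) \<in> surface_atlas \<Gamma> \<and> p \<in> V \<and> \<phi> (V, s) analytic_on {s p}"
  shows "\<phi> \<in> holomorphic_differentials (surface_atlas \<Gamma>) l"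
proof -
  have "\<phi> (U, t) holomorphic_on t ` U" if ch: "(U, t) \<in> surface_atlas \<Gamma>" for U t
  proof -
    have "\<phi> (U, t) analytic_on {t p}" if p: "p \<in> U" for p
    proof -
      obtain V s where V: "(V, s) \<in> surface_atlas \<Gamma>" "p \<in> V" "\<phi> (V, s) analytic_on {s p}"
        using loc[of p] atlas_points[OF ch] p by blast
      let ?F = "s \<circ> inv_into U t"
      obtain N where N: "open N" "t p \<in> N" "N \<subseteq> t ` (U \<inter> V)" "?F holomorphic_on N"
        using transition_holomorphic[OF ch V(1), of p] p V(2) by (metis IntI)
      have F: "?F (t q) = s q" if "q \<in> U" for q using atlas_branched(8)[OF ch] that by simp
      have an: "?F analytic_on {t p}" "deriv ?F analytic_on {t p}"
        using N holomorphic_deriv[OF N(4,1)] by (auto simp: analytic_at)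
      have "(\<phi> (V, s) \<circ> ?F) analytic_on {t p}"
        using an(1) V(3) F[OF p] by (intro analytic_on_compose) simp_all
      then have "(\<lambda>v. (\<phi> (V, s) \<circ> ?F) v * deriv ?F v ^ l) analytic_on {t p}"
        by (intro analytic_on_mult analytic_on_power an)
      moreover have "\<forall>\<^sub>F v in nhds (t p). (\<phi> (V, s) \<circ> ?F) v * deriv ?F v ^ l = \<phi> (U, t) v"
        using eventually_nhds_in_open[OF N(1,2)]
      proof eventually_elim
        case (elim v)
        then obtain q where "q \<in> U" "q \<in> V" "v = t q" using N(3) by auto
        then show ?case
          using meromorphic_differentialD(4)[OF \<phi> ch V(1), of q] F[of q] by (simp del: o_apply add: o_apply[of "\<phi> _"])
      qed
      ultimately show ?thesis by (rule analytic_at_cong[OF _ refl, THEN iffD1, rotated])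
    qed
    then have "\<phi> (U, t) analytic_on t ` U" by (subst analytic_on_analytic_at) auto
    then show ?thesis by (rule analytic_imp_holomorphic)
  qed
  then show ?thesis using \<phi> by (auto simp: holomorphic_differentials_def)
qed

lemma holomorphic_differential_analytic:
  assumes "\<phi> \<in> holomorphic_differentials (surface_atlas \<Gamma>) l" "(U, t) \<in> surface_atlas \<Gamma>" "p \<in> U"
  shows "\<phi> (U, t) analytic_on {t p}"
proof -
  have "\<phi> (U, t) holomorphic_on t ` U" using assms by (auto simp: holomorphic_differentials_def)
  then show ?thesis using atlas_branched(6)[OF assms(2)] assms(3) by (auto simp: analytic_at)
qed


section \<open>The form of a holomorphic differential\<close>

lemma chart_at:
  assumes "z \<in> uhp"
  obtains U t where "(U, t) \<in> surface_atlas \<Gamma>" "z \<in> preim U"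
  using interior_chart_exists[OF assms] by (metis UnI1 surface_atlas_def)

text \<open>The pull-back does not depend on the chart, by the transition law, and it is automorphic by the
chain rule. Its expansion at a cusp comes from descending it to the punctured unit disc; near the
cusp the resulting function is a constant times \<open>u\<^sup>l \<phi>(u)\<close>, which is holomorphic with a zero at the cusp.\<close>

lemma form_of_holomorphic_differential:
  assumes \<phi>: "\<phi> \<in> holomorphic_differentials (surface_atlas \<Gamma>) l" and l: "l > 0"
  obtains f where "f \<in> cusp_forms \<Gamma> (2 * l)" "pulls_back_off_centre l \<phi> f"
proof -
  have mero: "\<phi> \<in> meromorphic_differentials (surface_atlas \<Gamma>) l"
    and hol: "\<And>U t. (U, t) \<in> surface_atlas \<Gamma> \<Longrightarrow> \<phi> (U, t) holomorphic_on t ` U"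
    using \<phi> by (auto simp: holomorphic_differentials_def)
  define chart where "chart z = (SOME c. c \<in> surface_atlas \<Gamma> \<and> z \<in> preim (fst c))" for z
  define f where "f z = (if z \<in> uhp then \<phi> (chart z) (lift (snd (chart z)) z) * deriv (lift (snd (chart z))) z ^ l else 0)" for z
  have f: "f z = \<phi> (V, s) (lift s z) * deriv (lift s) z ^ l" if ch: "(V, s) \<in> surface_atlas \<Gamma>" and z: "z \<in> preim V" for V s z
  proof -
    have zu: "z \<in> uhp" using z by (simp add: preim_def)
    obtain U0 t0 where "(U0, t0) \<in> surface_atlas \<Gamma>" "z \<in> preim U0" by (rule chart_at[OF zu])
    then have "chart z \<in> surface_atlas \<Gamma> \<and> z \<in> preim (fst (chart z))"
      unfolding chart_def by (intro someI[of "\<lambda>c. c \<in> surface_atlas \<Gamma> \<and> z \<in> preim (fst c)" "(U0, t0)"]) simp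
    moreover obtain U t where Ut: "chart z = (U, t)" by (cases "chart z")
    ultimately have chU: "(U, t) \<in> surface_atlas \<Gamma>" and zU: "z \<in> preim U" by auto
    let ?p = "quot_map \<Gamma> z"
    have p: "?p \<in> U" "?p \<in> V" using z zU by (auto simp: preim_def)
    obtain N where N: "open N" "t ?p \<in> N" "(s \<circ> inv_into U t) holomorphic_on N"
      using transition_holomorphic[OF chU ch, of ?p] p by (metis IntI)
    have "lift t z \<in> N" using N(2) by (simp add: lift_def)
    note tr = deriv_lift_transition[OF chU ch N(1,3) this zU z]
    have "f z = \<phi> (U, t) (lift t z) * deriv (lift t) z ^ l" using zu by (simp add: f_def Ut)
    also have "\<phi> (U, t) (lift t z) = \<phi> (V, s) (lift s z) * deriv (s \<circ> inv_into U t) (lift t z) ^ l"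
      using meromorphic_differentialD(4)[OF mero chU ch p] by (simp add: lift_def)
    finally show ?thesis by (simp only: tr(2) power_mult_distrib mult.assoc)
  qed
  have pb: "pulls_back_off_centre l \<phi> f" using f by (auto simp: pulls_back_off_centre_def)
  have "f field_differentiable at z" if z: "z \<in> uhp" for z
  proof -
    obtain U t where ch: "(U, t) \<in> surface_atlas \<Gamma>" "z \<in> preim U" by (rule chart_at[OF z])
    note b = atlas_branched[OF ch(1)]
    have "(\<phi> (U, t) \<circ> lift t) holomorphic_on preim U"
      by (rule holomorphic_on_compose_gen[OF b(3) hol[OF ch(1)]]) (auto simp: lift_def preim_def)
    then have "(\<lambda>z. (\<phi> (U, t) \<circ> lift t) z * deriv (lift t) z ^ l) holomorphic_on preim U"
      by (intro holomorphic_on_mult holomorphic_on_power holomorphic_deriv b)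
    then have "f holomorphic_on preim U"
      by (rule holomorphic_transform) (simp add: f[OF ch(1)])
    then show ?thesis using b(2) ch(2) holomorphic_on_imp_differentiable_at by blast
  qed
  then have fhol: "f holomorphic_on uhp" by (auto simp: holomorphic_on_def intro: field_differentiable_at_within)
  have aut: "f (mob g z) = autf g z ^ (2 * l) * f z" if g: "g \<in> \<Gamma>" and z: "z \<in> uhp" for g z
  proof -
    obtain U t where ch: "(U, t) \<in> surface_atlas \<Gamma>" "z \<in> preim U" by (rule chart_at[OF z])
    show ?thesis
      using f[OF ch] f[OF ch(1) preim_mob[OF ch(2) g]] deriv_lift_mob[OF atlas_branched(1)[OF ch(1)] ch(2) g] lift_mob[OF z g]
      by (simp add: power_mult_distrib power_mult)
  qed
  have cusp: "\<exists>\<sigma> h a. cusp_frame \<Gamma> x \<sigma> h \<and> fourier_expansion (2 * l) f \<sigma> h a \<and> a 0 = 0" if x: "x \<in> cusps \<Gamma>" for x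
  proof -
    obtain \<sigma> h where frame: "cusp_frame \<Gamma> x \<sigma> h" by (rule cusp_frame_exists[OF x])
    note d = cusp_frameD[OF frame]
    obtain V s \<rho> where c: "(V, s) \<in> surface_atlas \<Gamma>" "orb \<Gamma> x \<in> V" "s (orb \<Gamma> x) = 0" "0 < \<rho>" "\<rho> \<le> 1"
      "ball 0 \<rho> \<subseteq> s ` V"
      and rel: "\<And>z l \<phi> f. z \<in> uhp \<Longrightarrow> norm (cusp_coord \<sigma> h z) < \<rho> \<Longrightarrow> pulls_back_off_centre l \<phi> f \<Longrightarrow>
         f z * autf \<sigma> z ^ (2 * l) = \<phi> (V, s) (cusp_coord \<sigma> h z) * (2 * of_real pi * \<i> / of_real h * cusp_coord \<sigma> h z) ^ l"
      by (rule cusp_chart_at[OF x frame]) blast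
    define S where "S z = f z * autf \<sigma> z ^ (2 * l)" for z
    have "(\<lambda>z. autf \<sigma> z ^ (2 * l)) holomorphic_on uhp" unfolding autf_def by (intro holomorphic_intros)
    then have Shol: "S holomorphic_on uhp" unfolding S_def by (intro holomorphic_on_mult fhol)
    have Sfib: "S z = S z'" if z: "z \<in> uhp" "z' \<in> uhp" "cusp_coord \<sigma> h z = cusp_coord \<sigma> h z'" for z z'
    proof -
      obtain n where n: "mob \<sigma> z' = mob \<sigma> z + of_int n * of_real h" using cusp_coord_eqD[OF d(3) z(3)] by blast
      obtain g \<epsilon> where g: "g \<in> \<Gamma>" "\<epsilon> \<in> {1, -1::real}"
        "\<And>z. z \<in> uhp \<Longrightarrow> mob \<sigma> (mob g z) = mob \<sigma> z + of_int n * of_real h"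
        "\<And>z. z \<in> uhp \<Longrightarrow> autf \<sigma> (mob g z) * autf g z = of_real \<epsilon> * autf \<sigma> z"
        using translation_on_uhp[OF frame, of n] by metis
      have "mob \<sigma> (mob g z) = mob \<sigma> z'" using g(3)[OF z(1)] n by simp
      then have "z' = mob g z" using mob_inv(1)[OF d(1)] g(1) z by (metis det_1 mob_uhp)
      then have "S z' = f z * (autf \<sigma> (mob g z) * autf g z) ^ (2 * l)"
        using aut[OF g(1) z(1)] by (simp add: S_def power_mult_distrib)
      also have "\<dots> = S z" unfolding g(4)[OF z(1)] using g(2) by (auto simp: S_def power_mult_distrib power_mult)
      finally show ?thesis by simp
    qed
    obtain F where F: "F holomorphic_on cusp_coord \<sigma> h ` uhp" "\<And>z. z \<in> uhp \<Longrightarrow> F (cusp_coord \<sigma> h z) = S z"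
      using descend_holomorphic[OF branched_cusp_coord(1)[OF d(1,3)] Shol Sfib] by metis
    \<comment> \<open>\<open>F\<close> is unspecified at 0, which is not a value of the coordinate.\<close>
    define P where "P u = (if u = 0 then 0 else F u)" for u
    have sub: "ball 0 1 - {0} \<subseteq> cusp_coord \<sigma> h ` uhp"
    proof
      fix u :: complex assume "u \<in> ball 0 1 - {0}"
      then have "u \<noteq> 0" "norm u < 1" by auto
      then show "u \<in> cusp_coord \<sigma> h ` uhp" using cusp_coord_surj[OF d(1,3)] by (metis image_eqI)
    qed
    have "F holomorphic_on ball 0 1 - {0}" by (rule holomorphic_on_subset[OF F(1) sub])
    then have P1: "P holomorphic_on ball 0 1 - {0}" by (rule holomorphic_transform) (auto simp: P_def)
    have "\<phi> (V, s) holomorphic_on ball 0 \<rho>" by (rule holomorphic_on_subset[OF hol[OF c(1)] c(6)])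
    then have "(\<lambda>u. \<phi> (V, s) u * (2 * of_real pi * \<i> / of_real h * u) ^ l) holomorphic_on ball 0 \<rho>"
      by (intro holomorphic_on_mult holomorphic_on_power holomorphic_on_const holomorphic_on_ident)
    then have P2: "P holomorphic_on ball 0 \<rho>"
    proof (rule holomorphic_transform)
      fix u :: complex assume u: "u \<in> ball 0 \<rho>"
      show "\<phi> (V, s) u * (2 * of_real pi * \<i> / of_real h * u) ^ l = P u"
      proof (cases "u = 0")
        case True
        then show ?thesis using l by (simp add: P_def zero_power)
      next
        case False
        have "norm u < 1" using u c(5) by simp
        then obtain z where z: "z \<in> uhp" "cusp_coord \<sigma> h z = u" using cusp_coord_surj[OF d(1,3) False] by blast
        show ?thesis using rel[OF z(1) _ pb] F(2)[OF z(1)] u False by (simp add: z(2) S_def P_def)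
      qed
    qed
    have "P holomorphic_on (ball 0 1 - {0}) \<union> ball 0 \<rho>"
      by (intro holomorphic_on_Un P1 P2) auto
    moreover have "(ball 0 1 - {0}) \<union> ball 0 \<rho> = ball (0::complex) 1" using c(4,5) by auto
    ultimately have Phol: "P holomorphic_on ball 0 1" by simp
    define a where "a n = (deriv ^^ n) P 0 / fact n" for n
    have "fourier_expansion (2 * l) f \<sigma> h a"
      unfolding fourier_expansion_iff[OF d(1)]
    proof
      fix z assume z: "z \<in> uhp"
      have "norm (cusp_coord \<sigma> h z) < 1"
        using norm_cusp_coord_less[OF d(3), of \<sigma> z 0] mob_uhp[OF d(1) z] by (simp add: uhp_def)
      then have "(\<lambda>n. a n * cusp_coord \<sigma> h z ^ n) sums P (cusp_coord \<sigma> h z)"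
        using holomorphic_power_series[OF Phol, of "cusp_coord \<sigma> h z"] by (simp add: a_def)
      then show "(\<lambda>n. a n * cusp_coord \<sigma> h z ^ n) sums (f z * autf \<sigma> z ^ (2 * l))"
        using F(2)[OF z] by (simp add: P_def S_def)
    qed
    moreover have "a 0 = 0" by (simp add: a_def P_def)
    ultimately show ?thesis using frame by blast
  qed
  have "f \<in> cusp_forms \<Gamma> (2 * l)"
    unfolding cusp_forms_def modular_forms_def using fhol aut cusp by (auto simp: f_def) blast+
  then show ?thesis using pb that by blast
qed

end

lemma cusp_forms_modular: "f \<in> cusp_forms \<Gamma> m \<Longrightarrow> f \<in> modular_forms \<Gamma> m"
  by (simp add: cusp_forms_def)

lemma divisor_condition_iff:
  fixes \<nu> :: int and e l :: nat
  assumes e: "e > 0"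
  defines "x \<equiv> of_int \<nu> / of_nat e - of_nat l * (1 - 1 / of_nat e) :: rat"
  shows "x \<in> \<int> \<and> x \<ge> 0 \<longleftrightarrow> (\<exists>k::nat. \<nu> = int (l * (e - 1) + e * k))"
proof -
  have eq: "x = of_nat k \<longleftrightarrow> \<nu> = int (l * (e - 1) + e * k)" for k :: nat
  proof -
    have "x = of_nat k \<longleftrightarrow> of_int \<nu> = (of_nat l * (of_nat e - 1) + of_nat e * of_nat k :: rat)"
      using e by (simp add: x_def field_simps)
    also have "\<dots> \<longleftrightarrow> of_int \<nu> = (of_int (int (l * (e - 1) + e * k)) :: rat)"
      using e by (simp add: of_nat_diff)
    also have "\<dots> \<longleftrightarrow> \<nu> = int (l * (e - 1) + e * k)" by (rule of_int_eq_iff)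
    finally show ?thesis .
  qed
  have "x \<in> \<int> \<and> x \<ge> 0 \<longleftrightarrow> (\<exists>k::nat. x = of_nat k)"
  proof
    assume "x \<in> \<int> \<and> x \<ge> 0"
    then obtain i where "x = of_int i" "i \<ge> 0" by (auto elim: Ints_cases)
    then show "\<exists>k::nat. x = of_nat k" by (intro exI[of _ "nat i"]) simp
  qed auto
  then show ?thesis by (simp only: eq)
qed

section \<open>Divisors and the isomorphism\<close>

lemma module_scale_form: "module scale_form"
  by standard (auto simp: scale_form_def fun_eq_iff algebra_simps)

lemma module_scale_mdiff: "module (scale_mdiff :: complex \<Rightarrow> 'a mdiff \<Rightarrow> 'a mdiff)"
  by standard (auto simp: scale_mdiff_def fun_eq_iff algebra_simps)

context discrete_SL2_subgroup
begin

lemma cusp_form_any_frame: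
  assumes f: "f \<in> cusp_forms \<Gamma> m" and frame: "cusp_frame \<Gamma> x \<sigma> h" and x: "x \<in> cusps \<Gamma>"
  obtains a where "fourier_expansion m f \<sigma> h a" "a 0 = 0"
proof -
  obtain \<sigma>' h' a' where "cusp_frame \<Gamma> x \<sigma>' h'" "fourier_expansion m f \<sigma>' h' a'" "a' 0 = 0"
    using f x unfolding cusp_forms_def by blast
  moreover have "f (mob g z) = autf g z ^ m * f z" if "g \<in> \<Gamma>" "z \<in> uhp" for g z
    using modular_forms_automorphic[OF cusp_forms_modular[OF f]] that by (simp add: automorphic_def)
  ultimately show ?thesis
    using fourier_expansion_change_of_frame[OF frame _ refl] that by metis
qed

lemma cusp_formsI:
  assumes "automorphic m f" "\<And>z. z \<notin> uhp \<Longrightarrow> f z = 0"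
    "\<And>x \<sigma> h. x \<in> cusps \<Gamma> \<Longrightarrow> cusp_frame \<Gamma> x \<sigma> h \<Longrightarrow> \<exists>a. fourier_expansion m f \<sigma> h a \<and> a 0 = 0"
  shows "f \<in> cusp_forms \<Gamma> m"
proof -
  have "\<exists>\<sigma> h a. cusp_frame \<Gamma> x \<sigma> h \<and> fourier_expansion m f \<sigma> h a \<and> a 0 = 0" if "x \<in> cusps \<Gamma>" for x
    using cusp_frame_exists[OF that] assms(3)[OF that] by metis
  then show ?thesis
    using assms(1,2) unfolding cusp_forms_def modular_forms_def automorphic_def by blast
qed

lemma cusp_forms_zero: "(0 :: complex \<Rightarrow> complex) \<in> cusp_forms \<Gamma> m"
  by (rule cusp_formsI)
     (auto simp: automorphic_def fourier_expansion_def slash_def zero_fun_def intro!: exI[of _ "\<lambda>_. 0"])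

lemma cusp_forms_add:
  assumes f: "f \<in> cusp_forms \<Gamma> m" and g: "g \<in> cusp_forms \<Gamma> m"
  shows "f + g \<in> cusp_forms \<Gamma> m"
proof (rule cusp_formsI)
  show "automorphic m (f + g)"
    using modular_forms_automorphic[OF cusp_forms_modular[OF f]] modular_forms_automorphic[OF cusp_forms_modular[OF g]]
    by (auto simp: automorphic_def plus_fun_def algebra_simps intro!: holomorphic_intros)
  show "(f + g) z = 0" if "z \<notin> uhp" for z
    using cusp_forms_modular[OF f] cusp_forms_modular[OF g] that by (simp add: modular_forms_def)
  fix x \<sigma> h assume x: "x \<in> cusps \<Gamma>" and frame: "cusp_frame \<Gamma> x \<sigma> h"
  note d = cusp_frameD[OF frame]
  obtain a where a: "fourier_expansion m f \<sigma> h a" "a 0 = 0" by (rule cusp_form_any_frame[OF f frame x])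
  obtain b where b: "fourier_expansion m g \<sigma> h b" "b 0 = 0" by (rule cusp_form_any_frame[OF g frame x])
  have "fourier_expansion m (f + g) \<sigma> h (\<lambda>n. a n + b n)"
    using a(1) b(1) unfolding fourier_expansion_iff[OF d(1)] by (auto simp: algebra_simps intro!: sums_add)
  then show "\<exists>a. fourier_expansion m (f + g) \<sigma> h a \<and> a 0 = 0" using a b by auto
qed

lemma cusp_forms_scale:
  assumes f: "f \<in> cusp_forms \<Gamma> m"
  shows "scale_form c f \<in> cusp_forms \<Gamma> m"
proof (rule cusp_formsI)
  show "automorphic m (scale_form c f)"
    using modular_forms_automorphic[OF cusp_forms_modular[OF f]]
    by (auto simp: automorphic_def scale_form_def algebra_simps intro!: holomorphic_intros)
  show "scale_form c f z = 0" if "z \<notin> uhp" for z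
    using cusp_forms_modular[OF f] that by (simp add: modular_forms_def scale_form_def)
  fix x \<sigma> h assume x: "x \<in> cusps \<Gamma>" and frame: "cusp_frame \<Gamma> x \<sigma> h"
  note d = cusp_frameD[OF frame]
  obtain a where a: "fourier_expansion m f \<sigma> h a" "a 0 = 0" by (rule cusp_form_any_frame[OF f frame x])
  have "fourier_expansion m (scale_form c f) \<sigma> h (\<lambda>n. c * a n)"
    using a(1) unfolding fourier_expansion_iff[OF d(1)]
    by (auto simp: scale_form_def mult.assoc intro!: sums_mult)
  then show "\<exists>a. fourier_expansion m (scale_form c f) \<sigma> h a \<and> a 0 = 0" using a by auto
qed

lemma representative:
  assumes "a \<in> quot_map \<Gamma> ` uhp"
  shows "representative \<Gamma> a \<in> uhp" "quot_map \<Gamma> (representative \<Gamma> a) = a"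
  using assms someI_ex[of "\<lambda>\<xi>. \<xi> \<in> uhp \<and> quot_map \<Gamma> \<xi> = a"] by (auto simp: representative_def)

text \<open>One side refers to any representative of the point, the other to the chosen one; the index is the
same for both.\<close>

lemma elliptic_points_iff:
  assumes "a \<in> quot_map \<Gamma> ` uhp"
  shows "a \<in> elliptic_points \<Gamma> \<longleftrightarrow> point_index \<Gamma> a > 1"
proof
  assume "a \<in> elliptic_points \<Gamma>"
  then obtain \<xi> where \<xi>: "\<xi> \<in> uhp" "elliptic_index \<Gamma> \<xi> > 1" "a = quot_map \<Gamma> \<xi>" by (auto simp: elliptic_points_def)
  then obtain g where "g \<in> \<Gamma>" "representative \<Gamma> a = mob g \<xi>"
    using quot_map_eqE[of \<xi> "representative \<Gamma> a"] representative(2)[OF assms] by metis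
  then show "point_index \<Gamma> a > 1" using \<xi> by (simp add: point_index_def elliptic_index_mob)
next
  assume "point_index \<Gamma> a > 1"
  then show "a \<in> elliptic_points \<Gamma>"
    using representative[OF assms] unfolding elliptic_points_def point_index_def by force
qed

text \<open>At an elliptic point the integral parts in the definitions of \<open>\<cc>\<^sub>f\<close> and of the lower bound
cancel, and \<open>\<nu>/e - l (1 - 1/e)\<close> remains; at the other interior points \<open>l (1 - 1/e) = 0\<close>, so the same formula
holds. At a cusp the contributions 1 and \<open>l - 1\<close> add up to \<open>l\<close>.\<close>

lemma divisor_ge_iff:
  "divisor_ge (c_div \<Gamma> (2 * l) f)
     (divisor_sum (elliptic_points \<Gamma>) (\<lambda>a. of_int \<lfloor>ell_coeff \<Gamma> (2 * l) a\<rfloor>) +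
      divisor_sum (cusp_points \<Gamma>) (\<lambda>_. of_nat (2 * l) / 2 - 1)) \<longleftrightarrow>
   (\<forall>b\<in>cusp_points \<Gamma>. cusp_order \<Gamma> (2 * l) f b \<ge> l) \<and>
   (\<forall>a\<in>quot_map \<Gamma> ` uhp. \<exists>k::nat. zorder f (representative \<Gamma> a) =
      int (l * (point_index \<Gamma> a - 1) + point_index \<Gamma> a * k))"
proof -
  define D where "D = c_div \<Gamma> (2 * l) f -
    (divisor_sum (elliptic_points \<Gamma>) (\<lambda>a. of_int \<lfloor>ell_coeff \<Gamma> (2 * l) a\<rfloor>) +
      divisor_sum (cusp_points \<Gamma>) (\<lambda>_. of_nat (2 * l) / 2 - 1))"
  have sp: "surface_points \<Gamma> = quot_map \<Gamma> ` uhp \<union> cusp_points \<Gamma>"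
    by (auto simp: surface_points_def cusp_points_def quot_map_def)
  have disj: "a \<notin> cusp_points \<Gamma>" if "a \<in> quot_map \<Gamma> ` uhp" for a
    using that cusp_orbit_not_interior by (auto simp: cusp_points_def)
  have ell: "a \<in> quot_map \<Gamma> ` uhp" if "a \<in> elliptic_points \<Gamma>" for a
    using that by (auto simp: elliptic_points_def)
  have Dcusp: "D b = of_nat (cusp_order \<Gamma> (2 * l) f b) - of_nat l" if "b \<in> cusp_points \<Gamma>" for b
    using that disj ell by (auto simp: D_def c_div_def c'_div_def div_form_def divisor_sum_def sp)
  have Dint: "D a = of_int (zorder f (representative \<Gamma> a)) / of_nat (point_index \<Gamma> a) - of_nat l * (1 - 1 / of_nat (point_index \<Gamma> a))"
    if a: "a \<in> quot_map \<Gamma> ` uhp" for a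
  proof (cases "a \<in> elliptic_points \<Gamma>")
    case True
    then show ?thesis using disj[OF a] a
      by (simp add: D_def c_div_def c'_div_def div_form_def divisor_sum_def sp interior_order_def ell_coeff_def)
  next
    case False
    then have "point_index \<Gamma> a = 1"
      using elliptic_points_iff[OF a] rotations_eq(2)[OF representative(1)[OF a]] by (simp add: point_index_def)
    then show ?thesis using disj[OF a] a False
      by (simp add: D_def c_div_def c'_div_def div_form_def divisor_sum_def sp interior_order_def)
  qed
  have Dout: "D a = 0" if "a \<notin> surface_points \<Gamma>" for a
    using that ell by (auto simp: D_def c_div_def c'_div_def div_form_def divisor_sum_def sp)
  have cuspiff: "D b \<in> \<int> \<and> D b \<ge> 0 \<longleftrightarrow> cusp_order \<Gamma> (2 * l) f b \<ge> l" if "b \<in> cusp_points \<Gamma>" for b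
    unfolding Dcusp[OF that] by simp
  have intiff: "D a \<in> \<int> \<and> D a \<ge> 0 \<longleftrightarrow> (\<exists>k::nat. zorder f (representative \<Gamma> a) = int (l * (point_index \<Gamma> a - 1) + point_index \<Gamma> a * k))"
    if "a \<in> quot_map \<Gamma> ` uhp" for a
    unfolding Dint[OF that]
    by (rule divisor_condition_iff) (use rotations_eq(2)[OF representative(1)[OF that]] in \<open>simp add: point_index_def\<close>)
  have "(\<forall>a. D a \<in> \<int> \<and> D a \<ge> 0) \<longleftrightarrow>
    (\<forall>b\<in>cusp_points \<Gamma>. D b \<in> \<int> \<and> D b \<ge> 0) \<and> (\<forall>a\<in>quot_map \<Gamma> ` uhp. D a \<in> \<int> \<and> D a \<ge> 0)"
    using Dout unfolding sp by (metis Ints_0 UnE order_refl)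
  then show ?thesis unfolding divisor_ge_def D_def[symmetric] by (simp only: cuspiff intiff cong: ball_cong)
qed

lemma zero_differential:
  "(0 :: csphere set mdiff) \<in> holomorphic_differentials (surface_atlas \<Gamma>) l" if "l > 0"
  using that by (auto simp: holomorphic_differentials_def meromorphic_differentials_def zero_fun_def)

lemma form_differential_zero:
  assumes "l > 0"
  shows "form_differential \<Gamma> (2 * l) 0 = 0"
  using zero_differential[OF assms] assms
  by (intro form_differential_eqI) (auto simp: holomorphic_differentials_def pulls_back_to_def zero_power)

text \<open>The divisor condition is compared with the absence of poles in charts centred at the
chosen representatives and in frames at the cusps. The order at a cusp is a minimum over all frames and expansions,
which is harmless since the first \<open>l\<close> coefficients vanish in all of them as soon as the differential is
holomorphic.\<close>

lemma SH_forms_iff: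
  assumes f: "f \<in> cusp_forms \<Gamma> (2 * l)" and l: "l > 0"
  shows "f \<in> SH_forms \<Gamma> (2 * l) \<longleftrightarrow> form_differential \<Gamma> (2 * l) f \<in> holomorphic_differentials (surface_atlas \<Gamma>) l"
proof (cases "f = 0")
  case True
  then show ?thesis using f zero_differential[OF l] form_differential_zero[OF l] by (simp add: SH_forms_def)
next
  case False
  note fm = cusp_forms_modular[OF f]
  define \<phi> where "\<phi> = form_differential \<Gamma> (2 * l) f"
  have mero: "\<phi> \<in> meromorphic_differentials (surface_atlas \<Gamma>) l" and pb: "pulls_back_off_centre l \<phi> f"
    using form_differential[OF fm] by (auto simp: \<phi>_def)
  note nm = meromorphic_differentialD(2)[OF mero]
  have fhol: "f holomorphic_on uhp" using fm by (simp add: modular_forms_def)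
  have aut: "f (mob g z) = autf g z ^ (2 * l) * f z" if "g \<in> \<Gamma>" "z \<in> uhp" for g z
    using modular_forms_automorphic[OF fm] that by (simp add: automorphic_def)
  have nz: "\<exists>z\<in>uhp. f z \<noteq> 0"
  proof (rule ccontr)
    assume "\<not> ?thesis"
    then have "f z = 0" for z using fm by (cases "z \<in> uhp") (auto simp: modular_forms_def)
    then show False using False by (auto simp: fun_eq_iff)
  qed
  have "f \<in> SH_forms \<Gamma> (2 * l) \<longleftrightarrow> (\<forall>b\<in>cusp_points \<Gamma>. cusp_order \<Gamma> (2 * l) f b \<ge> l) \<and>
     (\<forall>a\<in>quot_map \<Gamma> ` uhp. \<exists>k::nat. zorder f (representative \<Gamma> a) = int (l * (point_index \<Gamma> a - 1) + point_index \<Gamma> a * k))"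
    unfolding SH_forms_def mem_Collect_eq divisor_ge_iff using f False by simp
  also have "\<dots> \<longleftrightarrow> \<phi> \<in> holomorphic_differentials (surface_atlas \<Gamma>) l"
  proof (intro iffI conjI ballI)
    assume SH: "(\<forall>b\<in>cusp_points \<Gamma>. cusp_order \<Gamma> (2 * l) f b \<ge> l) \<and>
     (\<forall>a\<in>quot_map \<Gamma> ` uhp. \<exists>k::nat. zorder f (representative \<Gamma> a) = int (l * (point_index \<Gamma> a - 1) + point_index \<Gamma> a * k))"
    show "\<phi> \<in> holomorphic_differentials (surface_atlas \<Gamma>) l"
    proof (rule holomorphic_differential_if_local[OF mero])
      fix p assume "p \<in> quot_map \<Gamma> ` uhp \<union> cusp_points \<Gamma>"
      then show "\<exists>V s. (V, s) \<in> surface_atlas \<Gamma> \<and> p \<in> V \<and> \<phi> (V, s) analytic_on {s p}"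
      proof
        assume p: "p \<in> quot_map \<Gamma> ` uhp"
        note rep = representative[OF p]
        obtain V s where V: "(V, s) \<in> surface_atlas \<Gamma>" "p \<in> V" "s p = 0"
          "\<And>\<phi>. pulls_back_off_centre l \<phi> f \<Longrightarrow> \<phi> (V, s) nicely_meromorphic_on s ` V \<Longrightarrow>
             \<phi> (V, s) analytic_on {0} \<longleftrightarrow> (\<exists>k::nat. zorder f (representative \<Gamma> p) = int (l * (point_index \<Gamma> p - 1) + point_index \<Gamma> p * k))"
          by (rule analytic_at_interior_iff[OF rep(1) fhol nz, of l, unfolded rep(2), folded point_index_def]) blast
        from SH p have "\<exists>k::nat. zorder f (representative \<Gamma> p) = int (l * (point_index \<Gamma> p - 1) + point_index \<Gamma> p * k)"
          by blast
        then have "\<phi> (V, s) analytic_on {s p}" unfolding V(3) by (rule V(4)[OF pb nm[OF V(1)], THEN iffD2])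
        then show ?thesis using V(1,2) by blast
      next
        assume p: "p \<in> cusp_points \<Gamma>"
        then obtain x where x: "x \<in> cusps \<Gamma>" "p = orb \<Gamma> x" by (auto simp: cusp_points_def)
        obtain \<sigma> h where frame: "cusp_frame \<Gamma> x \<sigma> h" by (rule cusp_frame_exists[OF x(1)])
        obtain a where a: "fourier_expansion (2 * l) f \<sigma> h a" by (rule fourier_expansion_any_frame[OF fm frame x(1)])
        have "a n = 0" if n: "n < l" for n
        proof -
          have "n < cusp_order \<Gamma> (2 * l) f p" using SH p n by fastforce
          then show ?thesis using not_less_Least x frame a unfolding cusp_order_def by blast
        qed
        then show ?thesis
          using analytic_at_cusp_iff[OF x(1) frame a] pb nm unfolding x(2) by metis
      qed
    qed
  next
    fix b assume hol: "\<phi> \<in> holomorphic_differentials (surface_atlas \<Gamma>) l" and b: "b \<in> cusp_points \<Gamma>"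
    have vanish: "a n = 0" if prem: "x \<in> cusps \<Gamma>" "cusp_frame \<Gamma> x \<sigma> h" "fourier_expansion (2 * l) f \<sigma> h a" "n < l" for x \<sigma> h a n
    proof -
      obtain V s where V: "(V, s) \<in> surface_atlas \<Gamma>" "orb \<Gamma> x \<in> V" "s (orb \<Gamma> x) = 0"
        "\<And>\<phi>. pulls_back_off_centre l \<phi> f \<Longrightarrow> \<phi> (V, s) nicely_meromorphic_on s ` V \<Longrightarrow>
           \<phi> (V, s) analytic_on {0} \<longleftrightarrow> (\<forall>n<l. a n = 0)"
        by (rule analytic_at_cusp_iff[OF prem(1-3)]) blast
      have "\<phi> (V, s) analytic_on {0}"
        using holomorphic_differential_analytic[OF hol V(1,2)] V(3) by simp
      then show ?thesis using V(4)[OF pb nm[OF V(1)]] prem(4) by simp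
    qed
    obtain x where x: "x \<in> cusps \<Gamma>" "b = orb \<Gamma> x" using b by (auto simp: cusp_points_def)
    obtain \<sigma> h where frame: "cusp_frame \<Gamma> x \<sigma> h" by (rule cusp_frame_exists[OF x(1)])
    note d = cusp_frameD[OF frame]
    obtain a where a: "fourier_expansion (2 * l) f \<sigma> h a" by (rule fourier_expansion_any_frame[OF fm frame x(1)])
    have "\<exists>n. a n \<noteq> 0"
    proof (rule ccontr)
      assume "\<not> ?thesis"
      then have "(\<lambda>n. 0) sums (f z * autf \<sigma> z ^ (2 * l))" if "z \<in> uhp" for z
        using a that by (simp add: fourier_expansion_iff[OF d(1)])
      then have "f z * autf \<sigma> z ^ (2 * l) = 0" if "z \<in> uhp" for z using that sums_unique2[OF _ sums_zero] by blast
      then show False using nz autf_nonzero[OF d(1)] by auto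
    qed
    then have "\<exists>n. \<exists>x\<in>cusps \<Gamma>. \<exists>\<sigma> h a. orb \<Gamma> x = b \<and> cusp_frame \<Gamma> x \<sigma> h \<and> fourier_expansion (2 * l) f \<sigma> h a \<and> a n \<noteq> 0"
      using x frame a by blast
    then have "\<exists>x\<in>cusps \<Gamma>. \<exists>\<sigma> h a. orb \<Gamma> x = b \<and> cusp_frame \<Gamma> x \<sigma> h \<and> fourier_expansion (2 * l) f \<sigma> h a \<and> a (cusp_order \<Gamma> (2 * l) f b) \<noteq> 0"
      unfolding cusp_order_def by (rule LeastI_ex)
    then show "cusp_order \<Gamma> (2 * l) f b \<ge> l" using vanish by (meson not_less)
  next
    fix p assume hol: "\<phi> \<in> holomorphic_differentials (surface_atlas \<Gamma>) l" and p: "p \<in> quot_map \<Gamma> ` uhp"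
    note rep = representative[OF p]
    obtain V s where V: "(V, s) \<in> surface_atlas \<Gamma>" "p \<in> V" "s p = 0"
      "\<And>\<phi>. pulls_back_off_centre l \<phi> f \<Longrightarrow> \<phi> (V, s) nicely_meromorphic_on s ` V \<Longrightarrow>
         \<phi> (V, s) analytic_on {0} \<longleftrightarrow> (\<exists>k::nat. zorder f (representative \<Gamma> p) = int (l * (point_index \<Gamma> p - 1) + point_index \<Gamma> p * k))"
      by (rule analytic_at_interior_iff[OF rep(1) fhol nz, of l, unfolded rep(2), folded point_index_def]) blast
    have "\<phi> (V, s) analytic_on {0}"
      using holomorphic_differential_analytic[OF hol V(1,2)] V(3) by simp
    then show "\<exists>k::nat. zorder f (representative \<Gamma> p) = int (l * (point_index \<Gamma> p - 1) + point_index \<Gamma> p * k)"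
      using V(4)[OF pb nm[OF V(1)]] by simp
  qed
  finally show ?thesis by (simp add: \<phi>_def)
qed

lemma holomorphic_differentialI:
  assumes "\<And>c. c \<notin> surface_atlas \<Gamma> \<Longrightarrow> \<phi> c = (\<lambda>_. 0)"
    "\<And>U t. (U, t) \<in> surface_atlas \<Gamma> \<Longrightarrow> \<phi> (U, t) holomorphic_on t ` U"
    "\<And>U t u. (U, t) \<in> surface_atlas \<Gamma> \<Longrightarrow> u \<notin> t ` U \<Longrightarrow> \<phi> (U, t) u = 0"
    "\<And>U t V s p. (U, t) \<in> surface_atlas \<Gamma> \<Longrightarrow> (V, s) \<in> surface_atlas \<Gamma> \<Longrightarrow> p \<in> U \<Longrightarrow> p \<in> V \<Longrightarrow>
       \<phi> (U, t) (t p) = \<phi> (V, s) (s p) * deriv (s \<circ> inv_into U t) (t p) ^ l"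
  shows "\<phi> \<in> holomorphic_differentials (surface_atlas \<Gamma>) l"
proof -
  have "\<phi> (U, t) nicely_meromorphic_on t ` U" if "(U, t) \<in> surface_atlas \<Gamma>" for U t
    using assms(2)[OF that] atlas_branched(6)[OF that]
    by (intro analytic_on_imp_nicely_meromorphic_on) (simp add: analytic_on_open)
  then show ?thesis
    unfolding holomorphic_differentials_def meromorphic_differentials_def mem_Collect_eq
    using assms by (intro conjI) blast+
qed

lemma holomorphic_differentialD:
  assumes "\<phi> \<in> holomorphic_differentials (surface_atlas \<Gamma>) l"
  shows "\<phi> \<in> meromorphic_differentials (surface_atlas \<Gamma>) l"
    "\<And>U t. (U, t) \<in> surface_atlas \<Gamma> \<Longrightarrow> \<phi> (U, t) holomorphic_on t ` U"
  using assms unfolding holomorphic_differentials_def by auto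

lemma holomorphic_differentials_add:
  assumes \<phi>: "\<phi> \<in> holomorphic_differentials (surface_atlas \<Gamma>) l" and \<psi>: "\<psi> \<in> holomorphic_differentials (surface_atlas \<Gamma>) l"
  shows "\<phi> + \<psi> \<in> holomorphic_differentials (surface_atlas \<Gamma>) l"
proof (rule holomorphic_differentialI)
  note m = meromorphic_differentialD[OF holomorphic_differentialD(1)[OF \<phi>]]
  note n = meromorphic_differentialD[OF holomorphic_differentialD(1)[OF \<psi>]]
  show "(\<phi> + \<psi>) c = (\<lambda>_. 0)" if "c \<notin> surface_atlas \<Gamma>" for c
    using m(1)[OF that] n(1)[OF that] by (simp add: fun_eq_iff)
  show "(\<phi> + \<psi>) (U, t) holomorphic_on t ` U" if "(U, t) \<in> surface_atlas \<Gamma>" for U t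
    using holomorphic_differentialD(2)[OF \<phi> that] holomorphic_differentialD(2)[OF \<psi> that]
    by (auto simp: plus_fun_def intro: holomorphic_on_add)
  show "(\<phi> + \<psi>) (U, t) u = 0" if "(U, t) \<in> surface_atlas \<Gamma>" "u \<notin> t ` U" for U t u
    using m(3)[OF that] n(3)[OF that] by simp
  show "(\<phi> + \<psi>) (U, t) (t p) = (\<phi> + \<psi>) (V, s) (s p) * deriv (s \<circ> inv_into U t) (t p) ^ l"
    if "(U, t) \<in> surface_atlas \<Gamma>" "(V, s) \<in> surface_atlas \<Gamma>" "p \<in> U" "p \<in> V" for U t V s p
    using m(4)[OF that] n(4)[OF that] by (simp add: distrib_right)
qed

lemma holomorphic_differentials_scale:
  assumes \<phi>: "\<phi> \<in> holomorphic_differentials (surface_atlas \<Gamma>) l"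
  shows "scale_mdiff c \<phi> \<in> holomorphic_differentials (surface_atlas \<Gamma>) l"
proof (rule holomorphic_differentialI)
  note m = meromorphic_differentialD[OF holomorphic_differentialD(1)[OF \<phi>]]
  show "scale_mdiff c \<phi> ch = (\<lambda>_. 0)" if "ch \<notin> surface_atlas \<Gamma>" for ch
    using m(1)[OF that] by (simp add: fun_eq_iff scale_mdiff_def)
  show "scale_mdiff c \<phi> (U, t) holomorphic_on t ` U" if "(U, t) \<in> surface_atlas \<Gamma>" for U t
    using holomorphic_differentialD(2)[OF \<phi> that] by (auto simp: scale_mdiff_def intro!: holomorphic_intros)
  show "scale_mdiff c \<phi> (U, t) u = 0" if "(U, t) \<in> surface_atlas \<Gamma>" "u \<notin> t ` U" for U t u
    using m(3)[OF that] by (simp add: scale_mdiff_def)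
  show "scale_mdiff c \<phi> (U, t) (t p) = scale_mdiff c \<phi> (V, s) (s p) * deriv (s \<circ> inv_into U t) (t p) ^ l"
    if "(U, t) \<in> surface_atlas \<Gamma>" "(V, s) \<in> surface_atlas \<Gamma>" "p \<in> U" "p \<in> V" for U t V s p
    using m(4)[OF that] by (simp add: scale_mdiff_def mult.assoc)
qed

lemma pulls_back_off_centre_add:
  "pulls_back_off_centre l \<phi> f \<Longrightarrow> pulls_back_off_centre l \<psi> g \<Longrightarrow> pulls_back_off_centre l (\<phi> + \<psi>) (f + g)"
  unfolding pulls_back_off_centre_def by (fastforce simp: distrib_right)

lemma pulls_back_off_centre_scale:
  "pulls_back_off_centre l \<phi> f \<Longrightarrow> pulls_back_off_centre l (scale_mdiff c \<phi>) (scale_form c f)"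
  unfolding pulls_back_off_centre_def by (fastforce simp: scale_mdiff_def scale_form_def mult.assoc)

text \<open>Two forms with the same differential agree near every point, except possibly at the point; then they
agree by continuity.\<close>

lemma form_determined_by_differential:
  assumes f: "f \<in> modular_forms \<Gamma> m" and g: "g \<in> modular_forms \<Gamma> m"
    and pb: "pulls_back_off_centre l \<phi> f" "pulls_back_off_centre l \<phi> g"
  shows "f = g"
proof
  fix z
  show "f z = g z"
  proof (cases "z \<in> uhp")
    case True
    obtain U t where ch: "(U, t) \<in> surface_atlas \<Gamma>" "z \<in> preim U" by (rule chart_at[OF True])
    have "\<forall>\<^sub>F w in at z. f w = g w"
      using atlas_branched(5)[OF ch]
      by eventually_elim (use pulls_back_off_centreD[OF pb(1) ch(1)] pulls_back_off_centreD[OF pb(2) ch(1)] in auto)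
    moreover have "isCont f z" "isCont g z"
      using f g True unfolding modular_forms_def
      by (auto intro: continuous_on_interior holomorphic_on_imp_continuous_on simp: interior_open)
    ultimately have "g \<midarrow>z\<rightarrow> f z" "g \<midarrow>z\<rightarrow> g z"
      unfolding isCont_def by (blast intro: Lim_transform_eventually)+
    then show ?thesis by (rule LIM_unique)
  next
    case False
    then show ?thesis using f g by (simp add: modular_forms_def)
  qed
qed

lemma SH_forms_eq:
  assumes "l > 0"
  shows "SH_forms \<Gamma> (2 * l) = {f \<in> cusp_forms \<Gamma> (2 * l). form_differential \<Gamma> (2 * l) f \<in> holomorphic_differentials (surface_atlas \<Gamma>) l}"
  using SH_forms_iff[OF _ assms] by (auto simp: SH_forms_def)

lemma form_differential_linear_iso:
  assumes l: "l > 0"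
  shows "linear_iso scale_form (SH_forms \<Gamma> (2 * l)) scale_mdiff (holomorphic_differentials (surface_atlas \<Gamma>) l)
           (form_differential \<Gamma> (2 * l))"
proof -
  let ?H = "holomorphic_differentials (surface_atlas \<Gamma>) l" and ?T = "form_differential \<Gamma> (2 * l)" and ?S = "SH_forms \<Gamma> (2 * l)"
  note SH = SH_forms_eq[OF l]
  have fd: "f \<in> modular_forms \<Gamma> (2 * l)" "f \<in> cusp_forms \<Gamma> (2 * l)" "?T f \<in> ?H" "pulls_back_off_centre l (?T f) f" if "f \<in> ?S" for f
    using that form_differential(2)[OF cusp_forms_modular, of f l] cusp_forms_modular unfolding SH by auto
  have add: "?T (f + g) = ?T f + ?T g" if "f \<in> ?S" "g \<in> ?S" for f g
    by (rule form_differential_eqI[OF holomorphic_differentialD(1) pulls_back_off_centre_imp])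
       (use fd that in \<open>auto intro: holomorphic_differentials_add pulls_back_off_centre_add\<close>)
  have scale: "?T (scale_form c f) = scale_mdiff c (?T f)" if "f \<in> ?S" for c f
    by (rule form_differential_eqI[OF holomorphic_differentialD(1) pulls_back_off_centre_imp])
       (use fd that in \<open>auto intro: holomorphic_differentials_scale pulls_back_off_centre_scale\<close>)
  have "module.subspace scale_form ?S"
    unfolding module.subspace_def[OF module_scale_form]
  proof (intro conjI ballI allI)
    show "0 \<in> ?S" using cusp_forms_zero by (simp add: SH_forms_def)
    show "f + g \<in> ?S" if "f \<in> ?S" "g \<in> ?S" for f g
      using fd[OF that(1)] fd[OF that(2)] add[OF that] by (simp add: SH cusp_forms_add holomorphic_differentials_add)
    show "scale_form c f \<in> ?S" if "f \<in> ?S" for c f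
      using fd[OF that] scale[OF that] by (simp add: SH cusp_forms_scale holomorphic_differentials_scale)
  qed
  moreover have "module.subspace scale_mdiff ?H"
    unfolding module.subspace_def[OF module_scale_mdiff]
    using zero_differential[OF l] holomorphic_differentials_add holomorphic_differentials_scale by blast
  moreover have "bij_betw ?T ?S ?H"
  proof (rule bij_betw_imageI)
    show "inj_on ?T ?S"
      by (rule inj_onI) (metis fd form_determined_by_differential)
    show "?T ` ?S = ?H"
    proof (intro equalityI subsetI)
      fix \<phi> assume \<phi>: "\<phi> \<in> ?H"
      obtain f where f: "f \<in> cusp_forms \<Gamma> (2 * l)" "pulls_back_off_centre l \<phi> f"
        by (rule form_of_holomorphic_differential[OF \<phi> l])
      have "?T f = \<phi>"
        by (rule form_differential_eqI[OF holomorphic_differentialD(1)[OF \<phi>] pulls_back_off_centre_imp[OF f(2)]])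
      then show "\<phi> \<in> ?T ` ?S" using f(1) \<phi> by (auto simp: SH)
    qed (use fd in auto)
  qed
  ultimately show ?thesis unfolding linear_iso_def using add scale by blast
qed

end

theorem theorem1p2:
  fixes \<Gamma> :: "(real^2^2) set" and m :: nat
  assumes "fuchsian_first_kind \<Gamma>" and "even m" and "m \<ge> 4"
  shows "form_differential \<Gamma> m \<in>
           cusp_forms \<Gamma> m \<rightarrow> meromorphic_differentials (surface_atlas \<Gamma>) (m div 2) \<and>
         linear_iso scale_form (SH_forms \<Gamma> m)
           scale_mdiff (holomorphic_differentials (surface_atlas \<Gamma>) (m div 2))
           (form_differential \<Gamma> m)"
proof -
  interpret discrete_SL2_subgroup \<Gamma>
    using assms(1) by (simp add: fuchsian_first_kind_def discrete_SL2_subgroup_def)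
  obtain l where l: "m = 2 * l" using assms(2) by (rule evenE)
  then have "l > 0" using assms(3) by simp
  then show ?thesis
    using form_differential(1)[OF cusp_forms_modular] form_differential_linear_iso unfolding l by simp
qed

end
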